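(* Let $n=3$, $n'=5$ and let $m,m'\ge2$ be integers. Suppose $X\subseteq\mathcal T(n,m)$ contains nondegenerate tilings, is invariant under $\mathrm{PSL}(2,\mathbb R)$ and closed, and suppose $Y\subseteq\mathcal T(n',m')$ is invariant under $\mathrm{PSL}(2,\mathbb R)$ and closed. Then the actions of $\mathrm{PSL}(2,\mathbb R)$ on $X$ and $Y$ are not topologically conjugate.
   Context: Work in the upper half-plane model of $\mathbb H^2$, with orientation-preserving isometry group $\mathrm{PSL}(2,\mathbb R)$ acting by Möbius maps. Let $n\ge3$, $m\ge2$ be integers, $\lambda=\lambda_n=2\cos(\pi/n)$, and let $G_n\subset\mathrm{PSL}(2,\mathbb R)$ be the Hecke group generated by $z\mapsto-1/z$ and $z\mapsto z+\lambda$. Let $\mathcal F_n$ be the packing by horoballs consisting of all images of $\{y\ge1\}$ under $G_n$; the closures of the components of the complement of its union are called $n$-gons (each bounded by arcs of $n$ cyclically tangent horoballs). The $(n,m)$ tile: start with the core $\gamma=\{x+iy:0\le x\le m\lambda,\ 1\le y\le m\}$. Attach below it $m$ prongs: the region bounded by the horocyclic segment from $i$ to $i+\lambda$ and the geodesic segments from $i$ and $i+\lambda$ to $e^{i\pi/n}$ (one $n$-th of an $n$-gon), and its translates by $\lambda,\dots,(m-1)\lambda$. Remove from the top a dent: the image of the first prong under $z\mapsto mz$. Add a small bump on the left vertical edge and remove the matching dent (its translate by $m\lambda$) on the right one, so that tiles meeting along vertical edges must be positioned like $\gamma$ and $\gamma+m\lambda$. $\mathcal T(n,m)$ is the space of all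 tilings of $\mathbb H^2$ by images of this tile under $\mathrm{PSL}(2,\mathbb R)$. A tiling is identified with the set of $g\in\mathrm{PSL}(2,\mathbb R)$ placing its tiles; the topology is that of convergence on compact sets (Fell topology on closed subsets of $\mathrm{PSL}(2,\mathbb R)$), which is compact metrizable, and $\mathrm{PSL}(2,\mathbb R)$ acts continuously. The tilings in $\mathcal T(n,m)$ are of two kinds. Nondegenerate: the union of the cores is the union of a horoball packing $h(T)=g\mathcal F_n$, $g\in\mathrm{PSL}(2,\mathbb R)$, and each horoball is tiled by cores as follows (independently for different horoballs): after an isometry in $\mathrm{PSL}(2,\mathbb R)$ taking the horoball to $\{y\ge1\}$ and its tangency points with other horoballs to $i+l\lambda$, $l\in\mathbb Z$, the cores are the sets $\{\lambda(c_j+m^{j+1}l)\le x\le\lambda(c_j+m^{j+1}(l+1)),\ m^j\le y\le m^{j+1}\}$, $j\ge0$, $l\in\mathbb Z$, where $c_j\in\mathbb Z$ and $c_{j+1}\equiv c_j\pmod{m^{j+1}}$. Degenerate: the cores themselves tile $\mathbb H^2$; up to an isometry they are given by the same formula with $j$ ranging over all of $\mathbb Z$, $c_j\in\mathbb R$ and $c_{j+1}-c_j\in m^{j+1}\mathbb Z$. Actions of $G$ on $X$ and $Y$ are topologically conjugate if there is a homeomorphism $\alpha:X\to Y$ with $\alpha(g(x))=g(\alpha(x))$ for all $g\in G$, $x\in X$. *)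

theory Defs
  imports "HOL-Analysis.Analysis"
begin

section \<open>The topological group PSL(2,R) and its action on the upper half-plane\<close>

quotient_type psl2 = "real^2^2" / partial: "\<lambda>A B. det A = 1 \<and> det B = 1 \<and> (A = B \<or> A = - B)"
proof (rule part_equivpI)
  show "\<exists>A::real^2^2. det A = 1 \<and> det A = 1 \<and> (A = A \<or> A = - A)"
    by (rule exI[of _ "mat 1"]) simp
  show "symp (\<lambda>A B::real^2^2. det A = 1 \<and> det B = 1 \<and> (A = B \<or> A = - B))"
    by (auto simp: symp_def)
  show "transp (\<lambda>A B::real^2^2. det A = 1 \<and> det B = 1 \<and> (A = B \<or> A = - B))"
    by (auto simp: transp_def)
qed

lemma matrix_mul_uminus_left: "(- A) ** (B::real^2^2) = - (A ** B)"
  by (simp add: vec_eq_iff matrix_matrix_mult_def sum_negf)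

lemma matrix_mul_uminus_right: "A ** (- B::real^2^2) = - (A ** B)"
  by (simp add: vec_eq_iff matrix_matrix_mult_def sum_negf)

definition adjugate2 :: "real^2^2 \<Rightarrow> real^2^2" where
  "adjugate2 A = vector [vector [A$2$2, - A$1$2], vector [- A$2$1, A$1$1]]"

instantiation psl2 :: "{monoid_mult, inverse}"
begin

lift_definition one_psl2 :: psl2 is "mat 1"
  by simp

lift_definition times_psl2 :: "psl2 \<Rightarrow> psl2 \<Rightarrow> psl2" is "(**)"
  by (auto simp: det_mul matrix_mul_uminus_left matrix_mul_uminus_right)

lift_definition inverse_psl2 :: "psl2 \<Rightarrow> psl2" is adjugate2
  by (auto simp: adjugate2_def det_2 vec_eq_iff forall_2 algebra_simps)

definition divide_psl2 :: "psl2 \<Rightarrow> psl2 \<Rightarrow> psl2" where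
  "divide_psl2 g h = g * inverse h"

instance
  by standard (transfer, auto simp: matrix_mul_assoc det_mul)+

end

lemma psl2_left_inverse: "inverse g * g = (1::psl2)"
  by transfer (auto simp: adjugate2_def det_2 vec_eq_iff forall_2 matrix_matrix_mult_def
      mat_def sum_2 algebra_simps)

instantiation psl2 :: topological_space
begin

text \<open>Quotient topology of the subspace topology on the matrices of determinant 1.\<close>

definition open_psl2 :: "psl2 set \<Rightarrow> bool" where
  "open_psl2 U \<longleftrightarrow> openin (top_of_set {A. det A = 1}) {A. det A = 1 \<and> abs_psl2 A \<in> U}"

instance
proof
  show "open (UNIV::psl2 set)"
    unfolding open_psl2_def by simp
next
  fix U V :: "psl2 set"
  assume "open U" "open V"
  then have "openin (top_of_set {A. det A = 1})
      ({A. det A = 1 \<and> abs_psl2 A \<in> U} \<inter> {A. det A = 1 \<and> abs_psl2 A \<in> V})"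
    unfolding open_psl2_def by (rule openin_Int)
  moreover have "{A. det A = 1 \<and> abs_psl2 A \<in> U} \<inter> {A. det A = 1 \<and> abs_psl2 A \<in> V}
      = {A. det A = 1 \<and> abs_psl2 A \<in> U \<inter> V}" by auto
  ultimately show "open (U \<inter> V)"
    unfolding open_psl2_def by simp
next
  fix K :: "psl2 set set"
  assume "\<forall>U\<in>K. open U"
  then have "openin (top_of_set {A. det A = 1}) (\<Union>U\<in>K. {A. det A = 1 \<and> abs_psl2 A \<in> U})"
    unfolding open_psl2_def by (intro openin_Union) auto
  moreover have "(\<Union>U\<in>K. {A. det A = 1 \<and> abs_psl2 A \<in> U})
      = {A. det A = 1 \<and> abs_psl2 A \<in> \<Union>K}" by auto
  ultimately show "open (\<Union>K)"
    unfolding open_psl2_def by simp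
qed

end

definition upper_half_plane :: "complex set" where
  "upper_half_plane = {z. Im z > 0}"

lift_definition mobius :: "psl2 \<Rightarrow> complex \<Rightarrow> complex" is
  "\<lambda>A z. (of_real (A$1$1) * z + of_real (A$1$2)) / (of_real (A$2$1) * z + of_real (A$2$2))"
proof -
  fix A B :: "real^2^2"
  assume AB: "det A = 1 \<and> det B = 1 \<and> (A = B \<or> A = - B)"
  have neg: "(- a * z + - b) / (- c * z + - d) = (a * z + b) / (c * z + d)"
    for a b c d z :: complex
  proof -
    have "- a * z + - b = - (a * z + b)" "- c * z + - d = - (c * z + d)"
      by simp_all
    then show ?thesis
      by (simp only: minus_divide_left[symmetric] minus_divide_right[symmetric] minus_minus)
  qed
  show "(\<lambda>z. (of_real (A$1$1) * z + of_real (A$1$2)) /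
        (of_real (A$2$1) * z + of_real (A$2$2)) :: complex) =
      (\<lambda>z. (of_real (B$1$1) * z + of_real (B$1$2)) /
        (of_real (B$2$1) * z + of_real (B$2$2)))"
    using AB by (elim conjE disjE)
      (simp_all only: vector_uminus_component of_real_minus neg)
qed

text \<open>\<open>psl2_translation t\<close> is \<open>z \<mapsto> z + t\<close>, and \<open>psl2_inversion\<close> is \<open>z \<mapsto> -1/z\<close>.\<close>

lift_definition psl2_translation :: "real \<Rightarrow> psl2" is
  "\<lambda>t. vector [vector [1, t], vector [0, 1]]"
  by (simp add: det_2)

lift_definition psl2_inversion :: psl2 is
  "vector [vector [0, -1], vector [1, 0]]"
  by (simp add: det_2)

lemma mobius_translation: "mobius (psl2_translation t) z = z + of_real t"
  by transfer simp

lemma mobius_inversion: "mobius psl2_inversion z = - 1 / z"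
  by transfer simp

lemma mobius_mult:
  assumes "z \<in> upper_half_plane"
  shows "mobius (g * h) z = mobius g (mobius h z)"
  using assms
proof (transfer)
  fix z and A B :: "real^2^2"
  assume z: "z \<in> upper_half_plane"
    and "det A = 1 \<and> det A = 1 \<and> (A = A \<or> A = - A)"
    and B: "det B = 1 \<and> det B = 1 \<and> (B = B \<or> B = - B)"
  define a b c d where "a = complex_of_real (B$1$1)" and "b = complex_of_real (B$1$2)"
    and "c = complex_of_real (B$2$1)" and "d = complex_of_real (B$2$2)"
  have nz: "c * z + d \<noteq> 0"
    using z B by (auto simp: c_def d_def complex_eq_iff upper_half_plane_def det_2)
  have eq: "p * ((a * z + b) / (c * z + d)) + q
      = ((p * a + q * c) * z + (p * b + q * d)) / (c * z + d)" for p q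
  proof -
    have "p * ((a * z + b) / (c * z + d)) + q
        = (p * (a * z + b) + q * (c * z + d)) / (c * z + d)"
      using nz by (simp add: add_divide_distrib[of "p * (a * z + b)"])
    also have "p * (a * z + b) + q * (c * z + d) = (p * a + q * c) * z + (p * b + q * d)"
      by (simp add: algebra_simps)
    finally show ?thesis .
  qed
  have cancel: "(x / (c * z + d)) / (y / (c * z + d)) = x / y" for x y
    using nz by simp
  show "(of_real ((A ** B)$1$1) * z + of_real ((A ** B)$1$2)) /
        (of_real ((A ** B)$2$1) * z + of_real ((A ** B)$2$2)) =
      (of_real (A$1$1) * ((of_real (B$1$1) * z + of_real (B$1$2)) /
          (of_real (B$2$1) * z + of_real (B$2$2))) + of_real (A$1$2)) /
      (of_real (A$2$1) * ((of_real (B$1$1) * z + of_real (B$1$2)) /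
          (of_real (B$2$1) * z + of_real (B$2$2))) + (of_real (A$2$2) :: complex))"
    unfolding a_def[symmetric] b_def[symmetric] c_def[symmetric] d_def[symmetric] eq cancel
    by (simp add: matrix_matrix_mult_def sum_2 a_def b_def c_def d_def)
qed

section \<open>Hecke groups and horoball packings\<close>

definition hecke_width :: "nat \<Rightarrow> real" where
  "hecke_width n = 2 * cos (pi / real n)"

inductive_set hecke_group :: "nat \<Rightarrow> psl2 set" for n :: nat where
  one: "1 \<in> hecke_group n"
| inversion: "psl2_inversion \<in> hecke_group n"
| translation: "psl2_translation (hecke_width n) \<in> hecke_group n"
| mult: "g \<in> hecke_group n \<Longrightarrow> h \<in> hecke_group n \<Longrightarrow> g * h \<in> hecke_group n"
| inverse: "g \<in> hecke_group n \<Longrightarrow> inverse g \<in> hecke_group n"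

definition horoball_packing :: "nat \<Rightarrow> complex set set" where
  "horoball_packing n = (\<lambda>g. mobius g ` {z. Im z \<ge> 1}) ` hecke_group n"

section \<open>The tile\<close>

definition core :: "nat \<Rightarrow> nat \<Rightarrow> complex set" where
  "core n m = {z. 0 \<le> Re z \<and> Re z \<le> real m * hecke_width n \<and> 1 \<le> Im z \<and> Im z \<le> real m}"

text \<open>
  The geodesics from \<open>\<i>\<close> and from \<open>\<i> + \<lambda>\<close> to \<open>exp (\<i> * pi / n)\<close> lie on the unit circles
  around \<open>0\<close> and \<open>\<lambda>\<close>, where \<open>\<lambda> = hecke_width n\<close>; the prong is the region above both circles
  and below the horocycle \<open>Im z = 1\<close>.
\<close>

definition prong :: "nat \<Rightarrow> complex set" where
  "prong n = {z. 0 \<le> Re z \<and> Re z \<le> hecke_width n \<and> 0 < Im z \<and> Im z \<le> 1 \<and>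
                 1 \<le> cmod z \<and> 1 \<le> cmod (z - of_real (hecke_width n))}"

definition core_with_prongs :: "nat \<Rightarrow> nat \<Rightarrow> complex set" where
  "core_with_prongs n m =
     core n m \<union> (\<Union>k<m. (\<lambda>z. z + of_real (real k * hecke_width n)) ` prong n)"

definition top_dent :: "nat \<Rightarrow> nat \<Rightarrow> complex set" where
  "top_dent n m = (\<lambda>z. of_nat m * z) ` prong n"

text \<open>
  The tile, with a bump \<open>B\<close> added on the left and the translate of \<open>B\<close> removed on the right.
  The closure puts back the boundary of the two removed pieces.
\<close>

definition tile :: "nat \<Rightarrow> nat \<Rightarrow> complex set \<Rightarrow> complex set" where
  "tile n m B = closure ((core_with_prongs n m \<union> B) -
     (top_dent n m \<union> (\<lambda>z. z + of_real (real m * hecke_width n)) ` B))"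

section \<open>Tilings\<close>

text \<open>A tiling is represented by the set of group elements that place its tiles.\<close>

definition tilings :: "nat \<Rightarrow> nat \<Rightarrow> complex set \<Rightarrow> psl2 set set" where
  "tilings n m B = {S. (\<Union>g\<in>S. mobius g ` tile n m B) = upper_half_plane \<and>
     (\<forall>g\<in>S. \<forall>h\<in>S. g \<noteq> h \<longrightarrow>
        interior (mobius g ` tile n m B) \<inter> interior (mobius h ` tile n m B) = {})}"

text \<open>
  The shape of the bump is left open. It is a region attached to the left vertical edge of the
  core along a segment away from the corners, it is so small that its translate lies in the tile
  and away from the rest of the boundary, and it serves its purpose: in every tiling, the
  neighbours of a tile across its two vertical edges are its translates by \<open>\<plusminus> m \<lambda>\<close> in the
  coordinates of the tile.
\<close>

definition bump_region :: "nat \<Rightarrow> nat \<Rightarrow> complex set \<Rightarrow> bool" where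
  "bump_region n m B \<longleftrightarrow>
     compact B \<and> connected B \<and> closure (interior B) = B \<and>
     (\<exists>a b. 1 < a \<and> a < b \<and> b < real m \<and>
        B \<inter> {z. Re z = 0} = {z. Re z = 0 \<and> a \<le> Im z \<and> Im z \<le> b}) \<and>
     (\<lambda>z. z + of_real (real m * hecke_width n)) ` B
       \<subseteq> interior (tile n m {}) \<union>
          {z. Re z = real m * hecke_width n \<and> 1 < Im z \<and> Im z < real m}"

definition admissible_bump :: "nat \<Rightarrow> nat \<Rightarrow> complex set \<Rightarrow> bool" where
  "admissible_bump n m B \<longleftrightarrow> bump_region n m B \<and>
     (\<forall>S\<in>tilings n m B. \<forall>g\<in>S.
        g * psl2_translation (real m * hecke_width n) \<in> S \<and>
        g * psl2_translation (- (real m * hecke_width n)) \<in> S)"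

definition nondegenerate :: "nat \<Rightarrow> nat \<Rightarrow> psl2 set \<Rightarrow> bool" where
  "nondegenerate n m S \<longleftrightarrow>
     (\<exists>g. (\<Union>h\<in>S. mobius h ` core n m) = mobius g ` \<Union>(horoball_packing n))"

section \<open>The space of tilings and topological conjugacy\<close>

text \<open>
  The Fell topology on closed sets, that is, convergence on compact sets. Its subbasic open sets
  consist of the closed sets that miss a given compact set or hit a given open set.
\<close>

definition fell_topology :: "'a::topological_space set topology" where
  "fell_topology = topology_generated_by
     ({{C. closed C \<and> C \<inter> K = {}} |K. compact K} \<union>
      {{C. closed C \<and> C \<inter> U \<noteq> {}} |U. open U})"

lemma topspace_fell_topology: "topspace fell_topology = {C. closed C}"
proof -
  have "{C. closed C \<and> C \<inter> {} = {}} \<in> {{C. closed C \<and> C \<inter> K = {}} |K::'a set. compact K}"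
    by blast
  then show ?thesis
    unfolding fell_topology_def topology_generated_by_topspace by auto
qed

definition tiling_space :: "nat \<Rightarrow> nat \<Rightarrow> complex set \<Rightarrow> psl2 set topology" where
  "tiling_space n m B = subtopology fell_topology (tilings n m B)"

text \<open>The tile placed by \<open>h\<close> is moved by \<open>g\<close> to the tile placed by \<open>g * h\<close>.\<close>

definition move_tiling :: "psl2 \<Rightarrow> psl2 set \<Rightarrow> psl2 set" where
  "move_tiling g S = (\<lambda>h. g * h) ` S"

definition topologically_conjugate ::
  "('g \<Rightarrow> 'x \<Rightarrow> 'x) \<Rightarrow> 'x topology \<Rightarrow> ('g \<Rightarrow> 'y \<Rightarrow> 'y) \<Rightarrow> 'y topology \<Rightarrow> bool" where
  "topologically_conjugate act X act' Y \<longleftrightarrow>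
     (\<exists>\<alpha>. homeomorphic_map X Y \<alpha> \<and>
        (\<forall>g. \<forall>x\<in>topspace X. \<alpha> (act g x) = act' g (\<alpha> x)))"

end

theory Submission
  imports Defs
begin

text \<open>
A placement \<open>g\<close> of a tile determines the horoball \<open>g {Im z > 1}\<close>, tangent to the boundary of the
half-plane at its base point \<open>g \<infinity>\<close>. The idea of the proof is that an equivariant homeomorphism
\<open>\<alpha>\<close> from \<open>X\<close> to \<open>Y\<close> cannot create base points: if \<open>S\<close> is nondegenerate, then every base point of
\<open>\<alpha> S\<close> is a base point of the packing \<open>h(S) = g F_3\<close> and so lies in the image under \<open>g\<close> of the
projective line over the rationals. But \<open>\<alpha> S\<close> is not degenerate, and in a tiling with \<open>n = 5\<close> that
is not degenerate five horoballs surround some vertex; four of their base points have a cross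
ratio equal to the golden ratio \<open>2 cos (\<pi>/5)\<close>, whereas the cross ratio of four rational points is
rational.

Why base points are preserved. After an isometry, all base points of a degenerate tiling are \<open>\<infinity>\<close>; from
now on, only tilings with this property are called degenerate. The tiles of
such a tiling \<open>E\<close> of \<open>Y\<close> form horizontal rows whose heights are \<open>\<sigma> m'^j\<close> for all integers \<open>j\<close>, and
the translation by \<open>t = \<sigma> \<lambda> m'^j\<close> preserves all rows of height at most \<open>\<sigma> m'^(j-1)\<close>. Hence \<open>E\<close> and
its translate by \<open>t\<close>, both moved by an isometry \<open>p\<close> fixing \<open>\<infinity>\<close>, agree on large compact sets as soon
as \<open>p\<close> stretches enough (\<open>degenerate_agreement\<close>). The space of tilings is compact, so their images
under the inverse of \<open>\<alpha>\<close> cannot be told apart by open conditions either (\<open>transfer\<close>). If the preimage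
\<open>D\<close> of \<open>E\<close> had a horoball with base point \<open>0\<close>, then one could choose \<open>p\<close> so that this horoball, seen
from the point \<open>\<i>\<close>, is nearly horizontal and so that the translation by \<open>t\<close> moves its boundary
visibly; as horoballs with different base points are disjoint, this is impossible. So \<open>D\<close> is
degenerate too (\<open>degenerate_preimage\<close>). If now \<open>\<alpha> S\<close> has the base point \<open>\<infinity>\<close>, then the tilings
\<open>r \<alpha> S\<close> accumulate, as \<open>r\<close> tends to \<open>0\<close>, only at degenerate tilings, hence so do the tilings \<open>r S\<close>, and
therefore a vertical ray is covered by the horoballs of \<open>S\<close> (\<open>cusp_ray\<close>). These horoballs lie in those
of the packing, which are disjoint; so the ray lies in one of them, and this one has base point
\<open>\<infinity>\<close> (\<open>image_cusps\<close>).

Geometry enters through rows. Consecutive tiles across vertical edges fit together to a row, the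
region between two infinite regular polygons with geodesic sides, the upper one being the image
of the lower one under \<open>z \<mapsto> m z\<close>; the bump disappears from this description. Distinct rows of a
tiling do not overlap (\<open>tilings_row_tiling\<close>). That horoballs are disjoint or concentric, the heights
of the rows of a degenerate tiling, and the configuration around a vertex all follow from this.
At a vertex of a lowest row with \<open>n = 5\<close>, the rows fill the full angle \<open>2 \<pi>\<close> by sectors of angle
\<open>2 \<pi>/5\<close>, \<open>\<pi>\<close> or \<open>8 \<pi>/5\<close>, one of them of angle \<open>2 \<pi>/5\<close>; as \<open>5\<close> is odd, a half-plane cannot occur, and a
sector of angle \<open>8 \<pi>/5\<close> would belong to a still lower concentric row. So there are five sectors of
angle \<open>2 \<pi>/5\<close> (\<open>five_rows\<close>).
\<close>

section \<open>Matrices and Moebius maps\<close>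

definition psl2_of :: "real \<Rightarrow> real \<Rightarrow> real \<Rightarrow> real \<Rightarrow> psl2" where
  "psl2_of a b c d = abs_psl2 (vector [vector [a, b], vector [c, d]])"

lemma psl2_cases:
  obtains a b c d where "a * d - b * c = 1" "g = psl2_of a b c d"
proof -
  define A where "A = rep_psl2 g"
  have "det A = 1" using Quotient3_rep_reflp[OF Quotient3_psl2, of g] by (simp add: A_def)
  moreover have "A = vector [vector [A$1$1, A$1$2], vector [A$2$1, A$2$2]]"
    by (simp add: vec_eq_iff forall_2)
  moreover have "g = abs_psl2 A" using Quotient3_abs_rep[OF Quotient3_psl2, of g] by (simp add: A_def)
  ultimately show thesis
    by (intro that[of "A$1$1" "A$2$2" "A$1$2" "A$2$1"]) (auto simp: psl2_of_def det_2)
qed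

lemma psl2_of_eq_iff:
  assumes "a * d - b * c = 1" "a' * d' - b' * c' = 1"
  shows "psl2_of a b c d = psl2_of a' b' c' d' \<longleftrightarrow>
    (a, b, c, d) = (a', b', c', d') \<or> (a, b, c, d) = (- a', - b', - c', - d')"
  using assms Quotient3_rel[OF Quotient3_psl2, symmetric, of "vector [vector [a, b], vector [c, d]]" "vector [vector [a', b'], vector [c', d']]"]
  unfolding psl2_of_def by (simp add: det_2 vec_eq_iff forall_2)

lemma psl2_of_mult:
  assumes "a * d - b * c = 1" "a' * d' - b' * c' = 1"
  shows "psl2_of a b c d * psl2_of a' b' c' d' =
    psl2_of (a * a' + b * c') (a * b' + b * d') (c * a' + d * c') (c * b' + d * d')"
proof -
  have "(vector [vector [a, b], vector [c, d]] :: real^2^2) ** vector [vector [a', b'], vector [c', d']] =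
    (vector [vector [a * a' + b * c', a * b' + b * d'], vector [c * a' + d * c', c * b' + d * d']] :: real^2^2)"
    by (simp add: vec_eq_iff forall_2 matrix_matrix_mult_def sum_2)
  then show ?thesis
    unfolding psl2_of_def using assms by (subst times_psl2.abs_eq) (auto simp: det_2)
qed

lemma psl2_of_inverse:
  assumes "a * d - b * c = 1"
  shows "inverse (psl2_of a b c d) = psl2_of d (- b) (- c) a"
  unfolding psl2_of_def using assms by (subst inverse_psl2.abs_eq) (auto simp: det_2 adjugate2_def)

lemma psl2_one: "1 = psl2_of 1 0 0 1"
proof -
  have "mat 1 = (vector [vector [1, 0], vector [0, 1]] :: real^2^2)"
    by (simp add: vec_eq_iff forall_2 mat_def)
  then show ?thesis unfolding psl2_of_def one_psl2_def by simp
qed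

lemma psl2_translation_eq: "psl2_translation t = psl2_of 1 t 0 1"
  unfolding psl2_of_def psl2_translation_def by simp

lemma psl2_inversion_eq: "psl2_inversion = psl2_of 0 (- 1) 1 0"
  unfolding psl2_of_def psl2_inversion_def by simp

lemma mobius_psl2_of:
  assumes "a * d - b * c = 1"
  shows "mobius (psl2_of a b c d) z = (of_real a * z + of_real b) / (of_real c * z + of_real d)"
  unfolding psl2_of_def using assms by (subst mobius.abs_eq) (auto simp: det_2)

lemma psl2_right_inverse: "g * inverse g = (1::psl2)"
  by (cases g rule: psl2_cases) (simp add: psl2_of_inverse psl2_of_mult psl2_one algebra_simps)

lemma psl2_inverse_inverse [simp]: "inverse (inverse g) = (g::psl2)"
  by (cases g rule: psl2_cases) (simp add: psl2_of_inverse algebra_simps)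

lemma psl2_inverse_mult: "inverse (g * h) = inverse h * inverse (g::psl2)"
  by (metis mult.assoc mult.right_neutral mult.left_neutral psl2_left_inverse psl2_right_inverse)

lemma psl2_cancel [simp]:
  "inverse g * (g * h) = (h::psl2)" "g * (inverse g * h) = h"
  "inverse g * g = (1::psl2)" "g * inverse g = 1"
  by (simp_all add: mult.assoc[symmetric] psl2_left_inverse psl2_right_inverse)

lemma translation_add: "psl2_translation s * psl2_translation t = psl2_translation (s + t)"
  by (simp add: psl2_translation_eq psl2_of_mult algebra_simps)

lemma translation_inverse: "inverse (psl2_translation t) = psl2_translation (- t)"
  by (simp add: psl2_translation_eq psl2_of_inverse)

lemma translation_0: "psl2_translation 0 = 1"
  by (simp add: psl2_translation_eq psl2_one)

abbreviation uhp :: "complex set" where "uhp \<equiv> upper_half_plane"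

lemma uhp_iff: "z \<in> uhp \<longleftrightarrow> Im z > 0"
  by (simp add: upper_half_plane_def)

lemma mobius_one: "mobius 1 z = z"
  by (simp add: psl2_one mobius_psl2_of)

lemma denom_nonzero:
  assumes "a * d - b * c = (1::real)" "Im z > 0"
  shows "of_real c * z + of_real d \<noteq> 0"
  using assms by (auto simp: complex_eq_iff)

lemma Im_mobius:
  assumes "a * d - b * c = 1"
  shows "Im (mobius (psl2_of a b c d) z) = Im z / (cmod (of_real c * z + of_real d))\<^sup>2"
proof -
  have "Im ((of_real a * z + of_real b) / (of_real c * z + of_real d))
     = ((a * d - b * c) * Im z) / (cmod (of_real c * z + of_real d))\<^sup>2"
    by (simp add: Im_divide cmod_power2 algebra_simps)
  then show ?thesis using assms by (simp add: mobius_psl2_of)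
qed

lemma mobius_uhp [simp]: "z \<in> uhp \<Longrightarrow> mobius g z \<in> uhp"
proof (cases g rule: psl2_cases)
  case (1 a b c d)
  assume "z \<in> uhp"
  then show ?thesis using 1 denom_nonzero[of a d b c z] by (simp add: uhp_iff Im_mobius)
qed

lemma mobius_inverse [simp]:
  "z \<in> uhp \<Longrightarrow> mobius (inverse g) (mobius g z) = z"
  "z \<in> uhp \<Longrightarrow> mobius g (mobius (inverse g) z) = z"
  by (simp_all add: mobius_mult[symmetric] mobius_one)

lemma mobius_image_iff:
  assumes "A \<subseteq> uhp"
  shows "z \<in> mobius g ` A \<longleftrightarrow> z \<in> uhp \<and> mobius (inverse g) z \<in> A"
proof
  assume "z \<in> mobius g ` A" then show "z \<in> uhp \<and> mobius (inverse g) z \<in> A" using assms by auto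
next
  assume "z \<in> uhp \<and> mobius (inverse g) z \<in> A"
  then show "z \<in> mobius g ` A" by (metis image_eqI mobius_inverse(2))
qed

lemma continuous_on_mobius: "continuous_on uhp (mobius g)"
proof (cases g rule: psl2_cases)
  case (1 a b c d)
  show ?thesis unfolding 1 mobius_psl2_of[OF 1(1), abs_def]
    using denom_nonzero[OF 1(1)] by (auto intro!: continuous_intros simp: uhp_iff)
qed

lemma open_uhp: "open uhp"
  by (simp add: upper_half_plane_def open_halfspace_Im_gt)

lemma open_mobius_preimage:
  assumes "open A" shows "open {z \<in> uhp. mobius g z \<in> A}"
proof -
  have "open (uhp \<inter> mobius g -` A)"
    using continuous_on_mobius open_uhp assms by (rule continuous_open_preimage)
  also have "uhp \<inter> mobius g -` A = {z \<in> uhp. mobius g z \<in> A}" by auto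
  finally show ?thesis .
qed

lemma open_mobius_image:
  assumes "open A" "A \<subseteq> uhp" shows "open (mobius g ` A)"
proof -
  have "mobius g ` A = {z \<in> uhp. mobius (inverse g) z \<in> A}"
    using mobius_image_iff[OF assms(2)] by auto
  then show ?thesis using open_mobius_preimage[OF assms(1)] by simp
qed

lemma interior_mobius_image:
  assumes "A \<subseteq> uhp" shows "interior (mobius g ` A) = mobius g ` interior A"
proof
  show "mobius g ` interior A \<subseteq> interior (mobius g ` A)"
    using open_mobius_image[of "interior A" g] assms interior_subset[of A]
    by (intro interior_maximal) auto
  have im: "mobius g ` A \<subseteq> uhp" using assms by auto
  have "mobius (inverse g) ` interior (mobius g ` A) \<subseteq> interior A"
  proof (rule interior_maximal)
    show "mobius (inverse g) ` interior (mobius g ` A) \<subseteq> A"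
      using interior_subset[of "mobius g ` A"] assms by force
    show "open (mobius (inverse g) ` interior (mobius g ` A))"
      using open_mobius_image[of "interior (mobius g ` A)"] im interior_subset[of "mobius g ` A"] by auto
  qed
  moreover have "z = mobius g (mobius (inverse g) z)" if "z \<in> interior (mobius g ` A)" for z
    using that im interior_subset by (metis mobius_inverse(2) subsetD)
  ultimately show "interior (mobius g ` A) \<subseteq> mobius g ` interior A"
    by blast
qed

section \<open>The topology of PSL(2,R)\<close>

lemma continuous_on_abs_psl2: "continuous_on {A. det A = 1} abs_psl2"
proof -
  have "{A. det A = 1} \<inter> abs_psl2 -` U = {A. det A = 1 \<and> abs_psl2 A \<in> U}" for U by auto
  then show ?thesis
    by (subst continuous_on_open_gen[of _ _ UNIV]) (auto simp: open_psl2_def open_openin[symmetric])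
qed

lemma continuous_on_psl2I:
  fixes f :: "psl2 \<Rightarrow> 'b::topological_space"
  assumes "continuous_on {A. det A = 1} (\<lambda>A. f (abs_psl2 A))"
  shows "continuous_on UNIV f"
proof -
  have "open (f -` V)" if "open V" for V
  proof -
    have "{A. det A = 1} \<inter> (\<lambda>A. f (abs_psl2 A)) -` V = {A. det A = 1 \<and> abs_psl2 A \<in> f -` V}"
      by auto
    then show ?thesis
      using continuous_openin_preimage_gen[OF assms that] by (simp add: open_psl2_def)
  qed
  then show ?thesis by (simp add: continuous_on_open_vimage)
qed

lemma psl2_of_entries: "abs_psl2 A = psl2_of (A$1$1) (A$1$2) (A$2$1) (A$2$2)"
proof -
  have "A = vector [vector [A$1$1, A$1$2], vector [A$2$1, A$2$2]]"
    by (simp add: vec_eq_iff forall_2)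
  then show ?thesis by (simp add: psl2_of_def)
qed

lemma continuous_mobius_inverse:
  assumes "z \<in> uhp"
  shows "continuous_on UNIV (\<lambda>g. mobius (inverse g) z)"
proof (rule continuous_on_psl2I)
  have "continuous_on {A. det A = 1} (\<lambda>A::real^2^2.
     (of_real (A$2$2) * z + of_real (- A$1$2)) / (of_real (- A$2$1) * z + of_real (A$1$1)))"
  proof (intro continuous_intros ballI)
    fix A :: "real^2^2" assume "A \<in> {A. det A = 1}"
    then show "of_real (- A$2$1) * z + of_real (A$1$1) \<noteq> 0"
      using assms by (intro denom_nonzero[of "A$2$2" _ "- A$1$2"]) (auto simp: uhp_iff det_2 algebra_simps)
  qed
  moreover have "mobius (inverse (abs_psl2 A)) z =
     (of_real (A$2$2) * z + of_real (- A$1$2)) / (of_real (- A$2$1) * z + of_real (A$1$1))"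
    if "det A = 1" for A
    using that by (simp add: psl2_of_entries det_2 psl2_of_inverse mobius_psl2_of algebra_simps)
  ultimately show "continuous_on {A. det A = 1} (\<lambda>A. mobius (inverse (abs_psl2 A)) z)"
    by (subst continuous_on_cong[OF refl]) auto
qed

text \<open>The squares of the two entries of the first column.\<close>

text \<open>
Only the squares of the entries of the first column are well defined. The value \<open>sq21 g = 0\<close> means that
\<open>g\<close> fixes \<open>\<infinity>\<close>, and then \<open>sq11 g\<close> is its scaling factor; the value \<open>sq11 g = 0\<close> means that \<open>g\<close> maps \<open>\<infinity>\<close>
to \<open>0\<close>, and then \<open>1 / sq21 g\<close> is the Euclidean diameter of the horoball \<open>g {Im z > 1}\<close>.
\<close>

lift_definition sq11 :: "psl2 \<Rightarrow> real" is "\<lambda>A. (A$1$1)\<^sup>2"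
  by auto

lift_definition sq21 :: "psl2 \<Rightarrow> real" is "\<lambda>A. (A$2$1)\<^sup>2"
  by auto

lemma sq_psl2_of:
  assumes "a * d - b * c = 1"
  shows "sq11 (psl2_of a b c d) = a\<^sup>2" "sq21 (psl2_of a b c d) = c\<^sup>2"
  using assms by (simp_all add: psl2_of_def sq11.abs_eq sq21.abs_eq det_2)

lemma continuous_sq11: "continuous_on UNIV sq11"
proof (rule continuous_on_psl2I)
  have "continuous_on {A. det A = 1} (\<lambda>A::real^2^2. (A$1$1)\<^sup>2)"
    by (intro continuous_intros)
  then show "continuous_on {A. det A = 1} (\<lambda>A. sq11 (abs_psl2 A))"
    by (subst continuous_on_cong[OF refl]) (auto simp: sq11.abs_eq)
qed

lemma continuous_sq21: "continuous_on UNIV sq21"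
proof (rule continuous_on_psl2I)
  have "continuous_on {A. det A = 1} (\<lambda>A::real^2^2. (A$2$1)\<^sup>2)"
    by (intro continuous_intros)
  then show "continuous_on {A. det A = 1} (\<lambda>A. sq21 (abs_psl2 A))"
    by (subst continuous_on_cong[OF refl]) (auto simp: sq21.abs_eq)
qed

lemma psl2_fix_two:
  assumes "mobius g \<i> = \<i>" "mobius g (2 * \<i>) = 2 * \<i>"
  shows "g = 1"
proof (cases g rule: psl2_cases)
  case (1 a b c d)
  have n1: "of_real c * \<i> + of_real d \<noteq> (0::complex)" "of_real c * (2 * \<i>) + of_real d \<noteq> (0::complex)"
    using denom_nonzero[OF 1(1), of \<i>] denom_nonzero[OF 1(1), of "2 * \<i>"] by auto
  have "of_real a * \<i> + of_real b = \<i> * (of_real c * \<i> + of_real d)"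
    using assms(1) n1 by (simp add: 1 mobius_psl2_of divide_eq_eq)
  then have e1: "b = - c" "a = d" by (auto simp: complex_eq_iff)
  have "of_real a * (2 * \<i>) + of_real b = 2 * \<i> * (of_real c * (2 * \<i>) + of_real d)"
    using assms(2) n1 by (simp only: 1(2) mobius_psl2_of[OF 1(1)] divide_eq_eq if_True not_False_eq_True)
  then have "b = - 4 * c" by (auto simp: complex_eq_iff)
  then have "c = 0" "b = 0" "a * a = 1" using e1 1(1) by auto
  then show ?thesis
    using e1 1 by (auto simp: psl2_one psl2_of_eq_iff square_eq_1_iff)
qed

text \<open>
The group is Hausdorff, because an isometry is determined by the images of two points and these
images depend continuously on it.
\<close>

lemma psl2_separated:
  fixes g h :: psl2
  assumes "g \<noteq> h"
  obtains U V where "open U" "open V" "g \<in> U" "h \<in> V" "U \<inter> V = {}"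
proof -
  have "\<exists>z\<in>uhp. mobius (inverse g) z \<noteq> mobius (inverse h) z"
  proof (rule ccontr)
    assume "\<not> ?thesis"
    then have *: "mobius (inverse g) z = mobius (inverse h) z" if "z \<in> uhp" for z using that by auto
    have i: "\<i> \<in> uhp" "2 * \<i> \<in> uhp" by (auto simp: uhp_iff)
    have "mobius (h * inverse g) z = z" if "z \<in> uhp" for z
      using that * by (simp add: mobius_mult)
    then have "h * inverse g = 1" using i by (intro psl2_fix_two) auto
    then have "h = g" by (metis mult.assoc mult.left_neutral mult.right_neutral psl2_left_inverse)
    with assms show False by simp
  qed
  then obtain z where z: "z \<in> uhp" "mobius (inverse g) z \<noteq> mobius (inverse h) z" by blast
  then obtain U V where UV: "open U" "open V" "mobius (inverse g) z \<in> U" "mobius (inverse h) z \<in> V" "U \<inter> V = {}"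
    by (meson hausdorff)
  let ?f = "\<lambda>g. mobius (inverse g) z"
  have "open (?f -` U)" "open (?f -` V)"
    using continuous_mobius_inverse[OF z(1)] UV by (simp_all add: continuous_on_open_vimage)
  then show thesis using UV by (intro that[of "?f -` U" "?f -` V"]) auto
qed

lemma compact_psl2_bounded: "compact (abs_psl2 ` {A. det A = 1 \<and> norm A \<le> M})"
proof (rule compact_continuous_image)
  show "continuous_on {A. det A = 1 \<and> norm A \<le> M} abs_psl2"
    by (rule continuous_on_subset[OF continuous_on_abs_psl2]) auto
  have "closed {A::real^2^2. det A = 1}"
    unfolding det_2 by (intro closed_Collect_eq continuous_intros)
  then have "compact ({A::real^2^2. det A = 1} \<inter> cball 0 M)"
    by (intro closed_Int_compact compact_cball)
  also have "{A::real^2^2. det A = 1} \<inter> cball 0 M = {A. det A = 1 \<and> norm A \<le> M}"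
    by auto
  finally show "compact {A::real^2^2. det A = 1 \<and> norm A \<le> M}" .
qed

text \<open>The action on the upper half-plane is proper.\<close>

text \<open>
The action on the upper half-plane is proper: with \<open>z\<close> and \<open>g z\<close> confined to a compact set, the identity
\<open>Im (g z) = Im z / \<bar>c z + d\<bar>\<^sup>2\<close> bounds the second row of \<open>g\<close>, and then \<open>a z + b = (g z) (c z + d)\<close> bounds the
first one.
\<close>

lemma proper_action:
  assumes "\<eta> > 0"
  obtains K where "compact K"
    "\<And>g w. Im w \<ge> \<eta> \<Longrightarrow> cmod w \<le> M \<Longrightarrow> Im (mobius g w) \<ge> \<eta> \<Longrightarrow> cmod (mobius g w) \<le> M \<Longrightarrow> g \<in> K"
proof -
  define S where "S = (1 + M) * sqrt (M / \<eta>)"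
  define L where "L = S * (1 + 1 / \<eta>) * (1 + M)"
  have bd: "\<bar>c\<bar> \<le> L \<and> \<bar>d\<bar> \<le> L"
    if "cmod (of_real c * w + of_real d) \<le> S" "Im w \<ge> \<eta>" "cmod w \<le> M" for c d w
  proof -
    have S: "S \<ge> 0" and M: "M \<ge> 0"
      using that(1,3) norm_ge_zero order_trans by blast+
    have "\<bar>c\<bar> * \<eta> \<le> \<bar>c\<bar> * Im w" using that(2) by (intro mult_left_mono) auto
    also have "\<bar>c\<bar> * Im w \<le> S"
      using that(1,2) abs_Im_le_cmod[of "of_real c * w + of_real d"] assms by (simp add: abs_mult)
    finally have c: "\<bar>c\<bar> \<le> S / \<eta>" using assms by (simp add: field_simps)
    have "cmod (of_real d) \<le> cmod (of_real c * w + of_real d) + cmod (of_real c * w)"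
      by (metis add_diff_cancel_left' norm_triangle_ineq4)
    then have "\<bar>d\<bar> \<le> S + \<bar>c\<bar> * cmod w" using that(1) by (simp add: norm_mult)
    also have "\<bar>c\<bar> * cmod w \<le> S / \<eta> * M"
      using c that S assms by (intro mult_mono) auto
    finally have d: "\<bar>d\<bar> \<le> S + S / \<eta> * M" by simp
    have "S \<ge> 0" "S * M \<ge> 0" "S / \<eta> \<ge> 0" "S / \<eta> * M \<ge> 0" using S M assms by auto
    moreover have "L = S + S * M + S / \<eta> + S / \<eta> * M" unfolding L_def by (simp add: algebra_simps add_divide_distrib)
    ultimately show ?thesis using c d by linarith
  qed
  show thesis
  proof (rule that[OF compact_psl2_bounded[of "4 * L"]])
    fix g w assume h: "Im w \<ge> \<eta>" "cmod w \<le> M" "Im (mobius g w) \<ge> \<eta>" "cmod (mobius g w) \<le> M"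
    show "g \<in> abs_psl2 ` {A. det A = 1 \<and> norm A \<le> 4 * L}"
    proof (cases g rule: psl2_cases)
      case (1 a b c d)
      have M: "M \<ge> 0" using h(2) norm_ge_zero order_trans by blast
      define N where "N = cmod (of_real c * w + of_real d)"
      have nz: "of_real c * w + of_real d \<noteq> 0" using denom_nonzero[OF 1(1), of w] h assms by auto
      then have N: "N > 0" by (simp add: N_def)
      have im: "Im (mobius g w) * N\<^sup>2 = Im w" using N 1 by (simp add: Im_mobius N_def)
      have "\<eta> * N\<^sup>2 \<le> Im (mobius g w) * N\<^sup>2" using h by (intro mult_right_mono) auto
      also have "\<dots> \<le> M" using im h(2) abs_Im_le_cmod[of w] by linarith
      finally have "N\<^sup>2 \<le> M / \<eta>" using assms by (simp add: field_simps)
      then have N1: "N \<le> sqrt (M / \<eta>)" by (rule real_le_rsqrt)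
      have "0 \<le> M * sqrt (M / \<eta>)" using M assms by simp
      then have "N \<le> sqrt (M / \<eta>) + M * sqrt (M / \<eta>)" using N1 by linarith
      then have N2: "N \<le> S" by (simp add: S_def algebra_simps)
      have "of_real a * w + of_real b = mobius g w * (of_real c * w + of_real d)"
        using nz 1 by (simp add: mobius_psl2_of)
      then have "cmod (of_real a * w + of_real b) = cmod (mobius g w) * N"
        by (simp add: norm_mult N_def)
      also have "\<dots> \<le> M * sqrt (M / \<eta>)" using h N N1 M by (intro mult_mono) auto
      also have "\<dots> \<le> S" using M assms by (simp add: S_def algebra_simps)
      finally have N3: "cmod (of_real a * w + of_real b) \<le> S" .
      define A :: "real^2^2" where "A = vector [vector [a, b], vector [c, d]]"
      have "norm A \<le> norm (A$1) + norm (A$2)" using norm_le_l1[of A]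
        unfolding norm_vec_def L2_set_def sum_2 by (intro sqrt_sum_squares_le_sum) auto
      also have "\<dots> \<le> (\<bar>a\<bar> + \<bar>b\<bar>) + (\<bar>c\<bar> + \<bar>d\<bar>)"
        using norm_le_l1_cart[of "A$1"] norm_le_l1_cart[of "A$2"] by (simp add: A_def sum_2)
      also have "\<dots> \<le> 4 * L"
        using bd[of c w d] bd[of a w b] N2 N3 h unfolding N_def by linarith
      finally have "norm A \<le> 4 * L" .
      moreover have "det A = 1" using 1 by (simp add: A_def det_2)
      moreover have "g = abs_psl2 A" using 1 by (simp add: A_def psl2_of_def)
      ultimately show ?thesis by blast
    qed
  qed
qed

lemma psl2_locally_compact:
  assumes "open U" "(e::psl2) \<in> U"
  obtains U' Q where "open U'" "e \<in> U'" "U' \<subseteq> Q" "Q \<subseteq> U" "compact Q"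
proof -
  define A where "A = rep_psl2 e"
  have A: "det A = 1" "abs_psl2 A = e"
    using Quotient3_rep_reflp[OF Quotient3_psl2, of e] Quotient3_abs_rep[OF Quotient3_psl2, of e]
    by (simp_all add: A_def)
  have "openin (top_of_set {A. det A = 1}) {A. det A = 1 \<and> abs_psl2 A \<in> U}"
    using assms by (simp add: open_psl2_def)
  then obtain \<epsilon> where e: "\<epsilon> > 0" "\<And>B. det B = 1 \<Longrightarrow> dist B A < \<epsilon> \<Longrightarrow> abs_psl2 B \<in> U"
    unfolding openin_euclidean_subtopology_iff using A assms by blast
  define S where "S = {A::real^2^2. det A = 1}"
  define Q where "Q = abs_psl2 ` (S \<inter> cball A (\<epsilon>/2))"
  define U' where "U' = abs_psl2 ` (S \<inter> ball A (\<epsilon>/2))"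
  have "closed S" unfolding S_def det_2 by (intro closed_Collect_eq continuous_intros)
  then have "compact (S \<inter> cball A (\<epsilon>/2))" by (intro closed_Int_compact compact_cball)
  then have "compact Q" unfolding Q_def
    by (rule compact_continuous_image[rotated]) (rule continuous_on_subset[OF continuous_on_abs_psl2], auto simp: S_def)
  have 1: "B \<in> ball A (\<epsilon>/2) \<or> - B \<in> ball A (\<epsilon>/2)"
    if "det B = 1" "abs_psl2 B = abs_psl2 C" "C \<in> S" "C \<in> ball A (\<epsilon>/2)" for B C
  proof -
    have "B = C \<or> B = - C"
      using that(1,2,3) Quotient3_rel[OF Quotient3_psl2, symmetric, of B C] by (auto simp: S_def)
    then show ?thesis using that(4) by auto
  qed
  have 2: "abs_psl2 B = abs_psl2 (- B)" "det (- B) = 1" if "det B = 1" for B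
    using that Quotient3_rel[OF Quotient3_psl2, symmetric, of B "- B"] by (auto simp: det_2)
  have "{B. det B = 1 \<and> abs_psl2 B \<in> U'} = S \<inter> (ball A (\<epsilon>/2) \<union> uminus -` ball A (\<epsilon>/2))"
    (is "?L = ?R")
  proof (intro set_eqI iffI)
    fix B assume "B \<in> ?L"
    then obtain C where "det B = 1" "abs_psl2 B = abs_psl2 C" "C \<in> S" "C \<in> ball A (\<epsilon>/2)"
      unfolding U'_def by blast
    then show "B \<in> ?R" using 1[of B C] unfolding S_def by simp
  next
    fix B assume B: "B \<in> ?R"
    then have d: "det B = 1" by (simp add: S_def)
    from B have "B \<in> ball A (\<epsilon>/2) \<or> - B \<in> ball A (\<epsilon>/2)" by simp
    then have "abs_psl2 B \<in> U'"
    proof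
      assume "B \<in> ball A (\<epsilon>/2)" then show ?thesis using d unfolding U'_def S_def by blast
    next
      assume "- B \<in> ball A (\<epsilon>/2)" then show ?thesis using 2[OF d] unfolding U'_def S_def by blast
    qed
    then show "B \<in> ?L" using d by simp
  qed
  moreover have "open (uminus -` ball A (\<epsilon>/2))"
    by (intro continuous_open_vimage) (auto intro!: continuous_intros)
  ultimately have "open U'"
    unfolding open_psl2_def S_def[symmetric] by (auto intro!: openin_open_Int)
  moreover have "e \<in> U'" using A e(1) by (auto simp: U'_def S_def)
  moreover have "U' \<subseteq> Q" by (auto simp: U'_def Q_def)
  moreover have "Q \<subseteq> U" using e by (auto simp: Q_def S_def dist_commute)
  ultimately show thesis using \<open>compact Q\<close> by (rule that)
qed

lemma compact_placements:
  assumes "z \<in> uhp" "compact C" "\<eta> > 0" "\<And>y. y \<in> C \<Longrightarrow> \<eta> \<le> Im y"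
  shows "compact {g. mobius (inverse g) z \<in> C}"
proof -
  let ?P = "{g. mobius (inverse g) z \<in> C}"
  have "bounded C" using assms by (intro compact_imp_bounded)
  then obtain b where b: "\<And>y. y \<in> C \<Longrightarrow> cmod y \<le> b" by (auto simp: bounded_iff)
  obtain K where K: "compact K"
    "\<And>g y. Im y \<ge> min \<eta> (Im z) \<Longrightarrow> cmod y \<le> max b (cmod z) \<Longrightarrow>
       Im (mobius g y) \<ge> min \<eta> (Im z) \<Longrightarrow> cmod (mobius g y) \<le> max b (cmod z) \<Longrightarrow> g \<in> K"
    using proper_action[of "min \<eta> (Im z)" "max b (cmod z)"] assms uhp_iff by auto
  have "?P \<subseteq> K"
  proof
    fix g assume g: "g \<in> ?P"
    then have "\<eta> \<le> Im (mobius (inverse g) z)" "cmod (mobius (inverse g) z) \<le> b"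
      using assms(4) b by blast+
    then show "g \<in> K" using assms by (intro K(2)[of "mobius (inverse g) z"]) auto
  qed
  moreover have "closed ?P"
  proof -
    have "closed ((\<lambda>g. mobius (inverse g) z) -` C)"
      using continuous_mobius_inverse[OF assms(1)] assms(2)
      by (simp add: continuous_on_closed_vimage compact_imp_closed)
    then show ?thesis by (simp add: vimage_def)
  qed
  ultimately show ?thesis
    using closed_Int_compact[of ?P K] K(1) by (simp add: Int_absorb2)
qed

section \<open>The Fell topology\<close>

lemma openin_fell_miss: "compact K \<Longrightarrow> openin fell_topology {C. closed C \<and> C \<inter> K = {}}"
  and openin_fell_hit: "open U \<Longrightarrow> openin fell_topology {C. closed C \<and> C \<inter> U \<noteq> {}}"
  unfolding fell_topology_def by (intro topology_generated_by_Basis; blast)+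

lemma topology_generated_by_subbase:
  "topology (arbitrary union_of (finite intersection_of (\<lambda>x. x \<in> B) relative_to \<Union>B)) = topology_generated_by B"
    (is "?T = _")
proof (rule topology_eq[THEN iffD2], intro allI iffI)
  fix S assume S: "openin ?T S"
  show "openin (topology_generated_by B) S"
  proof (rule minimal_topology_subbase[OF _ _ S])
    show "openin (topology_generated_by B) (\<Union>B)"
      by (metis openin_topspace topology_generated_by_topspace)
  qed (simp add: topology_generated_by_Basis)
next
  fix S assume "openin (topology_generated_by B) S"
  then have "generate_topology_on B S" by (simp add: openin_topology_generated_by_iff)
  then show "openin ?T S"
  proof (induction rule: generate_topology_on.induct)
    case (Basis s)
    then have "(finite intersection_of (\<lambda>x. x \<in> B) relative_to \<Union>B) (\<Union>B \<inter> s)"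
      by (intro relative_to_inc finite_intersection_of_inc)
    moreover have "\<Union>B \<inter> s = s" using Basis by blast
    ultimately show ?case by (simp add: openin_subbase arbitrary_union_of_inc)
  next
    case (Int a b) then show ?case by (intro openin_Int)
  next
    case (UN K) then show ?case by (intro openin_Union) auto
  qed simp
qed

text \<open>
By Alexander's subbase theorem only covers by subbasic sets matter. In such a cover, consider the
complement \<open>C0\<close> of the union of all open sets that occur in a hitting condition. It satisfies none of
these conditions, so it misses a compact set \<open>K\<close> that occurs in a missing condition. Hence finitely
many of the open sets cover \<open>K\<close>, and their hitting conditions together with missing \<open>K\<close> exhaust all
closed sets.
\<close>

lemma compact_space_fell: "compact_space (fell_topology :: 'a::topological_space set topology)"
proof (rule Alexander_subbase[where X = fell_topology])
  let ?B = "{{C. closed C \<and> C \<inter> K = {}} |K::'a set. compact K} \<union>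
      {{C. closed C \<and> C \<inter> U \<noteq> {}} |U::'a set. open U}"
  show "topology (arbitrary union_of (finite intersection_of (\<lambda>x. x \<in> ?B) relative_to \<Union>?B)) = fell_topology"
    unfolding fell_topology_def by (rule topology_generated_by_subbase)
next
  fix \<C> :: "'a set set set"
  let ?B = "{{C. closed C \<and> C \<inter> K = {}} |K::'a set. compact K} \<union>
      {{C. closed C \<and> C \<inter> U \<noteq> {}} |U::'a set. open U}"
  assume C: "\<C> \<subseteq> ?B" "\<Union>\<C> = topspace fell_topology"
  define \<U> where "\<U> = {U::'a set. open U \<and> {C. closed C \<and> C \<inter> U \<noteq> {}} \<in> \<C>}"
  define C0 where "C0 = - \<Union>\<U>"
  have "closed C0" unfolding C0_def \<U>_def by (auto simp: closed_def)
  then have "C0 \<in> \<Union>\<C>" using C(2) by (simp add: topspace_fell_topology)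
  then obtain N where N: "N \<in> \<C>" "C0 \<in> N" by blast
  have "N \<in> ?B" using N(1) C(1) by (rule subsetD[rotated])
  then consider K where "compact K" "N = {C. closed C \<and> C \<inter> K = {}}"
    | U where "open U" "N = {C. closed C \<and> C \<inter> U \<noteq> {}}"
    by (elim UnE CollectE exE conjE) auto
  then show "\<exists>\<C>'. finite \<C>' \<and> \<C>' \<subseteq> \<C> \<and> \<Union>\<C>' = topspace fell_topology"
  proof cases
    case (1 K)
    then have "K \<subseteq> \<Union>\<U>" using N(2) by (auto simp: C0_def)
    then obtain \<V> where V: "\<V> \<subseteq> \<U>" "finite \<V>" "K \<subseteq> \<Union>\<V>"
      using compactE[OF 1(1), of \<U>] unfolding \<U>_def by (smt (verit) mem_Collect_eq)
    define \<C>' where "\<C>' = insert N ((\<lambda>U. {C. closed C \<and> C \<inter> U \<noteq> {}}) ` \<V>)"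
    have "finite \<C>'" "\<C>' \<subseteq> \<C>" using V N by (auto simp: \<C>'_def \<U>_def)
    moreover have "\<Union>\<C>' = topspace fell_topology"
    proof
      show "\<Union>\<C>' \<subseteq> topspace fell_topology" using \<open>\<C>' \<subseteq> \<C>\<close> C(2) by blast
      show "topspace fell_topology \<subseteq> \<Union>\<C>'"
      proof
        fix C :: "'a set" assume "C \<in> topspace fell_topology"
        then have cl: "closed C" by (simp add: topspace_fell_topology)
        show "C \<in> \<Union>\<C>'"
        proof (cases "C \<inter> K = {}")
          case True then show ?thesis using cl 1 by (auto simp: \<C>'_def)
        next
          case False
          then obtain U where "U \<in> \<V>" "C \<inter> U \<noteq> {}" using V(3) by blast
          then show ?thesis using cl by (auto simp: \<C>'_def)
        qed
      qed
    qed
    ultimately show ?thesis by blast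
  next
    case (2 U)
    then have "U \<in> \<U>" using N by (simp add: \<U>_def)
    then have False using 2 N(2) unfolding C0_def by blast
    then show ?thesis ..
  qed
qed

text \<open>
Membership in an open set of the Fell topology depends, locally uniformly, only on a compact part of
the closed set. For a hitting condition this needs local compactness of the group.
\<close>

lemma fell_open_local:
  fixes O' :: "psl2 set set"
  assumes "openin fell_topology O'" "C \<in> O'"
  obtains W Q where "openin fell_topology W" "C \<in> W" "compact Q"
    "\<And>D D'. D \<in> W \<Longrightarrow> closed D' \<Longrightarrow> D \<inter> Q = D' \<inter> Q \<Longrightarrow> D' \<in> O'"
proof -
  let ?B = "{{C. closed C \<and> C \<inter> K = {}} |K::psl2 set. compact K} \<union>
      {{C. closed C \<and> C \<inter> U \<noteq> {}} |U::psl2 set. open U}"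
  define P where "P = (\<lambda>(O'::psl2 set set) (C::psl2 set). \<exists>W Q. openin fell_topology W \<and> C \<in> W \<and> compact Q \<and>
    (\<forall>D D'. D \<in> W \<longrightarrow> closed D' \<longrightarrow> D \<inter> Q = D' \<inter> Q \<longrightarrow> D' \<in> O'))"
  have PI: "P O' C" if "openin fell_topology W" "C \<in> W" "compact Q"
    "\<And>D D'. D \<in> W \<Longrightarrow> closed D' \<Longrightarrow> D \<inter> Q = D' \<inter> Q \<Longrightarrow> D' \<in> O'" for O' C W Q
    unfolding P_def using that by blast
  have PE: "R" if "P O' C" and "\<And>W Q. openin fell_topology W \<Longrightarrow> C \<in> W \<Longrightarrow> compact Q \<Longrightarrow>
    (\<And>D D'. D \<in> W \<Longrightarrow> closed D' \<Longrightarrow> D \<inter> Q = D' \<inter> Q \<Longrightarrow> D' \<in> O') \<Longrightarrow> R" for O' C R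
    using that(1) unfolding P_def by (elim exE conjE) (rule that(2), auto)
  have "generate_topology_on ?B O'"
    using assms(1) unfolding fell_topology_def openin_topology_generated_by_iff .
  then have "\<forall>C\<in>O'. P O' C"
  proof (induction rule: generate_topology_on.induct)
    case Empty then show ?case by simp
  next
    case (Int a b)
    show ?case
    proof
      fix C assume C: "C \<in> a \<inter> b"
      have "P a C" using Int.IH(1) C by blast
      then obtain W Q where 1: "openin fell_topology W" "C \<in> W" "compact Q"
        "\<And>D D'. D \<in> W \<Longrightarrow> closed D' \<Longrightarrow> D \<inter> Q = D' \<inter> Q \<Longrightarrow> D' \<in> a" by (rule PE) (rule that)
      have "P b C" using Int.IH(2) C by blast
      then obtain W' Q' where 2: "openin fell_topology W'" "C \<in> W'" "compact Q'"
        "\<And>D D'. D \<in> W' \<Longrightarrow> closed D' \<Longrightarrow> D \<inter> Q' = D' \<inter> Q' \<Longrightarrow> D' \<in> b" by (rule PE) (rule that)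
      show "P (a \<inter> b) C"
      proof (rule PI)
        show "openin fell_topology (W \<inter> W')" "C \<in> W \<inter> W'" "compact (Q \<union> Q')"
          using 1 2 by (auto intro: compact_Un)
        fix D D' :: "psl2 set"
        assume D: "D \<in> W \<inter> W'" "closed D'" "D \<inter> (Q \<union> Q') = D' \<inter> (Q \<union> Q')"
        then have "D \<inter> Q = D' \<inter> Q" "D \<inter> Q' = D' \<inter> Q'" by blast+
        then show "D' \<in> a \<inter> b" using D 1(4)[of D D'] 2(4)[of D D'] by blast
      qed
    qed
  next
    case (UN K)
    show ?case
    proof
      fix C assume "C \<in> \<Union>K"
      then obtain k where k: "k \<in> K" "C \<in> k" by blast
      then have "P k C" using UN by blast
      then show "P (\<Union>K) C"
      proof (rule PE)
        fix W Q assume "openin fell_topology W" "C \<in> W" "compact Q"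
          "\<And>D D'. D \<in> W \<Longrightarrow> closed D' \<Longrightarrow> D \<inter> Q = D' \<inter> Q \<Longrightarrow> D' \<in> k"
        then show ?thesis using k(1) by (intro PI[of W C Q]) blast+
      qed
    qed
  next
    case (Basis s)
    then consider K where "compact K" "s = {C. closed C \<and> C \<inter> K = {}}"
      | U where "open U" "s = {C. closed C \<and> C \<inter> U \<noteq> {}}"
      by (elim UnE CollectE exE conjE) auto
    then show ?case
    proof cases
      case (1 K)
      show ?thesis
      proof
        fix C assume "C \<in> s"
        then show "P s C" using openin_fell_miss[OF 1(1)] 1
          by (intro PI[of s C K]) auto
      qed
    next
      case (2 U)
      show ?thesis
      proof
        fix C assume C: "C \<in> s"
        then obtain e where "e \<in> C" "e \<in> U" using 2 by blast
        then obtain U' Q where UQ: "open U'" "e \<in> U'" "U' \<subseteq> Q" "Q \<subseteq> U" "compact Q"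
          using psl2_locally_compact[OF 2(1)] by metis
        show "P s C"
        proof (rule PI)
          show "openin fell_topology {C. closed C \<and> C \<inter> U' \<noteq> {}}" using UQ openin_fell_hit by blast
          show "C \<in> {C. closed C \<and> C \<inter> U' \<noteq> {}}" using C 2 \<open>e \<in> C\<close> UQ by auto
          show "compact Q" by fact
          fix D D' :: "psl2 set"
          assume "D \<in> {C. closed C \<and> C \<inter> U' \<noteq> {}}" "closed D'" "D \<inter> Q = D' \<inter> Q"
          then show "D' \<in> s" using 2 UQ by blast
        qed
      qed
    qed
  qed
  with assms(2) have "P O' C" by blast
  then show thesis by (rule PE) (rule that)
qed

lemma compact_space_cluster_point:
  assumes "compact_space T" "closedin T F" "\<And>k::nat. y k \<in> F"
  obtains E where "E \<in> F" "\<And>W n. openin T W \<Longrightarrow> E \<in> W \<Longrightarrow> \<exists>k\<ge>n. y k \<in> W"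
proof (rule ccontr)
  note th = that
  assume not: "\<not> thesis"
  have "\<exists>W n. openin T W \<and> E \<in> W \<and> (\<forall>k\<ge>n. y k \<notin> W)" if "E \<in> F" for E
    using not th[OF that] by meson
  then obtain W n where W: "\<And>E. E \<in> F \<Longrightarrow> openin T (W E)" "\<And>E. E \<in> F \<Longrightarrow> E \<in> W E"
    "\<And>E k. E \<in> F \<Longrightarrow> k \<ge> n E \<Longrightarrow> y k \<notin> W E" by metis
  have "compactin T F" using assms closedin_compact_space by blast
  then obtain \<F> where F: "finite \<F>" "\<F> \<subseteq> W ` F" "F \<subseteq> \<Union>\<F>"
    unfolding compactin_def using W(1,2)
    by (elim conjE allE[of _ "W ` F"]) blast
  then obtain G where G: "finite G" "G \<subseteq> F" "\<F> = W ` G" by (meson finite_subset_image)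
  define k where "k = Max (insert 0 (n ` G))"
  have "y k \<in> \<Union>\<F>" using assms(3) F by blast
  then obtain E where "E \<in> G" "y k \<in> W E" using G by blast
  moreover have "n E \<le> k" using G(1) \<open>E \<in> G\<close> unfolding k_def by simp
  ultimately show False using W(3) G by blast
qed

text \<open>Two sequences that eventually agree on every compact set cannot be told apart.\<close>

text \<open>
Two sequences that eventually agree on every compact set cannot be told apart: near a cluster point
of the first one, the neighbourhood \<open>N\<close> only looks at a compact part, where the second one agrees.
\<close>

lemma asymptotic_agreement:
  fixes Y :: "psl2 set set"
  defines "T \<equiv> subtopology fell_topology Y"
  assumes "compact_space T" "closedin T F" "openin T N" "F \<subseteq> N"
    and y: "\<And>k::nat. y k \<in> F" and y': "\<And>k. y' k \<in> topspace T"
    and agree: "\<And>Q. compact Q \<Longrightarrow> \<exists>n. \<forall>k\<ge>n. y k \<inter> Q = y' k \<inter> Q"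
  shows "\<exists>k. y' k \<in> N"
proof -
  obtain E where E: "E \<in> F" "\<And>W n. openin T W \<Longrightarrow> E \<in> W \<Longrightarrow> \<exists>k\<ge>n. y k \<in> W"
    using compact_space_cluster_point[of T F y] assms by metis
  obtain N' where N': "openin fell_topology N'" "N = N' \<inter> Y"
    using assms(4) unfolding T_def openin_subtopology by blast
  have "E \<in> N'" using E(1) assms(5) N' by blast
  then obtain W Q where W: "openin fell_topology W" "E \<in> W" "compact Q"
    "\<And>D D'. D \<in> W \<Longrightarrow> closed D' \<Longrightarrow> D \<inter> Q = D' \<inter> Q \<Longrightarrow> D' \<in> N'"
    using fell_open_local[OF N'(1)] by metis
  obtain n where n: "\<And>k. k \<ge> n \<Longrightarrow> y k \<inter> Q = y' k \<inter> Q" using agree[OF W(3)] by blast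
  have "E \<in> Y" using E(1) assms(5) N' by blast
  then obtain k where "k \<ge> n" "y k \<in> W \<inter> Y"
    using E(2)[of "W \<inter> Y" n] W unfolding T_def openin_subtopology by blast
  moreover have "y' k \<in> Y" "closed (y' k)" using y'[of k] by (auto simp: T_def topspace_fell_topology)
  ultimately show ?thesis using W(4)[of "y k" "y' k"] n N' by blast
qed

section \<open>Rows of tiles\<close>

text \<open>
A convex regular polygon with infinitely many sides, one on each of the circles. Its vertices are the
tips of the prongs, \<open>exp (\<i> \<pi>/n) + k \<lambda>\<close>, and its angles are \<open>2 \<pi>/n\<close>.
\<close>

definition apeirogon :: "nat \<Rightarrow> complex set" where
  "apeirogon n = {z. Im z > 0 \<and> (\<forall>k::int. 1 \<le> cmod (z - of_real (of_int k * hecke_width n)))}"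

definition open_apeirogon :: "nat \<Rightarrow> complex set" where
  "open_apeirogon n = {z. Im z > 0 \<and> (\<forall>k::int. 1 < cmod (z - of_real (of_int k * hecke_width n)))}"

text \<open>
The region between the polygon and its image under \<open>z \<mapsto> m z\<close>. It is the union of the translates of
the tile by the multiples of \<open>m \<lambda>\<close>: prongs reach down to the lower polygon, dents to the upper one, and
the bumps fill the matching dents.
\<close>

definition row :: "nat \<Rightarrow> nat \<Rightarrow> complex set" where
  "row n m = {z \<in> apeirogon n. z / of_nat m \<notin> open_apeirogon n}"

definition open_row :: "nat \<Rightarrow> nat \<Rightarrow> complex set" where
  "open_row n m = {z \<in> open_apeirogon n. z / of_nat m \<notin> apeirogon n}"

lemma nearest:
  fixes x l :: real assumes "l > 0"
  obtains k :: int where "\<bar>x - of_int k * l\<bar> \<le> l / 2"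
proof
  have "\<bar>x / l - of_int (round (x / l))\<bar> \<le> 1/2"
    by (metis abs_minus_commute of_int_round_abs_le)
  then have "\<bar>x / l - of_int (round (x / l))\<bar> * l \<le> 1/2 * l" using assms by (intro mult_right_mono) auto
  moreover have "\<bar>x / l - of_int (round (x / l))\<bar> * l = \<bar>(x / l - of_int (round (x / l))) * l\<bar>"
    using assms by (simp add: abs_mult)
  moreover have "(x / l - of_int (round (x / l))) * l = x - of_int (round (x / l)) * l"
    using assms by (simp add: algebra_simps)
  ultimately show "\<bar>x - of_int (round (x / l)) * l\<bar> \<le> l / 2" by simp
qed

lemma floor_shift:
  fixes x l :: real assumes "l > 0"
  obtains k :: int where "0 \<le> x - of_int k * l" "x - of_int k * l < l"
proof
  have "of_int \<lfloor>x / l\<rfloor> * l \<le> x / l * l" using assms by (intro mult_right_mono) auto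
  moreover have "x / l * l < (of_int \<lfloor>x / l\<rfloor> + 1) * l" using assms by (intro mult_strict_right_mono) linarith+
  ultimately show "0 \<le> x - of_int \<lfloor>x / l\<rfloor> * l" "x - of_int \<lfloor>x / l\<rfloor> * l < l"
    using assms by (auto simp: field_simps)
qed

lemma cmod_ge_iff: "r \<ge> 0 \<Longrightarrow> r \<le> cmod (z - of_real a) \<longleftrightarrow> r\<^sup>2 \<le> (Re z - a)\<^sup>2 + (Im z)\<^sup>2"
  and cmod_gt_iff: "r \<ge> 0 \<Longrightarrow> r < cmod (z - of_real a) \<longleftrightarrow> r\<^sup>2 < (Re z - a)\<^sup>2 + (Im z)\<^sup>2"
  by (auto simp: cmod_def real_le_rsqrt real_less_rsqrt intro: sqrt_ge_absD real_le_lsqrt)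
     (metis abs_of_nonneg norm_complex_def not_le real_sqrt_abs real_sqrt_less_iff real_sqrt_le_iff)+

text \<open>
The last condition says that the dents stay above the horocycle \<open>Im z = 1\<close>, so that a row contains
the horocyclic strip between the heights \<open>1\<close> and \<open>m sin (\<pi>/n)\<close>. This strip is what makes horoballs of
different rows disjoint.
\<close>

locale hecke_tile =
  fixes n m :: nat
  assumes n3: "n \<ge> 3" and m2: "m \<ge> 2" and tall: "1 < real m * sin (pi / real n)"
begin

abbreviation "\<Lambda> \<equiv> hecke_width n"
abbreviation "\<phi> \<equiv> pi / real n"
abbreviation "w \<equiv> real m * \<Lambda>"
abbreviation "\<tau> k \<equiv> psl2_translation (of_int k * w)"

lemma angle_bounds: "0 < \<phi>" "\<phi> \<le> pi / 3"
  using n3 by (auto simp: field_simps)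

lemma width_bounds: "1 \<le> \<Lambda>" "\<Lambda> < 2" "sin \<phi> > 0" "(sin \<phi>)\<^sup>2 = 1 - (\<Lambda> / 2)\<^sup>2" "sin \<phi> < 1"
proof -
  have "cos (pi / 3) \<le> cos \<phi>" using angle_bounds by (intro cos_monotone_0_pi_le) auto
  then show "1 \<le> \<Lambda>" by (simp add: hecke_width_def cos_60)
  have "cos \<phi> < cos 0" using angle_bounds pi_gt_zero by (intro cos_monotone_0_pi) linarith+
  then show "\<Lambda> < 2" by (simp add: hecke_width_def)
  show s: "sin \<phi> > 0" using angle_bounds pi_gt_zero by (intro sin_gt_zero) linarith+
  show e: "(sin \<phi>)\<^sup>2 = 1 - (\<Lambda> / 2)\<^sup>2" by (simp add: hecke_width_def sin_squared_eq)
  have "(sin \<phi>)\<^sup>2 < 1" unfolding e using \<open>1 \<le> \<Lambda>\<close> by simp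
  then show "sin \<phi> < 1" using s by (simp add: power_less_one_iff abs_square_less_1)
qed

lemma m_bounds: "real m > 0" "real m \<ge> 2" "m > 0" using m2 by auto

lemma period_bounds: "w > 0" "w \<ge> 2" using m_bounds width_bounds mult_mono[of 2 "real m" 1 \<Lambda>] by auto

lemma apeirogon_Im:
  assumes "z \<in> apeirogon n" shows "Im z \<ge> sin \<phi>"
proof -
  obtain k :: int where k: "\<bar>Re z - of_int k * \<Lambda>\<bar> \<le> \<Lambda> / 2" using nearest[of \<Lambda> "Re z"] width_bounds by auto
  have "1\<^sup>2 \<le> (Re z - of_int k * \<Lambda>)\<^sup>2 + (Im z)\<^sup>2"
    using assms cmod_ge_iff[of 1 z "of_int k * \<Lambda>"] by (auto simp: apeirogon_def)
  moreover have "(Re z - of_int k * \<Lambda>)\<^sup>2 \<le> (\<Lambda> / 2)\<^sup>2" using k width_bounds by (simp add: abs_le_square_iff[symmetric])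
  ultimately have "(sin \<phi>)\<^sup>2 \<le> (Im z)\<^sup>2" using width_bounds by simp
  then show ?thesis using assms width_bounds by (auto simp: apeirogon_def intro: power2_le_imp_le)
qed

lemma high_open_apeirogon: "Im z > 1 \<Longrightarrow> z \<in> open_apeirogon n"
  unfolding open_apeirogon_def
  by (auto intro!: order.strict_trans2[OF _ abs_Im_le_cmod])

lemma high_apeirogon: "Im z \<ge> 1 \<Longrightarrow> z \<in> apeirogon n"
  unfolding apeirogon_def
  by (auto intro!: order_trans[OF _ abs_Im_le_cmod])

lemma open_subset_apeirogon: "open_apeirogon n \<subseteq> apeirogon n"
  by (auto simp: open_apeirogon_def apeirogon_def less_imp_le)

lemma open_row_subset: "open_row n m \<subseteq> row n m"
  using open_subset_apeirogon by (auto simp: row_def open_row_def)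

lemma finite_near: "finite {k::int. cmod (z - of_real (of_int k * \<Lambda>)) \<le> r}"
proof (rule finite_subset)
  show "{k::int. cmod (z - of_real (of_int k * \<Lambda>)) \<le> r} \<subseteq> {\<lfloor>(Re z - r) / \<Lambda>\<rfloor> .. \<lceil>(Re z + r) / \<Lambda>\<rceil>}"
  proof
    fix k :: int assume "k \<in> {k. cmod (z - of_real (of_int k * \<Lambda>)) \<le> r}"
    then have "\<bar>Re z - of_int k * \<Lambda>\<bar> \<le> r" using abs_Re_le_cmod[of "z - of_real (of_int k * \<Lambda>)"] by auto
    then have "(Re z - r) / \<Lambda> \<le> of_int k" "of_int k \<le> (Re z + r) / \<Lambda>" using width_bounds by (auto simp: field_simps)
    then show "k \<in> {\<lfloor>(Re z - r) / \<Lambda>\<rfloor> .. \<lceil>(Re z + r) / \<Lambda>\<rceil>}" by (auto simp: floor_le_iff le_ceiling_iff)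
  qed
qed simp

text \<open>
Infinitely many conditions still define an open set, since only finitely many of the circles come
near a given point.
\<close>

lemma open_outside: "open {z. Im z > 0 \<and> (\<forall>k\<in>I. 1 < cmod (z - of_real (of_int k * \<Lambda>)))}" (is "open ?S")
proof (subst open_subopen, intro ballI)
  fix z assume z: "z \<in> ?S"
  define J where "J = {k::int. cmod (z - of_real (of_int k * \<Lambda>)) \<le> 2} \<inter> I"
  have "finite J" using finite_near by (simp add: J_def)
  define V where "V = ball z 1 \<inter> {z. Im z > 0} \<inter> (\<Inter>k\<in>J. {z. 1 < cmod (z - of_real (of_int k * \<Lambda>))})"
  have "open V" unfolding V_def using \<open>finite J\<close>
    by (intro open_Int open_INT open_ball open_halfspace_Im_gt ballI open_Collect_less continuous_intros) auto
  moreover have "z \<in> V" using z by (auto simp: V_def J_def)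
  moreover have "V \<subseteq> ?S"
  proof
    fix y assume y: "y \<in> V"
    have "1 < cmod (y - of_real (of_int k * \<Lambda>))" if "k \<in> I" for k
    proof (cases "k \<in> J")
      case True then show ?thesis using y by (auto simp: V_def)
    next
      case False
      then have "2 < cmod (z - of_real (of_int k * \<Lambda>))" using that by (auto simp: J_def)
      moreover have "cmod (z - y) < 1" using y by (simp add: V_def dist_norm)
      moreover have "cmod (z - of_real (of_int k * \<Lambda>)) \<le> cmod (z - y) + cmod (y - of_real (of_int k * \<Lambda>))"
        using norm_triangle_ineq[of "z - y" "y - of_real (of_int k * \<Lambda>)"] by simp
      ultimately show ?thesis by linarith
    qed
    then show "y \<in> ?S" using y by (auto simp: V_def)
  qed
  ultimately show "\<exists>V. open V \<and> z \<in> V \<and> V \<subseteq> ?S" by blast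
qed

lemma open_open_apeirogon: "open (open_apeirogon n)"
  using open_outside[of UNIV] by (simp add: open_apeirogon_def)

lemma closed_apeirogon: "closed (apeirogon n)"
proof -
  have "apeirogon n = {z. Im z \<ge> sin \<phi>} \<inter> (\<Inter>k::int. {z. 1 \<le> cmod (z - of_real (of_int k * \<Lambda>))})"
    using apeirogon_Im width_bounds(3) by (auto simp: apeirogon_def intro: order.strict_trans2)
  also have "closed \<dots>"
    by (intro closed_Int closed_INT ballI closed_Collect_le continuous_intros closed_halfspace_Im_ge)
  finally show ?thesis .
qed

lemma continuous_div_m: "continuous_on UNIV (\<lambda>z::complex. z / of_nat m)"
  using m_bounds by (intro continuous_intros) auto

lemma open_open_row: "open (open_row n m)"
proof -
  have "open ((\<lambda>z. z / of_nat m) -` (- apeirogon n))"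
    using continuous_div_m closed_apeirogon by (simp add: continuous_on_open_vimage open_Compl)
  moreover have "open_row n m = open_apeirogon n \<inter> (\<lambda>z. z / of_nat m) -` (- apeirogon n)"
    by (auto simp: open_row_def)
  ultimately show ?thesis using open_open_apeirogon by auto
qed

lemma closed_row: "closed (row n m)"
proof -
  have "open ((\<lambda>z. z / of_nat m) -` open_apeirogon n)"
    using continuous_div_m open_open_apeirogon by (simp add: continuous_on_open_vimage)
  moreover have "row n m = apeirogon n \<inter> - ((\<lambda>z. z / of_nat m) -` open_apeirogon n)"
    by (auto simp: row_def)
  ultimately show ?thesis using closed_apeirogon by (auto intro: closed_Int)
qed

lemma row_Im: "z \<in> row n m \<Longrightarrow> Im z \<ge> sin \<phi>"
  using apeirogon_Im by (auto simp: row_def)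

lemma row_Im_le: "z \<in> row n m \<Longrightarrow> Im z \<le> real m"
proof (rule ccontr)
  assume "z \<in> row n m" "\<not> Im z \<le> real m"
  then have "Im (z / of_nat m) > 1" using m_bounds by (simp add: Im_divide_of_nat field_simps)
  then show False using high_open_apeirogon \<open>z \<in> row n m\<close> by (auto simp: row_def)
qed

lemma row_uhp: "row n m \<subseteq> uhp"
  using row_Im width_bounds by (force simp: uhp_iff)

text \<open>
Below the height \<open>m sin (\<pi>/n)\<close> there are no points of the polygon scaled by \<open>m\<close>.
\<close>

lemma strip_open_row:
  assumes "1 < Im z" "Im z < real m * sin \<phi>" shows "z \<in> open_row n m"
proof -
  have "Im (z / of_nat m) < sin \<phi>" using assms m_bounds by (simp add: Im_divide_of_nat field_simps)
  then show ?thesis using assms high_open_apeirogon apeirogon_Im by (fastforce simp: open_row_def)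
qed

text \<open>
The dents touch the vertical line through a corner only at the top, so along this line a row reaches up
to the height \<open>m\<close>.
\<close>

lemma axis_open_row:
  assumes "1 < y" "y < real m" shows "\<i> * of_real y \<in> open_row n m"
proof -
  have "\<i> * of_real y / of_nat m \<notin> apeirogon n"
  proof
    assume "\<i> * of_real y / of_nat m \<in> apeirogon n"
    then have "1 \<le> cmod (\<i> * of_real y / of_nat m - of_real (of_int 0 * \<Lambda>))" unfolding apeirogon_def by blast
    then show False using assms m_bounds by (simp add: norm_mult norm_divide)
  qed
  then show ?thesis using assms high_open_apeirogon[of "\<i> * of_real y"] by (auto simp: open_row_def)
qed

text \<open>
Neighbouring prongs meet only at the height \<open>1\<close>, so a row has no points straight below \<open>\<i>\<close>.
\<close>

lemma pinch_not_row: "0 < y \<Longrightarrow> y < 1 \<Longrightarrow> \<i> * of_real y \<notin> row n m"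
proof
  assume y: "0 < y" "y < 1" "\<i> * of_real y \<in> row n m"
  then have "1 \<le> cmod (\<i> * of_real y - of_real (of_int 0 * \<Lambda>))" unfolding row_def apeirogon_def by blast
  then show False using y by (simp add: norm_mult)
qed

lemma shift_all: "(\<forall>k::int. P (z + of_real (of_int j * \<Lambda>) - of_real (of_int k * \<Lambda>))) \<longleftrightarrow>
   (\<forall>k::int. P (z - of_real (of_int k * \<Lambda>)))" for z :: complex
proof (intro iffI allI)
  fix k assume "\<forall>k::int. P (z + of_real (of_int j * \<Lambda>) - of_real (of_int k * \<Lambda>))"
  then have "P (z + of_real (of_int j * \<Lambda>) - of_real (of_int (k + j) * \<Lambda>))" by blast
  then show "P (z - of_real (of_int k * \<Lambda>))" by (simp add: algebra_simps)
next
  fix k assume "\<forall>k::int. P (z - of_real (of_int k * \<Lambda>))"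
  then have "P (z - of_real (of_int (k - j) * \<Lambda>))" by blast
  then show "P (z + of_real (of_int j * \<Lambda>) - of_real (of_int k * \<Lambda>))" by (simp add: algebra_simps)
qed

lemma apeirogon_shift: "z + of_real (of_int j * \<Lambda>) \<in> apeirogon n \<longleftrightarrow> z \<in> apeirogon n"
  "z + of_real (of_int j * \<Lambda>) \<in> open_apeirogon n \<longleftrightarrow> z \<in> open_apeirogon n"
  unfolding apeirogon_def open_apeirogon_def mem_Collect_eq
  by (subst shift_all[of "\<lambda>z. 1 \<le> cmod z"], simp) (subst shift_all[of "\<lambda>z. 1 < cmod z"], simp)

lemma row_shift: "z + of_real (of_int j * w) \<in> row n m \<longleftrightarrow> z \<in> row n m"
  "z + of_real (of_int j * w) \<in> open_row n m \<longleftrightarrow> z \<in> open_row n m"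
proof -
  have 1: "z + of_real (of_int j * w) = z + of_real (of_int (j * int m) * \<Lambda>)" by simp
  have 2: "(z + of_real (of_int j * w)) / of_nat m = z / of_nat m + of_real (of_int j * \<Lambda>)"
    using m_bounds by (simp add: field_simps)
  show "z + of_real (of_int j * w) \<in> row n m \<longleftrightarrow> z \<in> row n m"
    "z + of_real (of_int j * w) \<in> open_row n m \<longleftrightarrow> z \<in> open_row n m"
    unfolding row_def open_row_def mem_Collect_eq 2 apeirogon_shift by (simp_all only: 1 apeirogon_shift)
qed

section \<open>The tile inside its row\<close>

lemma prong_apeirogon: "prong n \<subseteq> apeirogon n"
proof
  fix p assume p: "p \<in> prong n"
  have pr: "0 \<le> Re p" "Re p \<le> \<Lambda>" "0 < Im p" "Im p \<le> 1" "1 \<le> cmod p" "1 \<le> cmod (p - of_real \<Lambda>)"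
    using p by (auto simp: prong_def)
  have "1 \<le> cmod (p - of_real (of_int j * \<Lambda>))" for j
  proof -
    have sq: "1 \<le> (Re p - 0)\<^sup>2 + (Im p)\<^sup>2" "1 \<le> (Re p - \<Lambda>)\<^sup>2 + (Im p)\<^sup>2"
      using pr cmod_ge_iff[of 1 p 0] cmod_ge_iff[of 1 p \<Lambda>] by simp_all
    consider "j \<le> 0" | "j \<ge> 1" by linarith
    then have "1 \<le> (Re p - of_int j * \<Lambda>)\<^sup>2 + (Im p)\<^sup>2"
    proof cases
      case 1
      then have "of_int j * \<Lambda> \<le> 0" using width_bounds by (simp add: mult_nonpos_nonneg)
      then have "(Re p - 0)\<^sup>2 \<le> (Re p - of_int j * \<Lambda>)\<^sup>2" using pr by (intro power_mono) auto
      then show ?thesis using sq by linarith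
    next
      case 2
      then have "1 * \<Lambda> \<le> of_int j * \<Lambda>" using width_bounds by (intro mult_right_mono) auto
      then have "(\<Lambda> - Re p)\<^sup>2 \<le> (of_int j * \<Lambda> - Re p)\<^sup>2" using pr by (intro power_mono) auto
      then show ?thesis using sq by (simp add: power2_commute)
    qed
    then show ?thesis using cmod_ge_iff[of 1 p "of_int j * \<Lambda>"] by simp
  qed
  then show "p \<in> apeirogon n" using pr by (auto simp: apeirogon_def)
qed

lemma core_minus_dent_row: "core_with_prongs n m - top_dent n m \<subseteq> row n m"
proof
  fix z assume z: "z \<in> core_with_prongs n m - top_dent n m"
  show "z \<in> row n m"
  proof (cases "z \<in> core n m")
    case True
    then have c: "0 \<le> Re z" "Re z \<le> w" "1 \<le> Im z" "Im z \<le> real m" by (auto simp: core_def)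
    have "z / of_nat m \<notin> open_apeirogon n"
    proof
      assume a: "z / of_nat m \<in> open_apeirogon n"
      have "z / of_nat m \<in> prong n"
        using a c m_bounds unfolding open_apeirogon_def prong_def
        by (auto simp: Re_divide_of_nat Im_divide_of_nat field_simps dest: spec[of _ 0] spec[of _ 1])
      then have "of_nat m * (z / of_nat m) \<in> top_dent n m" unfolding top_dent_def by blast
      then show False using z m_bounds by simp
    qed
    then show ?thesis using high_apeirogon c by (auto simp: row_def)
  next
    case False
    then obtain k where k: "k < m" "z \<in> (\<lambda>z. z + of_real (real k * \<Lambda>)) ` prong n"
      using z by (auto simp: core_with_prongs_def)
    then obtain p where p: "p \<in> prong n" "z = p + of_real (of_int (int k) * \<Lambda>)" by auto
    have pr: "Im p \<le> 1" using p by (auto simp: prong_def)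
    have "p \<in> apeirogon n" using p prong_apeirogon by blast
    then have "z \<in> apeirogon n" by (simp only: p apeirogon_shift)
    moreover have "z / of_nat m \<notin> open_apeirogon n"
    proof
      assume "z / of_nat m \<in> open_apeirogon n"
      then have "sin \<phi> \<le> Im (z / of_nat m)" using apeirogon_Im open_subset_apeirogon by blast
      also have "Im (z / of_nat m) \<le> 1 / real m" using p pr m_bounds by (simp add: Im_divide_of_nat field_simps)
      finally show False using tall m_bounds by (simp add: field_simps)
    qed
    ultimately show ?thesis by (simp add: row_def)
  qed
qed

lemma core_with_prongs_Re: "z \<in> core_with_prongs n m \<Longrightarrow> 0 \<le> Re z \<and> Re z \<le> w"
proof -
  assume "z \<in> core_with_prongs n m"
  then consider "z \<in> core n m" | k p where "k < m" "p \<in> prong n" "z = p + of_real (real k * \<Lambda>)"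
    by (auto simp: core_with_prongs_def)
  then show ?thesis
  proof cases
    case 1 then show ?thesis by (auto simp: core_def)
  next
    case 2
    then have "0 \<le> Re p" "Re p \<le> \<Lambda>" "real k + 1 \<le> real m" by (auto simp: prong_def)
    moreover have "(real k + 1) * \<Lambda> \<le> real m * \<Lambda>" using 2 width_bounds by (intro mult_right_mono) auto
    ultimately show ?thesis using 2 width_bounds by (auto simp: algebra_simps add_nonneg_nonneg)
  qed
qed

lemma tile_without_bump: "tile n m {} \<subseteq> row n m" "z \<in> tile n m {} \<Longrightarrow> 0 \<le> Re z \<and> Re z \<le> w"
proof -
  show "tile n m {} \<subseteq> row n m"
    unfolding tile_def using core_minus_dent_row closed_row by (intro closure_minimal) auto
  have "tile n m {} \<subseteq> {z. 0 \<le> Re z} \<inter> {z. Re z \<le> w}"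
    unfolding tile_def using core_with_prongs_Re by (intro closure_minimal closed_Int closed_halfspace_Re_le closed_halfspace_Re_ge) auto
  then show "z \<in> tile n m {} \<Longrightarrow> 0 \<le> Re z \<and> Re z \<le> w" by auto
qed

text \<open>
Away from the vertical edges, each point inside the row belongs to the tile before the bump is added
and its dent removed.
\<close>

lemma open_row_in_tile:
  assumes "z \<in> open_row n m" "0 < Re z" "Re z < w"
  shows "z \<in> core_with_prongs n m - top_dent n m"
proof -
  have r: "z \<in> open_apeirogon n" "z / of_nat m \<notin> apeirogon n" using assms by (auto simp: open_row_def)
  have I: "Im z > 0" using r by (simp add: open_apeirogon_def)
  have "z \<notin> top_dent n m"
  proof
    assume "z \<in> top_dent n m"
    then obtain p where p: "p \<in> prong n" "z = of_nat m * p" by (auto simp: top_dent_def)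
    then have "p = z / of_nat m" using m_bounds by simp
    have "p \<in> apeirogon n" using p prong_apeirogon by blast
    then show False using r \<open>p = z / of_nat m\<close> by simp
  qed
  moreover have "z \<in> core_with_prongs n m"
  proof (cases "Im z \<ge> 1")
    case True
    have "Im z \<le> real m" using row_Im_le open_row_subset assms(1) by blast
    then show ?thesis using assms True by (auto simp: core_with_prongs_def core_def)
  next
    case False
    obtain k :: int where k: "0 \<le> Re z - of_int k * \<Lambda>" "Re z - of_int k * \<Lambda> < \<Lambda>"
      using floor_shift[of \<Lambda> "Re z"] width_bounds by auto
    have "(- 1) * \<Lambda> < of_int k * \<Lambda>" "of_int k * \<Lambda> < real m * \<Lambda>" using k assms by linarith+
    then have "- 1 < real_of_int k" "real_of_int k < real m" using width_bounds by (auto simp only: mult_less_cancel_right)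
    then have "- 1 < k" "k < int m" by linarith+
    then have km: "nat k < m" "real (nat k) = of_int k" by auto
    have "z - of_real (of_int k * \<Lambda>) \<in> prong n"
      using r(1) k False I spec[of "\<lambda>k::int. 1 < cmod (z - of_real (of_int k * \<Lambda>))" "k + 1"]
      by (auto simp: open_apeirogon_def prong_def algebra_simps less_imp_le)
    then have "z \<in> (\<lambda>z. z + of_real (real (nat k) * \<Lambda>)) ` prong n"
      unfolding km by (auto simp: image_iff intro!: bexI[of _ "z - of_real (of_int k * \<Lambda>)"])
    then show ?thesis using km(1) unfolding core_with_prongs_def
      by (intro UnI2 UN_I[of "nat k"]) simp_all
  qed
  ultimately show ?thesis by blast
qed

context
  fixes B assumes B: "bump_region n m B"
begin

lemma bump_translate:
  assumes "z \<in> B" shows "z + of_real w \<in> row n m" "0 \<le> Re z + w" "Re z \<le> 0"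
proof -
  have "z + of_real w \<in> interior (tile n m {}) \<union> {z. Re z = w \<and> 1 < Im z \<and> Im z < real m}"
    using B assms unfolding bump_region_def by blast
  moreover have "interior (tile n m {}) \<subseteq> tile n m {}" by (rule interior_subset)
  moreover have "y \<in> row n m" if y: "Re y = w" "1 < Im y" "Im y < real m" for y
  proof -
    have "\<i> * of_real (Im y) + of_real (of_int 1 * w) \<in> open_row n m"
      using axis_open_row[of "Im y"] y by (simp only: row_shift)
    moreover have "\<i> * of_real (Im y) + of_real (of_int 1 * w) = y" using y by (simp add: complex_eq_iff)
    ultimately show ?thesis using open_row_subset by auto
  qed
  ultimately show "z + of_real w \<in> row n m" "0 \<le> Re z + w" "Re z \<le> 0"
    using tile_without_bump(1) tile_without_bump(2)[of "z + of_real w"] period_bounds by (fastforce, fastforce, fastforce)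
qed

lemma tile_row: "tile n m B \<subseteq> row n m"
proof -
  have "z \<in> row n m" if "z \<in> B" for z
    using bump_translate(1)[OF that] row_shift(1)[of z 1] by simp
  then have "B \<subseteq> row n m" by blast
  then show ?thesis
    unfolding tile_def using core_minus_dent_row closed_row by (intro closure_minimal) blast
qed

lemma interior_bump: "interior B \<subseteq> interior (tile n m B)"
proof (rule interior_maximal)
  have neg: "Re z < 0" if z: "z \<in> interior B" for z
  proof -
    obtain e where e: "e > 0" "ball z e \<subseteq> B" using z by (meson mem_interior)
    have "z + of_real (e/2) \<in> ball z e" using e by (simp add: dist_norm)
    then show ?thesis using bump_translate(3)[of "z + of_real (e/2)"] e by auto
  qed
  have "z \<notin> top_dent n m" if z: "Re z < 0" for z
    using z m_bounds by (auto simp: top_dent_def prong_def mult_less_0_iff)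
  moreover have "z \<notin> (\<lambda>z. z + of_real w) ` B" if z: "Re z < 0" for z
    using z bump_translate(2) by force
  ultimately have "interior B \<subseteq> (core_with_prongs n m \<union> B) - (top_dent n m \<union> (\<lambda>z. z + of_real w) ` B)"
    using neg interior_subset by blast
  then show "interior B \<subseteq> tile n m B" unfolding tile_def using closure_subset by blast
qed auto

text \<open>
The interiors of the translated tiles are dense in the row. The points of the removed dent of a tile
are approximated by the bump of its right neighbour, because the bump is the closure of its interior.
\<close>

lemma open_row_dense:
  assumes z: "z \<in> open_row n m" and V: "open V" "z \<in> V"
  shows "\<exists>y\<in>V. \<exists>k::int. y - of_real (of_int k * w) \<in> interior (tile n m B)"
proof -
  define G where "G = {z \<in> open_row n m. 0 < Re z \<and> Re z < w}"
  have "open G"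
  proof -
    have "G = open_row n m \<inter> {z. Re z > 0} \<inter> {z. Re z < w}" by (auto simp: G_def)
    then show ?thesis using open_open_row
      by (metis open_Int open_halfspace_Re_gt open_halfspace_Re_lt)
  qed
  obtain k :: int where k: "0 \<le> Re z - of_int k * w" "Re z - of_int k * w < w"
    using floor_shift[of w "Re z"] period_bounds by auto
  define V' where "V' = (\<lambda>y. y + of_real (of_int k * w)) -` (V \<inter> open_row n m)"
  have V': "open V'" unfolding V'_def using V open_open_row
    by (intro continuous_open_vimage open_Int) (auto intro!: continuous_intros)
  define z' where "z' = z - of_real (of_int k * w)"
  have "z' \<in> V'" using z V by (simp add: z'_def V'_def)
  then obtain e where e: "e > 0" "ball z' e \<subseteq> V'" using V' openE by blast
  define \<delta> where "\<delta> = min (e/2) ((w - Re z') / 2)"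
  have "Re z' < w" "0 \<le> Re z'" using k by (simp_all add: z'_def)
  then have d: "\<delta> > 0" "\<delta> < e" "\<delta> < w - Re z'" using e by (auto simp: \<delta>_def min_def mult.commute)
  define z2 where "z2 = z' + of_real \<delta>"
  have "z2 \<in> V'" using e d by (auto simp: z2_def dist_norm subset_iff)
  have "z2 \<in> G"
  proof -
    have "z2 + of_real (of_int k * w) \<in> open_row n m" using \<open>z2 \<in> V'\<close> by (simp add: V'_def)
    then have "z2 \<in> open_row n m" by (simp only: row_shift)
    then show ?thesis using d k by (simp add: G_def z2_def z'_def)
  qed
  let ?TB = "(\<lambda>z. z + of_real w) ` B"
  have sub: "G - ?TB \<subseteq> interior (tile n m B)"
  proof (rule interior_maximal)
    have "compact B" using B by (simp add: bump_region_def)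
    then have "compact ?TB" by (intro compact_continuous_image continuous_intros)
    then show "open (G - ?TB)" using \<open>open G\<close> by (simp add: compact_imp_closed open_Diff)
    show "G - ?TB \<subseteq> tile n m B"
      unfolding tile_def using closure_subset open_row_in_tile by (force simp: G_def)
  qed
  show ?thesis
  proof (cases "z2 \<in> ?TB")
    case False
    then have "z2 \<in> interior (tile n m B)" using sub \<open>z2 \<in> G\<close> by blast
    then show ?thesis using \<open>z2 \<in> V'\<close>
      by (intro bexI[of _ "z2 + of_real (of_int k * w)"] exI[of _ k]) (auto simp: V'_def)
  next
    case True
    then have "z2 - of_real w \<in> B" by auto
    then have "z2 - of_real w \<in> closure (interior B)" using B by (simp add: bump_region_def)
    moreover have "open ((\<lambda>y. y + of_real w) -` V')"
      using V' by (intro continuous_open_vimage) (auto intro!: continuous_intros)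
    moreover have "z2 - of_real w \<in> (\<lambda>y. y + of_real w) -` V'" using \<open>z2 \<in> V'\<close> by simp
    ultimately have "(\<lambda>y. y + of_real w) -` V' \<inter> interior B \<noteq> {}"
      using open_Int_closure_eq_empty[of "(\<lambda>y. y + of_real w) -` V'" "interior B"] by blast
    then obtain y where "y \<in> interior B" "y + of_real w \<in> V'" by blast
    then show ?thesis using interior_bump
      by (intro bexI[of _ "y + of_real w + of_real (of_int k * w)"] exI[of _ "k + 1"])
         (auto simp: V'_def algebra_simps)
  qed
qed

lemma compact_tile: "compact (tile n m B)"
proof -
  have "core_with_prongs n m \<subseteq> cball 0 (w + real m + 1)"
  proof
    fix z assume z: "z \<in> core_with_prongs n m"
    have "\<bar>Re z\<bar> \<le> w" using core_with_prongs_Re[OF z] by auto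
    moreover have "\<bar>Im z\<bar> \<le> real m + 1"
      using z m_bounds by (auto simp: core_with_prongs_def core_def prong_def)
    ultimately show "z \<in> cball 0 (w + real m + 1)" using cmod_le[of z] by simp
  qed
  then have "bounded (core_with_prongs n m)" using bounded_subset bounded_cball by blast
  moreover have "bounded B" using B unfolding bump_region_def by (intro compact_imp_bounded) blast
  ultimately have "bounded (core_with_prongs n m \<union> B)" by simp
  then have "bounded ((core_with_prongs n m \<union> B) - X)" for X by (rule bounded_subset) (rule Diff_subset)
  then have "bounded (tile n m B)" unfolding tile_def by (intro bounded_closure)
  then show ?thesis by (simp add: compact_eq_bounded_closed tile_def)
qed

lemma tile_uhp: "tile n m B \<subseteq> uhp"
  using tile_row row_uhp by blast

end

end

context hecke_tile begin

section \<open>Tilings by rows\<close>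

text \<open>
What is used about a tiling, stated without reference to the bump. The compact set \<open>C\<close> in the third
condition makes the placements that cover points near a given point range over a compact set, and
the last condition then leaves finitely many of them.
\<close>

definition row_tiling :: "psl2 set \<Rightarrow> bool" where
  "row_tiling T \<longleftrightarrow>
     (\<forall>g\<in>T. \<forall>k::int. g * \<tau> k \<in> T) \<and>
     (\<forall>g\<in>T. \<forall>h\<in>T. \<forall>z\<in>uhp. mobius (inverse g) z \<in> open_row n m \<longrightarrow>
        mobius (inverse h) z \<in> open_row n m \<longrightarrow> (\<exists>k::int. h = g * \<tau> k)) \<and>
     (\<exists>C. compact C \<and> C \<subseteq> row n m \<and> (\<forall>z\<in>uhp. \<exists>g\<in>T. mobius (inverse g) z \<in> C)) \<and>
     (\<forall>K. compact K \<longrightarrow> finite (T \<inter> K))"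

lemma row_tiling_shift: "row_tiling T \<Longrightarrow> g \<in> T \<Longrightarrow> g * \<tau> k \<in> T"
  by (simp add: row_tiling_def)

lemma row_tiling_overlap:
  assumes "row_tiling T" "g \<in> T" "h \<in> T" "z \<in> uhp" "mobius (inverse g) z \<in> open_row n m"
    "mobius (inverse h) z \<in> open_row n m"
  obtains k :: int where "h = g * \<tau> k"
  using assms unfolding row_tiling_def by meson

lemma row_tiling_cover:
  assumes "row_tiling T" "z \<in> uhp"
  obtains g where "g \<in> T" "mobius (inverse g) z \<in> row n m"
  using assms unfolding row_tiling_def by (metis subsetD)

lemma mobius_inverse_tau:
  "z \<in> uhp \<Longrightarrow> mobius (inverse (g * \<tau> k)) z = mobius (inverse g) z - of_real (of_int k * w)"
  by (simp add: psl2_inverse_mult mobius_mult translation_inverse mobius_translation)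

lemma row_same:
  "z \<in> uhp \<Longrightarrow> mobius (inverse (g * \<tau> k)) z \<in> row n m \<longleftrightarrow> mobius (inverse g) z \<in> row n m"
  using row_shift(1)[of "mobius (inverse g) z" "- k"] by (simp add: mobius_inverse_tau)

lemma shift_add: "\<tau> j * \<tau> k = \<tau> (j + k)"
  by (simp add: translation_add algebra_simps)

context
  fixes B assumes B: "admissible_bump n m B"
begin

lemma bump_shape: "bump_region n m B"
  using B by (simp add: admissible_bump_def)

lemma tilings_closed_under_shift:
  assumes "T \<in> tilings n m B" "g \<in> T" shows "g * \<tau> k \<in> T"
proof -
  have step: "h * \<tau> 1 \<in> T" "h * \<tau> (- 1) \<in> T" if "h \<in> T" for h
    using B assms(1) that unfolding admissible_bump_def by simp_all
  show ?thesis
  proof (induction k rule: int_induct[of _ 0])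
    case base then show ?case using assms by (simp add: translation_0)
  next
    case (step1 i)
    have "g * \<tau> i * \<tau> 1 \<in> T" using step step1 by blast
    then show ?case by (simp only: mult.assoc shift_add)
  next
    case (step2 i)
    have "g * \<tau> i * \<tau> (- 1) \<in> T" using step step2 by blast
    then show ?case by (simp only: mult.assoc shift_add) (simp)
  qed
qed

lemma tilings_disjoint:
  assumes "T \<in> tilings n m B" "g \<in> T" "h \<in> T" "z \<in> uhp"
    "mobius (inverse g) z \<in> interior (tile n m B)" "mobius (inverse h) z \<in> interior (tile n m B)"
  shows "g = h"
proof (rule ccontr)
  assume "g \<noteq> h"
  then have "interior (mobius g ` tile n m B) \<inter> interior (mobius h ` tile n m B) = {}"
    using assms(1-3) unfolding tilings_def by blast
  moreover have "z \<in> interior (mobius g ` tile n m B)" "z \<in> interior (mobius h ` tile n m B)"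
    unfolding interior_mobius_image[OF tile_uhp[OF bump_shape]]
    using assms interior_subset tile_uhp[OF bump_shape] by (subst mobius_image_iff; blast)+
  ultimately show False by blast
qed

lemma tilings_cover:
  assumes "T \<in> tilings n m B" "z \<in> uhp"
  shows "\<exists>g\<in>T. mobius (inverse g) z \<in> tile n m B"
proof -
  have "z \<in> (\<Union>g\<in>T. mobius g ` tile n m B)" using assms unfolding tilings_def by blast
  then show ?thesis using mobius_image_iff[OF tile_uhp[OF bump_shape]] by blast
qed

lemma tile_has_interior:
  obtains p where "p \<in> uhp" "p \<in> interior (tile n m B)"
proof -
  have "(1 + min (real m * sin \<phi>) 2) / 2 > 1" "(1 + min (real m * sin \<phi>) 2) / 2 < real m * sin \<phi>"
    using tall by (auto simp: min_def)
  then have "\<i> * of_real ((1 + min (real m * sin \<phi>) 2) / 2) \<in> open_row n m"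
    by (intro strip_open_row) auto
  then obtain y k where "y - of_real (of_int k * w) \<in> interior (tile n m B)"
    using open_row_dense[OF bump_shape _ open_UNIV UNIV_I] by blast
  then show thesis using interior_subset tile_uhp[OF bump_shape] by (intro that) blast+
qed

text \<open>
Placements near a given \<open>g\<close> have a common point in the interiors of their tiles.
\<close>

lemma tilings_locally_finite:
  assumes "T \<in> tilings n m B" "compact K" shows "finite (T \<inter> K)"
proof -
  obtain p where p: "p \<in> uhp" "p \<in> interior (tile n m B)" by (rule tile_has_interior)
  define U where "U g = (\<lambda>h. mobius (inverse h) (mobius g p)) -` interior (tile n m B)" for g
  have "open (U g)" for g
    unfolding U_def using continuous_mobius_inverse[of "mobius g p"] p
    by (simp add: continuous_on_open_vimage)
  moreover have "g \<in> U g" for g using p by (simp add: U_def)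
  moreover have "K \<subseteq> (\<Union>g\<in>K. U g)" using \<open>\<And>g. g \<in> U g\<close> by blast
  ultimately obtain K' where K': "K' \<subseteq> K" "finite K'" "K \<subseteq> (\<Union>g\<in>K'. U g)"
    using compactE_image[OF assms(2), of K U] by metis
  have one: "g' = g''" if "g' \<in> T \<inter> U g" "g'' \<in> T \<inter> U g" for g g' g''
    using tilings_disjoint[OF assms(1), of g' g'' "mobius g p"] that p by (auto simp: U_def)
  have "finite (T \<inter> U g)" for g
    using one[of _ g] by (metis finite.simps finite_subset insertCI subsetI)
  then have "finite (\<Union>g\<in>K'. T \<inter> U g)" using K' by blast
  then show ?thesis by (rule rev_finite_subset) (use K' in blast)
qed

text \<open>
If two open rows meet, then, by density, so do the interiors of tiles in them. These tiles coincide,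
and therefore the rows differ by a translation.
\<close>

lemma tilings_row_tiling:
  assumes T: "T \<in> tilings n m B" shows "row_tiling T"
proof -
  have dense: "\<exists>y\<in>V. \<exists>k::int. mobius (inverse (g * \<tau> k)) y \<in> interior (tile n m B)"
    if h: "open V" "V \<subseteq> uhp" "z \<in> V" "mobius (inverse g) z \<in> open_row n m" for V z g
  proof -
    have "open (mobius (inverse g) ` V)" using h open_mobius_image by blast
    moreover have "mobius (inverse g) z \<in> mobius (inverse g) ` V" using h by blast
    ultimately obtain y k where y: "y \<in> mobius (inverse g) ` V"
      "y - of_real (of_int k * w) \<in> interior (tile n m B)"
      using open_row_dense[OF bump_shape h(4), of "mobius (inverse g) ` V"] by blast
    then obtain y0 where y0: "y0 \<in> V" "y = mobius (inverse g) y0" by blast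
    then have "mobius (inverse (g * \<tau> k)) y0 \<in> interior (tile n m B)"
      using y h(2) by (metis mobius_inverse_tau subsetD)
    then show ?thesis using y0(1) by blast
  qed
  have ov: "\<exists>k::int. h = g * \<tau> k" if gh: "g \<in> T" "h \<in> T" and z: "z \<in> uhp"
    "mobius (inverse g) z \<in> open_row n m" "mobius (inverse h) z \<in> open_row n m" for g h z
  proof -
    define V where "V = {z \<in> uhp. mobius (inverse g) z \<in> open_row n m} \<inter> {z \<in> uhp. mobius (inverse h) z \<in> open_row n m}"
    have "open V" unfolding V_def using open_open_row by (intro open_Int open_mobius_preimage)
    moreover have "V \<subseteq> uhp" "z \<in> V" using z by (auto simp: V_def)
    ultimately obtain y k where y: "y \<in> V" "mobius (inverse (g * \<tau> k)) y \<in> interior (tile n m B)"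
      using dense z by metis
    define V' where "V' = V \<inter> {z \<in> uhp. mobius (inverse (g * \<tau> k)) z \<in> interior (tile n m B)}"
    have "open V'" unfolding V'_def using \<open>open V\<close> by (intro open_Int open_mobius_preimage) auto
    moreover have "V' \<subseteq> uhp" "y \<in> V'" using y \<open>V \<subseteq> uhp\<close> by (auto simp: V'_def)
    moreover have "mobius (inverse h) y \<in> open_row n m" using y by (simp add: V_def)
    ultimately obtain x l where x: "x \<in> V'" "mobius (inverse (h * \<tau> l)) x \<in> interior (tile n m B)"
      using dense by metis
    have "g * \<tau> k = h * \<tau> l"
      using x gh tilings_closed_under_shift[OF T] tilings_disjoint[OF T, of "g * \<tau> k" "h * \<tau> l" x]
      by (auto simp: V'_def)
    then have "h * \<tau> l * \<tau> (- l) = g * \<tau> k * \<tau> (- l)" by simp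
    then have "h = g * \<tau> (k - l)" by (simp only: mult.assoc shift_add) (simp add: translation_0)
    then show ?thesis by blast
  qed
  show ?thesis unfolding row_tiling_def
  proof (intro conjI ballI allI impI)
    show "\<exists>C. compact C \<and> C \<subseteq> row n m \<and> (\<forall>z\<in>uhp. \<exists>g\<in>T. mobius (inverse g) z \<in> C)"
      using tilings_cover[OF T] compact_tile[OF bump_shape] tile_row[OF bump_shape] by blast
  qed (fact tilings_closed_under_shift[OF T] ov tilings_locally_finite[OF T])+
qed

text \<open>
Being a tiling is a closed condition. That a point is covered means that the set of placements meets
the compact set of all placements of a tile at that point. An overlap of two tiles persists under
small changes of both placements.
\<close>

lemma compact_tiling_space: "compact_space (tiling_space n m B)"
proof -
  have op: "openin fell_topology ({C. closed C} - tilings n m B)"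
  proof (subst openin_subopen, intro ballI)
    fix C assume C: "C \<in> {C. closed C} - tilings n m B"
    \<comment> \<open>A closed set that is not a tiling leaves a point uncovered or contains two overlapping placements.\<close>
    consider (miss) z where "z \<in> uhp" "\<forall>g\<in>C. mobius (inverse g) z \<notin> tile n m B"
      | (overlap) g h where "g \<in> C" "h \<in> C" "g \<noteq> h"
        "interior (mobius g ` tile n m B) \<inter> interior (mobius h ` tile n m B) \<noteq> {}"
    proof (cases "\<exists>z\<in>uhp. \<forall>g\<in>C. mobius (inverse g) z \<notin> tile n m B")
      case True then show thesis using miss by blast
    next
      case False
      then have "(\<Union>g\<in>C. mobius g ` tile n m B) = uhp"
        using mobius_image_iff[OF tile_uhp[OF bump_shape]] by blast
      then show thesis using C overlap unfolding tilings_def by blast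
    qed
    then show "\<exists>W. openin fell_topology W \<and> C \<in> W \<and> W \<subseteq> {C. closed C} - tilings n m B"
    proof cases
      case (miss z)
      let ?K = "{g. mobius (inverse g) z \<in> tile n m B}"
      have "openin fell_topology {C. closed C \<and> C \<inter> ?K = {}}"
        using compact_placements[OF miss(1) compact_tile[OF bump_shape] width_bounds(3)] row_Im tile_row[OF bump_shape]
        by (intro openin_fell_miss) blast
      moreover have "C \<in> {C. closed C \<and> C \<inter> ?K = {}}" using C miss by auto
      moreover have "{C. closed C \<and> C \<inter> ?K = {}} \<subseteq> {C. closed C} - tilings n m B"
        using tilings_cover[OF _ miss(1)] by blast
      ultimately show ?thesis by blast
    next
      case (overlap g h)
      then obtain z where z: "z \<in> mobius g ` interior (tile n m B)" "z \<in> mobius h ` interior (tile n m B)"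
        unfolding interior_mobius_image[OF tile_uhp[OF bump_shape]] by blast
      have sub: "interior (tile n m B) \<subseteq> uhp" using interior_subset tile_uhp[OF bump_shape] by blast
      then have z': "z \<in> uhp" "mobius (inverse g) z \<in> interior (tile n m B)" "mobius (inverse h) z \<in> interior (tile n m B)"
        using z mobius_image_iff[OF sub] by blast+
      define P where "P = (\<lambda>g. mobius (inverse g) z) -` interior (tile n m B)"
      have "open P" unfolding P_def using continuous_mobius_inverse[OF z'(1)] by (simp add: continuous_on_open_vimage)
      obtain U V where UV: "open U" "open V" "g \<in> U" "h \<in> V" "U \<inter> V = {}"
        using psl2_separated[OF overlap(3)] .
      let ?W = "{C. closed C \<and> C \<inter> (U \<inter> P) \<noteq> {}} \<inter> {C. closed C \<and> C \<inter> (V \<inter> P) \<noteq> {}}"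
      have "openin fell_topology ?W" using UV \<open>open P\<close> by (intro openin_Int openin_fell_hit) auto
      moreover have "C \<in> ?W" using C UV overlap z' by (auto simp: P_def)
      moreover have "?W \<subseteq> {C. closed C} - tilings n m B"
      proof
        fix D assume "D \<in> ?W"
        then obtain g' h' where gh: "closed D" "g' \<in> D" "g' \<in> U" "g' \<in> P" "h' \<in> D" "h' \<in> V" "h' \<in> P" by blast
        then have "D \<notin> tilings n m B"
          using tilings_disjoint[of D g' h' z] z'(1) UV(5) by (auto simp: P_def)
        then show "D \<in> {C. closed C} - tilings n m B" using gh by simp
      qed
      ultimately show ?thesis by blast
    qed
  qed
  have "closedin fell_topology ({C. closed C} \<inter> tilings n m B)"
    unfolding closedin_def topspace_fell_topology using op by (simp add: Diff_Int_distrib Diff_Int)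
  then have "compactin fell_topology ({C. closed C} \<inter> tilings n m B)"
    using compact_space_fell closedin_compact_space by blast
  then have "compact_space (subtopology fell_topology ({C. closed C} \<inter> tilings n m B))"
    by (simp add: compact_space_subtopology)
  then show ?thesis unfolding tiling_space_def
    by (metis subtopology_restrict topspace_fell_topology)
qed

end

end

section \<open>Horoballs\<close>

text \<open>
The horoball \<open>g {Im z > 1}\<close> consists of the points of depth greater than \<open>1\<close>.
\<close>

abbreviation depth :: "psl2 \<Rightarrow> complex \<Rightarrow> real" where
  "depth g z \<equiv> Im (mobius (inverse g) z)"

lemma between:
  fixes l a b :: real
  assumes "l < a" "l < b" obtains y where "l < y" "y < a" "y < b"
  using dense[of l "min a b"] assms by auto

lemma depth_psl2_of:
  assumes "a * d - b * c = 1"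
  shows "depth (psl2_of a b c d) z = Im z / ((a - c * Re z)\<^sup>2 + (c * Im z)\<^sup>2)"
proof -
  have "d * a - (- b) * (- c) = 1" using assms by (simp add: algebra_simps)
  then show ?thesis
    unfolding psl2_of_inverse[OF assms] by (simp add: Im_mobius cmod_power2)
qed

lemma depth_mult: "z \<in> uhp \<Longrightarrow> depth (p * g) z = depth g (mobius (inverse p) z)"
  by (simp add: psl2_inverse_mult mobius_mult)

lemma depth_base_infinity:
  assumes "sq21 g = 0" shows "depth g z = Im z / sq11 g"
proof (cases g rule: psl2_cases)
  case (1 a b c d)
  then show ?thesis using assms by (simp add: depth_psl2_of sq_psl2_of)
qed

lemma sq11_pos: "sq21 g = 0 \<Longrightarrow> sq11 g > 0" and sq21_pos: "sq11 g = 0 \<Longrightarrow> sq21 g > 0"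
  by (cases g rule: psl2_cases; auto simp: sq_psl2_of)+

lemma depth_base_zero:
  assumes "sq11 g = 0" shows "depth g z = Im z / (sq21 g * (cmod z)\<^sup>2)"
proof (cases g rule: psl2_cases)
  case (1 a b c d)
  then show ?thesis using assms
    by (simp add: depth_psl2_of sq_psl2_of cmod_power2 power_mult_distrib algebra_simps)
qed

lemma sq_mult_translation [simp]:
  "sq11 (g * psl2_translation t) = sq11 g" "sq21 (g * psl2_translation t) = sq21 g"
  by (cases g rule: psl2_cases; simp add: psl2_translation_eq psl2_of_mult sq_psl2_of algebra_simps)+

lemma sq_upper_mult:
  assumes "sq21 p = 0"
  shows "sq21 (p * g) = sq21 g / sq11 p" "sq21 g = 0 \<Longrightarrow> sq11 (p * g) = sq11 p * sq11 g"
proof -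
  obtain a b c d a' b' c' d' where 1: "a * d - b * c = 1" "p = psl2_of a b c d"
    "a' * d' - b' * c' = 1" "g = psl2_of a' b' c' d'" by (metis psl2_cases)
  have c: "c = 0" "a \<noteq> 0" "d = 1 / a" using assms 1 by (auto simp: sq_psl2_of eq_divide_eq mult.commute)
  have pg: "p * g = psl2_of (a * a' + b * c') (a * b' + b * d') (c * a' + d * c') (c * b' + d * d')"
    using 1 by (simp add: psl2_of_mult)
  have det: "(a * a' + b * c') * (c * b' + d * d') - (a * b' + b * d') * (c * a' + d * c') = 1"
  proof -
    have "(a * a' + b * c') * (c * b' + d * d') - (a * b' + b * d') * (c * a' + d * c') = (a * d - b * c) * (a' * d' - b' * c')"
      by (simp add: algebra_simps)
    then show ?thesis using 1 by simp
  qed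
  have sq: "sq11 p = a\<^sup>2" "sq11 g = a'\<^sup>2" "sq21 g = c'\<^sup>2" using 1 by (auto simp: sq_psl2_of)
  show "sq21 (p * g) = sq21 g / sq11 p"
    unfolding pg sq_psl2_of[OF det] sq using c by (simp add: power_divide)
  show "sq21 g = 0 \<Longrightarrow> sq11 (p * g) = sq11 p * sq11 g"
    unfolding pg sq_psl2_of[OF det] sq using c by (simp add: power_mult_distrib)
qed

lemma same_base_infinity:
  assumes "sq21 (inverse g * h) = 0" "sq21 g = 0" shows "sq21 h = 0"
  using sq_upper_mult(1)[OF assms(2), of "inverse g * h"] assms(1) by simp

lemma same_base_zero:
  assumes "sq21 (inverse g * h) = 0" "sq11 g = 0" shows "sq11 h = 0"
proof (cases g rule: psl2_cases; cases h rule: psl2_cases)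
  fix a b c d a' b' c' d'
  assume 1: "a * d - b * c = 1" "g = psl2_of a b c d" "a' * d' - b' * c' = 1" "h = psl2_of a' b' c' d'"
  have det: "(d * a' - b * c') * (a * d' - c * b') - (d * b' - b * d') * (a * c' - c * a') = 1"
  proof -
    have "(d * a' - b * c') * (a * d' - c * b') - (d * b' - b * d') * (a * c' - c * a') = (a * d - b * c) * (a' * d' - b' * c')"
      by (simp add: algebra_simps)
    then show ?thesis using 1 by simp
  qed
  have "inverse g * h = psl2_of (d * a' - b * c') (d * b' - b * d') (a * c' - c * a') (a * d' - c * b')"
    using 1 by (simp add: psl2_of_inverse psl2_of_mult algebra_simps)
  then have "a * c' - c * a' = 0" using assms(1) by (simp add: sq_psl2_of[OF det])
  moreover have "a = 0" using assms(2) 1 by (simp add: sq_psl2_of)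
  ultimately show ?thesis using 1 by (auto simp: sq_psl2_of)
qed

definition dilation :: "real \<Rightarrow> psl2" where
  "dilation r = psl2_of (sqrt r) 0 0 (1 / sqrt r)"

lemma sq_dilation: "r > 0 \<Longrightarrow> sq11 (dilation r) = r" "r > 0 \<Longrightarrow> sq21 (dilation r) = 0"
  unfolding dilation_def by (subst sq_psl2_of; simp)+

lemma sq_translation: "sq11 (psl2_translation t) = 1" "sq21 (psl2_translation t) = 0"
  by (simp_all add: psl2_translation_eq sq_psl2_of)

lemma mobius_inverse_dilation: "r > 0 \<Longrightarrow> mobius (inverse (dilation r)) z = z / of_real r"
  unfolding dilation_def
  by (subst psl2_of_inverse, simp, subst mobius_psl2_of, simp) (simp add: field_simps flip: of_real_mult)

lemma move_tiling_one: "move_tiling 1 S = S"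
  by (simp add: move_tiling_def)

lemma move_tilingI: "h \<in> S \<Longrightarrow> g * h \<in> move_tiling g S"
  by (simp add: move_tiling_def)

definition degenerate :: "psl2 set \<Rightarrow> bool" where
  "degenerate E \<longleftrightarrow> (\<forall>e\<in>E. sq21 e = 0)"

lemma upper_form:
  assumes "sq21 e = 0"
  obtains a t where "a > 0" "e = psl2_of a (t / a) 0 (1 / a)" "sq11 e = a\<^sup>2"
    "\<And>z. mobius (inverse e) z = (z - of_real t) / of_real (a\<^sup>2)"
proof (cases e rule: psl2_cases)
  case (1 a b c d)
  have c: "c = 0" "a \<noteq> 0" "d = 1 / a" using assms 1 by (auto simp: sq_psl2_of eq_divide_eq mult.commute)
  define a' where "a' = \<bar>a\<bar>"
  have e: "e = psl2_of a' (a * b / a') 0 (1 / a')"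
    using c 1 by (cases "a > 0") (auto simp: psl2_of_eq_iff a'_def)
  have a': "a' > 0" using c by (simp add: a'_def)
  have "mobius (inverse e) z = (z - of_real (a * b)) / of_real (a'\<^sup>2)" for z
  proof -
    have "mobius (inverse e) z = (of_real (1 / a') * z + of_real (- (a * b / a'))) / of_real a'"
      unfolding e using a' by (subst psl2_of_inverse, simp, subst mobius_psl2_of, simp) simp
    also have "\<dots> = (z - of_real (a * b)) / of_real (a'\<^sup>2)"
      using a' by (simp add: field_simps power2_eq_square)
    finally show ?thesis .
  qed
  moreover have "sq11 e = a'\<^sup>2" unfolding e using a' by (subst sq_psl2_of) auto
  ultimately show thesis using a' e by (intro that[of a' "a * b"]) auto
qed

context hecke_tile begin

text \<open>
Horoballs of a tiling with different base points are disjoint. Suppose that two of them meet, and move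
the first one to \<open>{Im z > 1}\<close>. The boundary circle of the second one crosses the line \<open>Im z = 1\<close>, and near the
crossing there is a point in the strips of both rows. So the rows coincide, and so do the base points.
\<close>

lemma packing:
  assumes T: "row_tiling T" "g \<in> T" "h \<in> T" and z: "z \<in> uhp" "depth g z > 1" "depth h z > 1"
  shows "sq21 (inverse g * h) = 0"
proof (cases "inverse g * h" rule: psl2_cases)
  case (1 a b c d)
  define z' where "z' = mobius (inverse g) z"
  have h: "h = g * psl2_of a b c d" using 1 by (metis psl2_cancel(2))
  have z': "z' \<in> uhp" "Im z' > 1" using z by (simp_all add: z'_def)
  have "depth (psl2_of a b c d) z' > 1" using z unfolding h z'_def by (simp add: depth_mult)
  then have big: "Im z' > (a - c * Re z')\<^sup>2 + (c * Im z')\<^sup>2"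
    using 1(1) z' unfolding depth_psl2_of[OF 1(1)] by (auto simp: less_divide_eq split: if_splits)
  have "c = 0"
  proof (rule ccontr)
    assume c: "c \<noteq> 0"
    have "(c * Im z')\<^sup>2 < Im z'" using big zero_le_power2[of "a - c * Re z'"] by linarith
    then have "c\<^sup>2 * Im z' < 1" using z' by (simp add: power_mult_distrib power2_eq_square)
    moreover have "c\<^sup>2 * 1 \<le> c\<^sup>2 * Im z'" using z' by (intro mult_left_mono) auto
    ultimately have "c\<^sup>2 < 1" by linarith
    then have c1: "c\<^sup>2 < 1" "c\<^sup>2 > 0" using c by simp_all
    have "1 < 1 / c\<^sup>2" using c1 by (simp add: field_simps)
    then obtain y where y: "1 < y" "y < real m * sin \<phi>" "y < 1 / c\<^sup>2" using tall between by metis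
    have "c\<^sup>2 * y < 1" using y(3) c1 by (simp add: field_simps)
    have "1 < 1 / (c\<^sup>2 * y)" using \<open>c\<^sup>2 * y < 1\<close> c1 y by (simp add: field_simps)
    then obtain v where v: "1 < v" "v < real m * sin \<phi>" "v < 1 / (c\<^sup>2 * y)" using tall between by metis
    have "c\<^sup>2 * y * v < 1" using v(3) c1 y by (simp add: field_simps)
    then have "y * (c\<^sup>2 * y * v) \<le> y * 1" using y by (intro mult_left_mono) auto
    then have D: "y / v - c\<^sup>2 * y\<^sup>2 \<ge> 0" using v by (simp add: field_simps power2_eq_square)
    \<comment> \<open>The height \<open>y\<close> puts the point into the strip of the first row; its real part is chosen so that its depth in the second horoball is \<open>v\<close>.\<close>
    define z2 where "z2 = Complex ((a - sqrt (y / v - c\<^sup>2 * y\<^sup>2)) / c) y"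
    have "depth (psl2_of a b c d) z2 = y / (y / v - c\<^sup>2 * y\<^sup>2 + c\<^sup>2 * y\<^sup>2)"
      unfolding depth_psl2_of[OF 1(1)] using D c by (simp add: z2_def power_mult_distrib)
    also have "\<dots> = v" using v y by simp
    finally have "mobius (inverse (psl2_of a b c d)) z2 \<in> open_row n m"
      using v strip_open_row by simp
    moreover have "z2 \<in> open_row n m" using y strip_open_row by (simp add: z2_def)
    moreover have "z2 \<in> uhp" using y by (simp add: z2_def uhp_iff)
    ultimately obtain k :: int where "h = g * \<tau> k"
      using row_tiling_overlap[OF T, of "mobius g z2"] by (auto simp: h psl2_inverse_mult mobius_mult)
    then have "psl2_of a b c d = \<tau> k" using 1 by simp
    then have "sq21 (psl2_of a b c d) = 0" by (simp add: sq_translation)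
    then show False using 1 c by (simp add: sq_psl2_of)
  qed
  then show ?thesis using 1 by (simp add: sq_psl2_of)
qed

text \<open>
For disjoint horoballs, the Euclidean diameter \<open>1 / sq21 g\<close> of the second is at most the height
\<open>sq11 h0\<close> of the first.
\<close>

lemma horoball_gap:
  assumes T: "row_tiling T" and h0: "h0 \<in> T" "g \<in> T" "sq21 h0 = 0" "sq21 g \<noteq> 0"
  shows "1 \<le> sq11 h0 * sq21 g"
proof (rule ccontr)
  have s: "sq11 h0 > 0" using h0 sq11_pos by blast
  assume near: "\<not> 1 \<le> sq11 h0 * sq21 g"
  obtain a b c d where abcd: "a * d - b * c = 1" "g = psl2_of a b c d" by (metis psl2_cases)
  have c: "c \<noteq> 0" "sq21 g = c\<^sup>2" using h0 abcd by (auto simp: sq_psl2_of)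
  have "sq11 h0 < 1 / c\<^sup>2" using near c by (simp add: field_simps)
  then obtain y where y: "sq11 h0 < y" "y < 1 / c\<^sup>2" using dense by blast
  define z where "z = Complex (a / c) y"
  have z: "z \<in> uhp" using y s by (simp add: z_def uhp_iff)
  have dh: "depth h0 z > 1" using y s by (simp add: depth_base_infinity[OF h0(3)] z_def)
  have "depth g z = 1 / (c\<^sup>2 * y)"
    unfolding abcd(2) depth_psl2_of[OF abcd(1)] using c y s by (simp add: z_def power2_eq_square)
  moreover have "c\<^sup>2 * y < 1" "c\<^sup>2 * y > 0" using y s c by (simp_all add: field_simps)
  ultimately have "depth g z > 1" by simp
  then have "sq21 (inverse h0 * g) = 0" using packing[OF T h0(1,2) z dh] by blast
  then show False using same_base_infinity h0(3,4) by blast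
qed

section \<open>Degenerate tilings\<close>

context
  fixes E assumes E: "row_tiling E" "degenerate E"
begin

lemma degenerate_sq21: "e \<in> E \<Longrightarrow> sq21 e = 0"
  using E by (simp add: degenerate_def)

text \<open>
Above a corner the first row fills the vertical line up to the height \<open>m\<close> times its scale, so the
horocyclic strip of the second row cannot begin below that height.
\<close>

lemma scale_gap:
  assumes "e \<in> E" "e' \<in> E" "sq11 e < sq11 e'" shows "real m * sq11 e \<le> sq11 e'"
proof (rule ccontr)
  assume not: "\<not> ?thesis"
  obtain a t where e: "a > 0" "sq11 e = a\<^sup>2" "\<And>z. mobius (inverse e) z = (z - of_real t) / of_real (a\<^sup>2)"
    using upper_form[OF degenerate_sq21[OF assms(1)]] by metis
  define r where "r = sq11 e' / sq11 e"
  have s: "sq11 e > 0" using e by simp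
  have r: "1 < r" "r < real m" using not assms(3) s by (auto simp: r_def field_simps)
  have "r * 1 < r * (real m * sin \<phi>)" using r tall by (intro mult_strict_left_mono) auto
  then obtain y where y: "r < y" "y < real m" "y < r * (real m * sin \<phi>)" using r between by (metis mult.right_neutral)
  define z where "z = of_real t + \<i> * of_real (sq11 e * y)"
  have z: "z \<in> uhp" using s y r by (simp add: z_def uhp_iff)
  have "mobius (inverse e) z = \<i> * of_real y" using e by (simp add: z_def)
  then have "mobius (inverse e) z \<in> open_row n m" using axis_open_row y r by simp
  moreover have d: "depth e' z = y / r"
    using depth_base_infinity[OF degenerate_sq21[OF assms(2)]] s by (simp add: z_def r_def)
  have "1 < depth e' z" "depth e' z < real m * sin \<phi>"
    unfolding d using y r by (simp_all add: field_simps)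
  then have "mobius (inverse e') z \<in> open_row n m" by (rule strip_open_row)
  ultimately obtain k :: int where "e' = e * \<tau> k" using row_tiling_overlap[OF E(1) assms(1,2) z] by metis
  then show False using assms(3) by simp
qed

text \<open>
The point just below a corner of the row of \<open>e\<close> is covered by some other row. Its scale is not the same,
because rows of the same scale overlap and hence coincide. It cannot be larger, since larger scales are larger by a factor of at least \<open>m\<close> and prongs do not reach that far down. So
it is smaller, by a factor of at least \<open>m\<close> because of the gap, and not by much more, because the row
has to reach up to the point.
\<close>

lemma scale_below:
  assumes "e \<in> E" "0 < \<epsilon>" "\<epsilon> < 1"
  obtains e' where "e' \<in> E" "real m * sq11 e' \<le> sq11 e" "(1 - \<epsilon>) * sq11 e \<le> real m * sq11 e'"
proof -
  obtain a t where e: "a > 0" "sq11 e = a\<^sup>2" "\<And>z. mobius (inverse e) z = (z - of_real t) / of_real (a\<^sup>2)"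
    using upper_form[OF degenerate_sq21[OF assms(1)]] by metis
  have s: "sq11 e > 0" using e by simp
  define z where "z = of_real t + \<i> * of_real (sq11 e * (1 - \<epsilon>))"
  have z: "z \<in> uhp" using s assms by (simp add: z_def uhp_iff)
  have mz: "mobius (inverse e) z = \<i> * of_real (1 - \<epsilon>)" using e by (simp add: z_def)
  obtain e' where e': "e' \<in> E" "mobius (inverse e') z \<in> row n m" using row_tiling_cover[OF E(1) z] .
  have s': "sq11 e' > 0" using sq11_pos degenerate_sq21 e' by blast
  have d: "depth e' z = (1 - \<epsilon>) * sq11 e / sq11 e'"
    using depth_base_infinity[OF degenerate_sq21[OF e'(1)]] by (simp add: z_def)
  have lo: "sin \<phi> * sq11 e' \<le> (1 - \<epsilon>) * sq11 e" and hi: "(1 - \<epsilon>) * sq11 e \<le> real m * sq11 e'"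
    using row_Im[OF e'(2)] row_Im_le[OF e'(2)] s' unfolding d by (simp_all add: field_simps)
  have "\<not> sq11 e < sq11 e'"
  proof
    assume "sq11 e < sq11 e'"
    then have "sin \<phi> * (real m * sq11 e) \<le> sin \<phi> * sq11 e'"
      using scale_gap assms(1) e'(1) width_bounds by (intro mult_left_mono) auto
    also have "\<dots> \<le> (1 - \<epsilon>) * sq11 e" by (rule lo)
    also have "\<dots> < 1 * sq11 e" using s assms by (intro mult_strict_right_mono) auto
    also have "\<dots> < (real m * sin \<phi>) * sq11 e" using s tall by (intro mult_strict_right_mono) auto
    finally show False by (simp add: algebra_simps)
  qed
  moreover have "sq11 e \<noteq> sq11 e'"
  proof
    assume eq: "sq11 e = sq11 e'"
    have "1 < real m" using m_bounds by linarith
    then obtain y where y: "1 < y" "y < real m" "y < real m * sin \<phi>" using tall between by metis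
    define z2 where "z2 = of_real t + \<i> * of_real (sq11 e * y)"
    have z2: "z2 \<in> uhp" using s y by (simp add: z2_def uhp_iff)
    have "mobius (inverse e) z2 = \<i> * of_real y" using e by (simp add: z2_def)
    then have "mobius (inverse e) z2 \<in> open_row n m" using axis_open_row y by simp
    moreover have "depth e' z2 = y"
      using depth_base_infinity[OF degenerate_sq21[OF e'(1)]] s eq by (simp add: z2_def)
    then have "mobius (inverse e') z2 \<in> open_row n m" using y by (intro strip_open_row) simp_all
    ultimately obtain k :: int where "e' = e * \<tau> k" using row_tiling_overlap[OF E(1) assms(1) e'(1) z2] by metis
    then have "mobius (inverse e) z \<in> row n m" using e'(2) row_same z by simp
    then show False using pinch_not_row[of "1 - \<epsilon>"] assms by (simp add: mz)
  qed
  ultimately have "real m * sq11 e' \<le> sq11 e" using scale_gap[OF e'(1) assms(1)] by linarith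
  then show thesis using that e' hi by blast
qed

text \<open>
Two different scales that are almost as large as \<open>sq11 e / m\<close> would contradict the gap between scales.
\<close>

lemma scale_next:
  assumes "e \<in> E" obtains e' where "e' \<in> E" "real m * sq11 e' = sq11 e"
proof -
  have s: "sq11 e > 0" using sq11_pos degenerate_sq21 assms by blast
  obtain e1 where e1: "e1 \<in> E" "real m * sq11 e1 \<le> sq11 e" "(1 - 1/2) * sq11 e \<le> real m * sq11 e1"
    using scale_below[OF assms, of "1/2"] by auto
  show thesis
  proof (cases "real m * sq11 e1 = sq11 e")
    case True then show thesis using that e1 by blast
  next
    case False
    define q where "q = real m * sq11 e1 / sq11 e"
    define \<epsilon> where "\<epsilon> = (1 - q) / 2"
    have q: "q < 1" "1/2 \<le> q" using e1 False s by (auto simp: field_simps q_def)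
    then have "0 < \<epsilon>" "\<epsilon> < 1" by (simp_all add: \<epsilon>_def)
    then obtain e2 where e2: "e2 \<in> E" "real m * sq11 e2 \<le> sq11 e" "(1 - \<epsilon>) * sq11 e \<le> real m * sq11 e2"
      using scale_below[OF assms] by metis
    have "q < 1 - \<epsilon>" using q by (simp add: \<epsilon>_def field_simps)
    then have "real m * sq11 e1 < (1 - \<epsilon>) * sq11 e" using s unfolding q_def by (simp only: divide_less_eq)
    then have "real m * sq11 e1 < real m * sq11 e2" using e2 by linarith
    then have "sq11 e1 < sq11 e2" using m_bounds by simp
    then have "real m * sq11 e1 \<le> sq11 e2" using scale_gap e1 e2 by blast
    then have "real m * (real m * sq11 e1) \<le> real m * sq11 e2" using m_bounds by (intro mult_left_mono) auto
    moreover have "2 * (real m * sq11 e1) \<le> real m * (real m * sq11 e1)"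
      using m_bounds e1 s by (intro mult_right_mono) auto
    moreover have "sq11 e \<le> 2 * (real m * sq11 e1)" using e1(3) by simp
    ultimately have "sq11 e \<le> real m * sq11 e2" by linarith
    then show thesis using that e2 by force
  qed
qed

lemma scale_power:
  assumes "e \<in> E" obtains e' where "e' \<in> E" "real m ^ j * sq11 e' = sq11 e"
proof (induction j arbitrary: thesis)
  case 0 then show ?case using assms by simp
next
  case (Suc j)
  obtain e' where e': "e' \<in> E" "real m ^ j * sq11 e' = sq11 e" by (rule Suc.IH)
  obtain e2 where e2: "e2 \<in> E" "real m * sq11 e2 = sq11 e'" using scale_next[OF e'(1)] .
  have "real m ^ Suc j * sq11 e2 = real m ^ j * (real m * sq11 e2)" by simp
  then show ?case using e2 e' by (intro Suc.prems[of e2]) simp_all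
qed

lemma scale_ratio:
  assumes "e \<in> E" "e' \<in> E" "sq11 e \<le> sq11 e'"
  obtains j where "sq11 e' = real m ^ j * sq11 e"
proof -
  have s: "sq11 e > 0" using sq11_pos degenerate_sq21 assms by blast
  define j where "j = (LEAST j. sq11 e' < real m ^ Suc j * sq11 e)"
  obtain N where "sq11 e' / sq11 e < real m ^ N" using real_arch_pow[of "real m"] m_bounds by auto
  then have "sq11 e' < real m ^ N * sq11 e" using s by (simp add: field_simps)
  also have "\<dots> \<le> real m ^ Suc N * sq11 e" using m_bounds s by (intro mult_right_mono power_increasing) auto
  finally have ex: "\<exists>j. sq11 e' < real m ^ Suc j * sq11 e" by blast
  have j1: "sq11 e' < real m ^ Suc j * sq11 e" unfolding j_def using ex by (rule LeastI_ex)
  have j2: "real m ^ j * sq11 e \<le> sq11 e'"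
  proof (cases j)
    case 0 then show ?thesis using assms by simp
  next
    case (Suc i)
    then have "\<not> sq11 e' < real m ^ Suc i * sq11 e" using not_less_Least[of i] unfolding j_def by (metis lessI)
    then show ?thesis using Suc by simp
  qed
  obtain e2 where e2: "e2 \<in> E" "real m ^ j * sq11 e2 = sq11 e'" using scale_power[OF assms(2)] .
  have mj: "real m ^ j > 0" using m_bounds by simp
  have "real m ^ j * sq11 e \<le> real m ^ j * sq11 e2" using j2 e2 by simp
  then have "sq11 e \<le> sq11 e2" using mj by simp
  moreover have "real m ^ j * sq11 e2 < real m ^ j * (real m * sq11 e)" using j1 e2 by (simp add: algebra_simps)
  then have "sq11 e2 < real m * sq11 e" using mj by simp
  ultimately have "sq11 e2 = sq11 e" using scale_gap[OF assms(1) e2(1)] by linarith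
  then show thesis using that e2 by metis
qed

text \<open>
Let \<open>\<sigma> = sq11 e0\<close>. A row of scale \<open>\<sigma> m^i\<close> has the period \<open>\<sigma> \<lambda> m^(i+1)\<close>, which divides \<open>\<sigma> \<lambda> m^j\<close>
for \<open>i < j\<close>. The translation \<open>t\<close> acts on such a row from the left as a power of the period acts from
the right.
\<close>

lemma degenerate_period:
  assumes e0: "e0 \<in> E" and t: "t = sq11 e0 * \<Lambda> * real m powi j"
    and e: "e \<in> E" "sq11 e \<le> t / w"
  shows "psl2_translation t * e \<in> E" "psl2_translation (- t) * e \<in> E"
proof -
  have s0: "sq11 e0 > 0" and s: "sq11 e > 0" using sq11_pos degenerate_sq21 e0 e by blast+
  have tw: "t / w = sq11 e0 * real m powi (j - 1)"
    using m_bounds width_bounds by (simp add: t power_int_diff field_simps)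
  have "\<exists>i::int. sq11 e = sq11 e0 * real m powi i"
  proof (cases "sq11 e0 \<le> sq11 e")
    case True
    then obtain i where "sq11 e = real m ^ i * sq11 e0" using scale_ratio[OF e0 e(1)] by metis
    then show ?thesis by (intro exI[of _ "int i"]) (simp add: power_int_of_nat)
  next
    case False
    then obtain i where "sq11 e0 = real m ^ i * sq11 e" using scale_ratio[OF e(1) e0] by (metis le_cases)
    then show ?thesis using m_bounds by (intro exI[of _ "- int i"]) (simp add: power_int_minus power_int_of_nat field_simps)
  qed
  then obtain i where i: "sq11 e = sq11 e0 * real m powi i" by blast
  have "real m powi i \<le> real m powi (j - 1)" using e(2) s0 unfolding tw i by simp
  then have ij: "i \<le> j - 1"
    using power_int_strict_increasing[of "j - 1" i "real m"] m_bounds by fastforce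
  define N where "N = int (m ^ nat (j - 1 - i))"
  have "real_of_int N = real m powi (j - 1 - i)" using ij by (simp add: N_def power_int_def)
  then have tN: "t = sq11 e * (of_int N * w)"
    using m_bounds ij by (simp add: t i power_int_diff power_int_add field_simps)
  obtain a b where ab: "a > 0" "e = psl2_of a (b / a) 0 (1 / a)" "sq11 e = a\<^sup>2"
    using upper_form[OF degenerate_sq21[OF e(1)]] by metis
  have ut: "psl2_translation (a\<^sup>2 * x) * e = e * psl2_translation x" for x
    unfolding ab(2) psl2_translation_eq using ab(1)
    by (subst psl2_of_mult; simp add: psl2_of_mult field_simps power2_eq_square)
  have "psl2_translation t * e = e * \<tau> N" "psl2_translation (- t) * e = e * \<tau> (- N)"
    using ut[of "of_int N * w"] ut[of "- (of_int N * w)"] tN ab(3) by simp_all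
  then show "psl2_translation t * e \<in> E" "psl2_translation (- t) * e \<in> E"
    using row_tiling_shift[OF E(1) e(1)] by metis+
qed

text \<open>
On a compact set of placements the scale is bounded, so for large scaling factor of \<open>p k\<close> only rows
with period \<open>t k\<close> are seen there.
\<close>

lemma degenerate_agreement:
  assumes e0: "e0 \<in> E" and t: "\<And>k. t k = sq11 e0 * \<Lambda> * real m powi j k"
    and p: "\<And>k. sq21 (p k) = 0" "filterlim (\<lambda>k. sq11 (p k) * t k) at_top sequentially"
    and Q: "compact Q"
  shows "\<exists>N. \<forall>k\<ge>N. move_tiling (p k) E \<inter> Q = move_tiling (p k * psl2_translation (t k)) E \<inter> Q"
proof -
  have "compact (sq11 ` Q)" using Q continuous_sq11 by (metis compact_continuous_image continuous_on_subset subset_UNIV)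
  then have "bounded (sq11 ` Q)" by (rule compact_imp_bounded)
  then obtain M where "\<forall>x\<in>sq11 ` Q. norm x \<le> M" unfolding bounded_iff by blast
  then have M: "\<And>g. g \<in> Q \<Longrightarrow> sq11 g \<le> M" by (auto simp: abs_le_iff)
  have "\<forall>\<^sub>F k in sequentially. M * w \<le> sq11 (p k) * t k" using p(2) by (simp add: filterlim_at_top)
  then obtain N where N: "\<And>k. k \<ge> N \<Longrightarrow> M * w \<le> sq11 (p k) * t k" by (auto simp: eventually_sequentially)
  have small: "sq11 e \<le> t k / w" if "e \<in> E" "sq11 (p k * e) \<le> M" "k \<ge> N" for e k
  proof -
    have "sq11 (p k) * sq11 e \<le> M" using that sq_upper_mult(2)[OF p(1) degenerate_sq21] by simp
    then have "sq11 (p k) * sq11 e * w \<le> M * w" using period_bounds by (intro mult_right_mono) auto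
    also have "\<dots> \<le> sq11 (p k) * t k" using N that by blast
    finally have "sq11 e * w \<le> t k" using sq11_pos[OF p(1)[of k]] by (simp add: algebra_simps)
    then show ?thesis using period_bounds by (simp add: field_simps)
  qed
  have "move_tiling (p k) E \<inter> Q = move_tiling (p k * psl2_translation (t k)) E \<inter> Q" if k: "k \<ge> N" for k
  proof (intro set_eqI iffI)
    fix g assume g: "g \<in> move_tiling (p k) E \<inter> Q"
    then obtain e where e: "e \<in> E" "g = p k * e" by (auto simp: move_tiling_def)
    then have "psl2_translation (- t k) * e \<in> E"
      using degenerate_period(2)[OF e0 t] small[of e k] g M k by simp
    then have "p k * psl2_translation (t k) * (psl2_translation (- t k) * e) \<in> move_tiling (p k * psl2_translation (t k)) E"
      by (rule move_tilingI)
    moreover have "p k * psl2_translation (t k) * (psl2_translation (- t k) * e) = g"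
      using e by (metis mult.assoc psl2_cancel(2) translation_inverse)
    ultimately show "g \<in> move_tiling (p k * psl2_translation (t k)) E \<inter> Q" using g by simp
  next
    fix g assume g: "g \<in> move_tiling (p k * psl2_translation (t k)) E \<inter> Q"
    then obtain e where e: "e \<in> E" "g = p k * (psl2_translation (t k) * e)" by (auto simp: move_tiling_def mult.assoc)
    have "sq11 (p k * e) = sq11 g"
      unfolding e(2) using degenerate_sq21[OF e(1)] p(1)[of k] sq_translation
      by (simp add: sq_upper_mult)
    then have "psl2_translation (t k) * e \<in> E"
      using degenerate_period(1)[OF e0 t e(1)] small[of e k] e(1) g M k by simp
    then show "g \<in> move_tiling (p k) E \<inter> Q" using g e(2) move_tilingI by auto
  qed
  then show ?thesis by blast
qed

text \<open>
A degenerate tiling has rows of arbitrarily small scale.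
\<close>

lemma degenerate_hits:
  assumes "z \<in> uhp" obtains g where "g \<in> E" "depth g z > 1"
proof -
  define z' where "z' = Complex (Re z) (Im z * sin \<phi> / 2)"
  have z': "z' \<in> uhp" using assms width_bounds by (simp add: z'_def uhp_iff)
  obtain g where g: "g \<in> E" "mobius (inverse g) z' \<in> row n m" using row_tiling_cover[OF E(1) z'] .
  have s: "sq11 g > 0" "sq21 g = 0" using sq11_pos degenerate_sq21 g by blast+
  have "sin \<phi> \<le> Im z * sin \<phi> / 2 / sq11 g"
    using row_Im[OF g(2)] depth_base_infinity[OF s(2), of z'] by (simp add: z'_def)
  then have "2 * sq11 g \<le> Im z" using s width_bounds by (simp add: field_simps)
  then have "depth g z \<ge> 2" using s unfolding depth_base_infinity[OF s(2)] by (simp add: le_divide_eq)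
  then show thesis using that g by force
qed

end

end

section \<open>Conjugacies preserve degenerate tilings\<close>

locale conjugacy = X: hecke_tile n m + Y: hecke_tile n' m' for n m n' m' +
  fixes B B' :: "complex set" and X Y :: "psl2 set set" and \<alpha> :: "psl2 set \<Rightarrow> psl2 set"
  assumes B: "admissible_bump n m B" "admissible_bump n' m' B'"
    and X: "X \<subseteq> tilings n m B" "closedin (tiling_space n m B) X"
      "\<And>g S. S \<in> X \<Longrightarrow> move_tiling g S \<in> X"
    and Y: "Y \<subseteq> tilings n' m' B'" "closedin (tiling_space n' m' B') Y"
      "\<And>g S. S \<in> Y \<Longrightarrow> move_tiling g S \<in> Y"
    and homeo: "homeomorphic_map (subtopology (tiling_space n m B) X) (subtopology (tiling_space n' m' B') Y) \<alpha>"
    and equivariant: "\<And>g S. S \<in> X \<Longrightarrow> \<alpha> (move_tiling g S) = move_tiling g (\<alpha> S)"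
begin

abbreviation "TX \<equiv> subtopology (tiling_space n m B) X"
abbreviation "TY \<equiv> subtopology (tiling_space n' m' B') Y"

lemma TX: "TX = subtopology fell_topology X" "topspace TX = X"
proof -
  show "TX = subtopology fell_topology X"
    using X(1) by (simp add: tiling_space_def subtopology_subtopology Int_absorb1)
  show "topspace TX = X" using closedin_subset[OF X(2)] by auto
qed

lemma TY: "TY = subtopology fell_topology Y" "topspace TY = Y" "compact_space TY"
proof -
  show "TY = subtopology fell_topology Y"
    using Y(1) by (simp add: tiling_space_def subtopology_subtopology Int_absorb1)
  show "topspace TY = Y" using closedin_subset[OF Y(2)] by auto
  show "compact_space TY"
    using Y.compact_tiling_space[OF B(2)] Y(2) closedin_compact_space compact_space_subtopology by blast
qed

lemma closed_X: "S \<in> X \<Longrightarrow> closed S"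
  using TX(2) unfolding TX(1) topspace_subtopology topspace_fell_topology by blast

lemma alpha_Y: "S \<in> X \<Longrightarrow> \<alpha> S \<in> Y"
  using homeomorphic_imp_surjective_map[OF homeo] TX(2) TY(2) by auto

lemma inj_alpha: "S \<in> X \<Longrightarrow> S' \<in> X \<Longrightarrow> \<alpha> S = \<alpha> S' \<Longrightarrow> S = S'"
  using homeomorphic_imp_injective_map[OF homeo] TX(2) by (auto dest: inj_onD)

lemma row_X: "S \<in> X \<Longrightarrow> X.row_tiling S" and row_Y: "T \<in> Y \<Longrightarrow> Y.row_tiling T"
  using X.tilings_row_tiling[OF B(1)] Y.tilings_row_tiling[OF B(2)] X(1) Y(1) by blast+

lemma closedin_miss: "open V \<Longrightarrow> closedin TX {C \<in> X. C \<inter> V = {}}"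
proof -
  assume "open V"
  then have "openin TX ({C. closed C \<and> C \<inter> V \<noteq> {}} \<inter> X)"
    unfolding TX(1) by (intro openin_subtopology_Int openin_fell_hit)
  moreover have "X - {C \<in> X. C \<inter> V = {}} = {C. closed C \<and> C \<inter> V \<noteq> {}} \<inter> X"
    using closed_X by blast
  ultimately show ?thesis unfolding closedin_def TX(2) by auto
qed

lemma openin_miss: "compact K \<Longrightarrow> openin TX {C \<in> X. C \<inter> K = {}}"
proof -
  assume "compact K"
  then have "openin TX ({C. closed C \<and> C \<inter> K = {}} \<inter> X)"
    unfolding TX(1) by (intro openin_subtopology_Int openin_fell_miss)
  moreover have "{C \<in> X. C \<inter> K = {}} = {C. closed C \<and> C \<inter> K = {}} \<inter> X"
    using closed_X by blast
  ultimately show ?thesis by simp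
qed

text \<open>
The mechanism by which asymptotic periods of tilings in \<open>Y\<close> are felt in \<open>X\<close>.
\<close>

lemma transfer:
  assumes x: "\<And>k::nat. x k \<in> X" "\<And>k. x' k \<in> X" "\<And>k. x k \<inter> V = {}"
    and V: "open V" "compact K" "K \<subseteq> V"
    and agree: "\<And>Q. compact Q \<Longrightarrow> \<exists>N. \<forall>k\<ge>N. \<alpha> (x k) \<inter> Q = \<alpha> (x' k) \<inter> Q"
  shows "\<exists>k. x' k \<inter> K = {}"
proof -
  have "\<exists>k. \<alpha> (x' k) \<in> \<alpha> ` {C \<in> X. C \<inter> K = {}}"
  proof (rule asymptotic_agreement[of Y "\<alpha> ` {C \<in> X. C \<inter> V = {}}" _ "\<lambda>k. \<alpha> (x k)"])
    show "compact_space (subtopology fell_topology Y)" using TY by simp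
    show "closedin (subtopology fell_topology Y) (\<alpha> ` {C \<in> X. C \<inter> V = {}})"
      using homeomorphic_imp_closed_map[OF homeo] closedin_miss[OF V(1)] TY(1) unfolding closed_map_def by simp
    show "openin (subtopology fell_topology Y) (\<alpha> ` {C \<in> X. C \<inter> K = {}})"
      using homeomorphic_imp_open_map[OF homeo] openin_miss[OF V(2)] TY(1) unfolding open_map_def by simp
    show "\<alpha> ` {C \<in> X. C \<inter> V = {}} \<subseteq> \<alpha> ` {C \<in> X. C \<inter> K = {}}" using V(3) by blast
    show "\<alpha> (x k) \<in> \<alpha> ` {C \<in> X. C \<inter> V = {}}" for k using x by blast
    show "\<alpha> (x' k) \<in> topspace (subtopology fell_topology Y)" for k
      using x(2) alpha_Y TY by metis
  qed (fact agree)
  then obtain k C where "\<alpha> (x' k) = \<alpha> C" "C \<in> X" "C \<inter> K = {}" by blast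
  then show ?thesis using inj_alpha x(2) by blast
qed

lemma powi_grows:
  assumes "s > 0" obtains j0 where "\<And>k. M \<le> s * real m' powi (int (k + j0))"
    "filterlim (\<lambda>k. s * real m' powi (int (k + j0))) at_top sequentially"
proof -
  have m1: "real m' > 1" using Y.m_bounds by linarith
  obtain j0 where "M / s < real m' ^ j0" using real_arch_pow[OF m1] by blast
  then have j0: "M < s * real m' ^ j0" using assms by (simp add: field_simps)
  have "M \<le> s * real m' powi (int (k + j0))" for k
  proof -
    have "s * real m' ^ j0 \<le> s * real m' ^ (k + j0)" using m1 assms by (intro mult_left_mono power_increasing) auto
    then show ?thesis using j0 by (simp only: power_int_of_nat)
  qed
  moreover have "filterlim (\<lambda>k. s * real m' powi (int (k + j0))) at_top sequentially"
  proof -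
    have "filterlim (\<lambda>k. real m' ^ k) at_top sequentially"
      using filterlim_at_infinity_imp_filterlim_at_top[OF filterlim_realpow_sequentially_gt1[of "real m'"]] m1
      by (auto intro!: always_eventually)
    then have "filterlim (\<lambda>k. real m' ^ (k + j0)) at_top sequentially"
      by (rule filterlim_compose) (rule filterlim_add_const_nat_at_top)
    then have "filterlim (\<lambda>k. s * real m' ^ (k + j0)) at_top sequentially"
      using assms by (intro filterlim_tendsto_pos_mult_at_top[OF tendsto_const])
    then show ?thesis by (simp only: power_int_of_nat)
  qed
  ultimately show thesis using that by blast
qed

text \<open>
A tiling of \<open>Y\<close> with base point \<open>\<infinity>\<close> only is the limit of its translates by the numbers \<open>t k\<close>, which tend
to infinity. If all horoballs of \<open>D\<close> had the base point \<open>0\<close>, then those of the translates of \<open>D\<close> would have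
the base points \<open>t k\<close> and could not accumulate at \<open>D\<close>.
\<close>

lemma no_base_zero_all:
  assumes D: "D \<in> X" "degenerate (\<alpha> D)" and h: "h \<in> D"
    and all: "\<And>g. g \<in> D \<Longrightarrow> sq11 g = 0"
  shows False
proof -
  let ?E = "\<alpha> D"
  have E: "Y.row_tiling ?E" using row_Y alpha_Y D by blast
  have i: "\<i> \<in> uhp" by (simp add: uhp_iff)
  obtain e0 where e0: "e0 \<in> ?E" using Y.row_tiling_cover[OF E i] by metis
  have s0: "sq11 e0 * Y.\<Lambda> > 0" using Y.width_bounds sq11_pos Y.degenerate_sq21[OF E D(2) e0] by simp
  obtain j0 where j0: "\<And>k. 1 \<le> sq11 e0 * Y.\<Lambda> * real m' powi (int (k + j0))"
    "filterlim (\<lambda>k. sq11 e0 * Y.\<Lambda> * real m' powi (int (k + j0))) at_top sequentially"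
    using powi_grows[OF s0] by metis
  define t where "t k = sq11 e0 * Y.\<Lambda> * real m' powi (int (k + j0))" for k
  define V where "V = {g. sq11 g < sq21 g}"
  have "open V" unfolding V_def
    using continuous_sq11 continuous_sq21 by (rule open_Collect_less)
  have "\<exists>k::nat. D \<inter> {h} = {}"
  proof (rule transfer[where x = "\<lambda>k. move_tiling (psl2_translation (t k)) D" and x' = "\<lambda>k. D"])
    show "move_tiling (psl2_translation (t k)) D \<inter> V = {}" for k
    proof -
      have "\<not> sq11 (psl2_translation (t k) * g) < sq21 (psl2_translation (t k) * g)" if g: "g \<in> D" for g
      proof (cases g rule: psl2_cases)
        case (1 a b c d)
        then have "a = 0" using all[OF g] by (simp add: sq_psl2_of)
        have "(a + t k * c) * d - (b + t k * d) * c = 1" using 1 by (simp add: algebra_simps)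
        moreover have "psl2_translation (t k) * g = psl2_of (a + t k * c) (b + t k * d) c d"
          using 1 by (simp add: psl2_translation_eq psl2_of_mult)
        moreover have "1 * c\<^sup>2 \<le> (t k)\<^sup>2 * c\<^sup>2" using j0(1)[of k] by (intro mult_right_mono) (simp_all add: t_def)
        ultimately show ?thesis using \<open>a = 0\<close> by (simp add: sq_psl2_of power_mult_distrib)
      qed
      then show ?thesis by (auto simp: V_def move_tiling_def)
    qed
    show "{h} \<subseteq> V" using all[OF h] sq21_pos by (auto simp: V_def)
    fix Q :: "psl2 set" assume Q: "compact Q"
    have "\<exists>N. \<forall>k\<ge>N. move_tiling 1 ?E \<inter> Q = move_tiling (1 * psl2_translation (t k)) ?E \<inter> Q"
      using Y.degenerate_agreement[OF E D(2) e0, of t "\<lambda>k. int (k + j0)" "\<lambda>k. 1", OF _ _ _ Q]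
        j0(2) sq_translation[of 0] by (simp add: t_def translation_0)
    then show "\<exists>N. \<forall>k\<ge>N. \<alpha> (move_tiling (psl2_translation (t k)) D) \<inter> Q = ?E \<inter> Q"
      using D(1) by (auto simp: equivariant move_tiling_one)
  qed (use D X \<open>open V\<close> in auto)
  then show False using h by simp
qed

text \<open>
Let the horoball of \<open>h\<close> have base point \<open>0\<close> and a diameter at least half as large as that of any other
horoball of \<open>D\<close> at \<open>0\<close>. Use periods \<open>t k\<close> of \<open>\<alpha> D\<close> tending to \<open>0\<close>, and scale by \<open>r k\<close> so that the horoball of
\<open>h\<close> gets the diameter \<open>q\<^sup>2\<close> and the period becomes \<open>q\<close>, where \<open>q = q k\<close> tends to infinity. At the horizontal
distances \<open>2 q\<close> and \<open>q\<close> from the base point, the boundary of the horoball has heights of about \<open>4\<close> and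
\<open>1\<close>. So the two tilings that differ by the translation \<open>q\<close> look different: in the second one there is a tile
whose horoball contains \<open>2 \<i>\<close> and \<open>5 \<i>\<close>. In the first one, such a horoball would meet the large horoball
of \<open>h\<close> at \<open>5 \<i>\<close> and hence be concentric with it, but containing \<open>2 \<i>\<close> it would be more than twice as large.
\<close>

lemma no_base_zero_max:
  assumes D: "D \<in> X" "degenerate (\<alpha> D)" and h: "h \<in> D" "sq11 h = 0"
    and max: "\<And>g. g \<in> D \<Longrightarrow> sq11 g = 0 \<Longrightarrow> sq21 h \<le> 2 * sq21 g"
  shows False
proof -
  let ?E = "\<alpha> D"
  define C where "C = sq21 h"
  have C: "C > 0" using h sq21_pos by (simp add: C_def)
  have E: "Y.row_tiling ?E" using row_Y alpha_Y D by blast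
  have RD: "X.row_tiling D" using row_X D by blast
  have i: "\<i> \<in> uhp" by (simp add: uhp_iff)
  obtain e0 where e0: "e0 \<in> ?E" using Y.row_tiling_cover[OF E i] by metis
  have s0: "sq11 e0 * Y.\<Lambda> > 0" using Y.width_bounds sq11_pos Y.degenerate_sq21[OF E D(2) e0] by simp
  define s where "s = sq11 e0 * Y.\<Lambda>"
  have "1 / (C * s) > 0" using s0 C by (simp add: s_def)
  then obtain j0 where j0: "\<And>k. 10 \<le> 1 / (C * s) * real m' powi (int (k + j0))"
    "filterlim (\<lambda>k. 1 / (C * s) * real m' powi (int (k + j0))) at_top sequentially"
    using powi_grows by metis
  define t where "t k = s * real m' powi (- int (k + j0))" for k
  have t0: "t k > 0" for k using s0 Y.m_bounds by (simp add: t_def s_def)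
  define q where "q k = 1 / (C * t k)" for k
  have q: "q k = 1 / (C * s) * real m' powi (int (k + j0))" for k
  proof -
    have inv: "real m' powi (- i) = 1 / real m' powi i" for i by (simp add: power_int_minus divide_simps)
    show ?thesis unfolding q_def t_def inv using Y.m_bounds C s0 by (simp add: s_def)
  qed
  have q10: "q k \<ge> 10" for k using j0(1) q by simp
  define r where "r k = C * (q k)\<^sup>2" for k
  have r0: "r k > 0" for k using C q10[of k] by (simp add: r_def)
  have rt: "r k * t k = q k" for k using C t0[of k] by (simp add: r_def q_def power2_eq_square)
  define p where "p k = psl2_translation (- 2 * q k) * dilation (r k)" for k
  have p: "sq21 (p k) = 0" "sq11 (p k) = r k" for k
    unfolding p_def using sq_translation sq_dilation[OF r0[of k]] by (simp_all add: sq_upper_mult)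
  have pinv: "mobius (inverse (p k)) z = (z + of_real (2 * q k)) / of_real (r k)" if "z \<in> uhp" for k z
    using that r0[of k]
    by (simp add: p_def psl2_inverse_mult mobius_mult translation_inverse mobius_translation mobius_inverse_dilation)
  have ptinv: "mobius (inverse (p k * psl2_translation (t k))) z = (z + of_real (q k)) / of_real (r k)" if "z \<in> uhp" for k z
  proof -
    have "mobius (inverse (p k * psl2_translation (t k))) z = (z + of_real (2 * q k)) / of_real (r k) - of_real (t k)"
      using that by (simp add: psl2_inverse_mult[of "p k"] mobius_mult pinv translation_inverse mobius_translation)
    also have "\<dots> = (z + of_real (2 * q k) - of_real (r k * t k)) / of_real (r k)"
      using r0[of k] by (simp add: field_simps)
    finally show ?thesis by (simp add: rt)
  qed
  have dz: "depth g ((\<i> * of_real v + of_real u) / of_real (r k)) = v * r k / (sq21 g * (u\<^sup>2 + v\<^sup>2))"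
    if "sq11 g = 0" for g u v k
  proof -
    let ?z = "(\<i> * of_real v + of_real u) / of_real (r k)"
    have Q: "(cmod ?z)\<^sup>2 = (u\<^sup>2 + v\<^sup>2) / (r k)\<^sup>2"
      using r0[of k] by (simp add: norm_divide power_divide cmod_power2)
    have "Im ?z = v / r k" by simp
    then have "depth g ?z = v / r k / (sq21 g * ((u\<^sup>2 + v\<^sup>2) / (r k)\<^sup>2))"
      unfolding depth_base_zero[OF that] Q by simp
    also have "\<dots> = v * r k / (sq21 g * (u\<^sup>2 + v\<^sup>2))"
      using r0[of k] by (simp add: power2_eq_square)
    finally show ?thesis .
  qed
  have i25: "2 * \<i> \<in> uhp" "5 * \<i> \<in> uhp" by (simp_all add: uhp_iff)
  \<comment> \<open>The open set \<open>V\<close> separates the two tilings; the compact set \<open>K\<close> inside it is met by the second one, where the condition on the real part can be achieved by a shift along the row.\<close>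
  define V where "V = {g. depth g (2 * \<i>) > 1} \<inter> {g. depth g (5 * \<i>) > 1}"
  have cont: "continuous_on UNIV (\<lambda>g. depth g z)" if "z \<in> uhp" for z
    using continuous_mobius_inverse[OF that] by (intro continuous_intros)
  have "open V" unfolding V_def
    by (intro open_Int open_Collect_less cont i25 continuous_on_const)
  define R where "R = cbox (Complex 0 (3/2)) (Complex X.w 2)"
  define K where "K = {g. mobius (inverse g) (2 * \<i>) \<in> R} \<inter> {g. 3/2 \<le> depth g (5 * \<i>)}"
  have "compact K" unfolding K_def
  proof (rule compact_Int_closed)
    show "compact {g. mobius (inverse g) (2 * \<i>) \<in> R}"
      by (rule compact_placements[of _ _ "3/2"]) (auto simp: R_def in_cbox_complex_iff uhp_iff)
    show "closed {g. 3/2 \<le> depth g (5 * \<i>)}"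
      by (intro closed_Collect_le cont i25 continuous_on_const)
  qed
  have "\<exists>k. move_tiling (p k * psl2_translation (t k)) D \<inter> K = {}"
  proof (rule transfer[where x = "\<lambda>k. move_tiling (p k) D" and V = V])
    show "move_tiling (p k) D \<inter> V = {}" for k
    proof (rule ccontr)
      assume "\<not> ?thesis"
      then obtain g where g: "g \<in> D" "depth (p k * g) (2 * \<i>) > 1" "depth (p k * g) (5 * \<i>) > 1"
        by (auto simp: V_def move_tiling_def)
      define z where "z = mobius (inverse (p k)) (5 * \<i>)"
      have z: "z \<in> uhp" using i25 by (simp add: z_def)
      have "z = (\<i> * of_real 5 + of_real (2 * q k)) / of_real (r k)" unfolding z_def pinv[OF i25(2)] by (simp add: mult.commute)
      then have "depth h z = 5 * r k / (C * ((2 * q k)\<^sup>2 + 5\<^sup>2))"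
        unfolding C_def by (simp only: dz[OF h(2)])
      also have "\<dots> = 5 * (q k)\<^sup>2 / (4 * (q k)\<^sup>2 + 25)" using C by (simp add: r_def power_mult_distrib)
      also have "\<dots> > 1"
      proof -
        have "10 * 10 \<le> (q k)\<^sup>2" unfolding power2_eq_square using q10[of k] by (intro mult_mono) auto
        then show ?thesis by (simp add: less_divide_eq add_pos_pos)
      qed
      finally have "depth h z > 1" .
      moreover have "depth g z > 1" using g(3) i25 by (simp add: depth_mult z_def)
      ultimately have "sq21 (inverse h * g) = 0" using X.packing[OF RD h(1) g(1) z] by simp
      then have g0: "sq11 g = 0" using same_base_zero h(2) by blast
      have "depth g ((\<i> * of_real 2 + of_real (2 * q k)) / of_real (r k)) > 1"
        using g(2) i25 by (simp add: depth_mult pinv mult.commute)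
      then have "2 * r k / (sq21 g * ((2 * q k)\<^sup>2 + 2\<^sup>2)) > 1" by (simp only: dz[OF g0])
      moreover have sg: "sq21 g > 0" using g0 sq21_pos by blast
      ultimately have "sq21 g * ((2 * q k)\<^sup>2 + 2\<^sup>2) < 2 * r k"
        by (subst (asm) less_divide_eq) (auto simp: add_nonneg_pos split: if_splits)
      moreover have "C * ((2 * q k)\<^sup>2 + 2\<^sup>2) \<le> 2 * sq21 g * ((2 * q k)\<^sup>2 + 2\<^sup>2)"
        using max[OF g(1) g0] by (intro mult_right_mono) (auto simp: C_def)
      ultimately show False using C by (simp add: r_def power_mult_distrib algebra_simps)
    qed
    show "K \<subseteq> V" by (auto simp: K_def V_def R_def in_cbox_complex_iff)
    fix Q :: "psl2 set" assume Q: "compact Q"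
    have "\<exists>N. \<forall>k\<ge>N. move_tiling (p k) ?E \<inter> Q = move_tiling (p k * psl2_translation (t k)) ?E \<inter> Q"
    proof (rule Y.degenerate_agreement[OF E D(2) e0])
      show "t k = sq11 e0 * Y.\<Lambda> * real m' powi (- int (k + j0))" for k by (simp add: t_def s_def)
      show "filterlim (\<lambda>k. sq11 (p k) * t k) at_top sequentially"
        unfolding p rt q by (rule j0(2))
    qed (use p Q in auto)
    then show "\<exists>N. \<forall>k\<ge>N. \<alpha> (move_tiling (p k) D) \<inter> Q = \<alpha> (move_tiling (p k * psl2_translation (t k)) D) \<inter> Q"
      using D(1) by (simp add: equivariant)
  qed (use D X \<open>open V\<close> \<open>compact K\<close> in auto)
  then obtain k where k: "move_tiling (p k * psl2_translation (t k)) D \<inter> K = {}" by blast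
  let ?p = "p k * psl2_translation (t k)"
  have dp: "depth (?p * h) (\<i> * of_real v) = v * (q k)\<^sup>2 / ((q k)\<^sup>2 + v\<^sup>2)" if "v > 0" for v
  proof -
    have "\<i> * of_real v \<in> uhp" using that by (simp add: uhp_iff)
    then have "depth (?p * h) (\<i> * of_real v) = v * r k / (C * ((q k)\<^sup>2 + v\<^sup>2))"
      using dz[OF h(2)] by (simp only: depth_mult ptinv) (simp add: C_def)
    then show ?thesis using C by (simp add: r_def)
  qed
  have q100: "10 * 10 \<le> (q k)\<^sup>2" unfolding power2_eq_square using q10[of k] by (intro mult_mono) auto
  obtain j :: int where j: "0 \<le> Re (mobius (inverse (?p * h)) (2 * \<i>)) - of_int j * X.w"
    "Re (mobius (inverse (?p * h)) (2 * \<i>)) - of_int j * X.w < X.w"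
    using floor_shift[OF X.period_bounds(1)] by metis
  define g where "g = h * X.\<tau> j"
  have gD: "g \<in> D" using X.row_tiling_shift[OF RD h(1)] by (simp add: g_def)
  have gm: "mobius (inverse (?p * g)) z = mobius (inverse (?p * h)) z - of_real (of_int j * X.w)" if "z \<in> uhp" for z
    using X.mobius_inverse_tau[OF that, of "?p * h" j] by (simp add: g_def mult.assoc)
  have d2: "depth (?p * g) (2 * \<i>) = 2 * (q k)\<^sup>2 / ((q k)\<^sup>2 + 4)" "depth (?p * g) (5 * \<i>) = 5 * (q k)\<^sup>2 / ((q k)\<^sup>2 + 25)"
    using dp[of 2] dp[of 5] gm i25 by (simp_all add: mult.commute)
  have "3/2 \<le> depth (?p * g) (2 * \<i>)" "depth (?p * g) (2 * \<i>) \<le> 2" "3/2 \<le> depth (?p * g) (5 * \<i>)"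
    unfolding d2 using q100 by (simp_all add: le_divide_eq divide_le_eq add_pos_pos add_nonneg_pos)
  moreover have "0 \<le> Re (mobius (inverse (?p * g)) (2 * \<i>))" "Re (mobius (inverse (?p * g)) (2 * \<i>)) \<le> X.w"
    using j gm[OF i25(1)] by simp_all
  ultimately have "?p * g \<in> K" by (simp add: K_def R_def in_cbox_complex_iff)
  then show False using k gD move_tilingI by blast
qed

text \<open>
A tile not based at \<open>\<infinity>\<close> can be translated to have the base point \<open>0\<close>. Either the horoballs at \<open>0\<close> have
bounded diameters, and there is one that is maximal up to the factor \<open>2\<close>; or they exhaust the half-plane,
and then every other horoball meets one of them and is concentric with it.
\<close>

lemma degenerate_preimage:
  assumes D: "D \<in> X" "degenerate (\<alpha> D)" shows "degenerate D"
proof (rule ccontr)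
  assume "\<not> degenerate D"
  then obtain h0 where h0: "h0 \<in> D" "sq21 h0 \<noteq> 0" by (auto simp: degenerate_def)
  obtain a b c d where abcd: "a * d - b * c = 1" "h0 = psl2_of a b c d" by (metis psl2_cases)
  have c: "c \<noteq> 0" using h0 abcd by (simp add: sq_psl2_of)
  define u where "u = psl2_translation (- (a / c))"
  define D1 where "D1 = move_tiling u D"
  have D1: "D1 \<in> X" using X(3) D by (simp add: D1_def)
  have RD: "X.row_tiling D1" using row_X D1 by blast
  have deg: "degenerate (\<alpha> D1)"
  proof -
    have "\<alpha> D1 = move_tiling u (\<alpha> D)" using D by (simp add: D1_def equivariant)
    then show ?thesis using D(2)
      by (auto simp: degenerate_def move_tiling_def u_def sq_upper_mult sq_translation)
  qed
  have uh: "u * h0 = psl2_of 0 (b - a / c * d) c d"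
    using abcd c by (simp add: u_def psl2_translation_eq psl2_of_mult)
  have "0 * d - (b - a / c * d) * c = 1" using abcd c by (simp add: field_simps)
  then have "sq11 (u * h0) = 0" unfolding uh by (simp add: sq_psl2_of)
  moreover have "u * h0 \<in> D1" using h0 by (simp add: D1_def move_tilingI)
  ultimately obtain h1 where h1: "h1 \<in> D1" "sq11 h1 = 0" by blast
  show False
  proof (cases "\<exists>h\<in>D1. sq11 h = 0 \<and> (\<forall>g\<in>D1. sq11 g = 0 \<longrightarrow> sq21 h \<le> 2 * sq21 g)")
    case True
    then show False using no_base_zero_max[OF D1 deg] by blast
  next
    case False
    have small: "\<exists>g\<in>D1. sq11 g = 0 \<and> sq21 g * 2 ^ N \<le> sq21 h1" for N
    proof (induction N)
      case 0 then show ?case using h1 by auto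
    next
      case (Suc N)
      then obtain g where g: "g \<in> D1" "sq11 g = 0" "sq21 g * 2 ^ N \<le> sq21 h1" by blast
      then obtain g' where g': "g' \<in> D1" "sq11 g' = 0" "2 * sq21 g' < sq21 g" using False by (meson not_le)
      have "sq21 g' * 2 ^ Suc N = 2 * sq21 g' * 2 ^ N" by simp
      also have "\<dots> \<le> sq21 g * 2 ^ N" using g' by (intro mult_right_mono) auto
      finally have "sq21 g' * 2 ^ Suc N \<le> sq21 h1" using g(3) by linarith
      then show ?case using g' by blast
    qed
    show False
    proof (rule no_base_zero_all[OF D1 deg h1(1)])
      fix g assume g: "g \<in> D1"
      define z where "z = mobius g (2 * \<i>)"
      have "2 * \<i> \<in> uhp" by (simp add: uhp_iff)
      then have z: "z \<in> uhp" "depth g z > 1" by (simp_all add: z_def)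
      have zn: "Im z > 0" "(cmod z)\<^sup>2 > 0" using z(1) by (auto simp: uhp_iff)
      obtain N where N: "sq21 h1 * (cmod z)\<^sup>2 / Im z < 2 ^ N" using real_arch_pow[of 2] by auto
      obtain g0 where g0: "g0 \<in> D1" "sq11 g0 = 0" "sq21 g0 * 2 ^ N \<le> sq21 h1" using small by blast
      have s: "sq21 g0 > 0" using sq21_pos g0 by blast
      have "sq21 g0 * 2 ^ N * (cmod z)\<^sup>2 \<le> sq21 h1 * (cmod z)\<^sup>2" using g0 by (intro mult_right_mono) auto
      also have "\<dots> < 2 ^ N * Im z" using N zn by (simp add: field_simps)
      finally have "sq21 g0 * (cmod z)\<^sup>2 < Im z" by (simp add: algebra_simps)
      then have "depth g0 z > 1" using depth_base_zero[OF g0(2)] s zn by (simp add: less_divide_eq)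
      then have "sq21 (inverse g0 * g) = 0" using X.packing[OF RD g0(1) g z(1)] z(2) by blast
      then show "sq11 g = 0" using same_base_zero g0(2) by blast
    qed
  qed
qed

text \<open>
Let \<open>\<infinity>\<close> be a base point of \<open>\<alpha> S\<close>. The horoballs of \<open>\<alpha> S\<close> with other base points have bounded diameters,
so under \<open>z \<mapsto> r z\<close> with small \<open>r\<close> they disappear: the limits are degenerate, and so are their preimages
under \<open>\<alpha>\<close>. In a degenerate tiling some horoball contains \<open>\<i>\<close>, and this is an open condition.
\<close>

lemma cusp_ray:
  assumes S: "S \<in> X" and h0: "h0 \<in> \<alpha> S" "sq21 h0 = 0"
  obtains r0 where "r0 > 0" "\<And>r. 0 < r \<Longrightarrow> r < r0 \<Longrightarrow> \<exists>g\<in>S. depth (dilation r * g) \<i> > 1"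
proof (rule ccontr)
  assume not: "\<not> thesis"
  have i: "\<i> \<in> uhp" by (simp add: uhp_iff)
  have "\<exists>r. 0 < r \<and> r < 1 / (real k + 1) \<and> (\<forall>g\<in>S. \<not> depth (dilation r * g) \<i> > 1)" for k
    using not that[of "1 / (real k + 1)"] by fastforce
  then obtain r where r: "\<And>k. 0 < r k" "\<And>k. r k < 1 / (real k + 1)"
    "\<And>k g. g \<in> S \<Longrightarrow> \<not> depth (dilation (r k) * g) \<i> > 1" by metis
  define U where "U = {g. depth g \<i> > 1}"
  have "open U" unfolding U_def using continuous_mobius_inverse[OF i]
    by (intro open_Collect_less continuous_intros) auto
  define F where "F = {C \<in> X. C \<inter> U = {}}"
  have "closedin TY (\<alpha> ` F)"
    using homeomorphic_imp_closed_map[OF homeo] closedin_miss[OF \<open>open U\<close>] unfolding closed_map_def F_def by simp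
  have y: "\<alpha> (move_tiling (dilation (r k)) S) \<in> \<alpha> ` F" for k
    using r(3) X(3) S by (auto simp: F_def U_def move_tiling_def)
  obtain E where E: "E \<in> \<alpha> ` F"
    "\<And>W n. openin TY W \<Longrightarrow> E \<in> W \<Longrightarrow> \<exists>k\<ge>n. \<alpha> (move_tiling (dilation (r k)) S) \<in> W"
    by (rule compact_space_cluster_point[OF TY(3) \<open>closedin TY (\<alpha> ` F)\<close>, of "\<lambda>k. \<alpha> (move_tiling (dilation (r k)) S)"])
       (use y in blast)+
  have RS: "Y.row_tiling (\<alpha> S)" using row_Y alpha_Y S by blast
  have s: "sq11 h0 > 0" using h0 sq11_pos by blast
  note far = Y.horoball_gap[OF RS h0(1) _ h0(2)]
  have "degenerate E"
    unfolding degenerate_def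
  proof (intro ballI, rule ccontr)
    fix e assume e: "e \<in> E" "sq21 e \<noteq> 0"
    define P where "P = {g. 0 < sq21 g} \<inter> {g. sq21 g < sq21 e + 1}"
    have "open P" unfolding P_def
      using continuous_sq21 by (intro open_Int open_Collect_less continuous_intros)
    have "sq21 e \<ge> 0" by (cases e rule: psl2_cases) (simp add: sq_psl2_of)
    then have "e \<in> P" using e by (simp add: P_def)
    have "E \<in> Y" using E(1) alpha_Y by (auto simp: F_def)
    then have "closed E" using TY(2) unfolding TY(1) topspace_subtopology topspace_fell_topology by blast
    obtain N where N: "(sq21 e + 1) * sq11 h0 < real N" using reals_Archimedean2 by blast
    have "openin TY ({C. closed C \<and> C \<inter> P \<noteq> {}} \<inter> Y)"
      unfolding TY(1) using \<open>open P\<close> by (intro openin_subtopology_Int openin_fell_hit)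
    moreover have "E \<in> {C. closed C \<and> C \<inter> P \<noteq> {}} \<inter> Y" using \<open>E \<in> Y\<close> \<open>closed E\<close> e \<open>e \<in> P\<close> by blast
    ultimately obtain k where k: "k \<ge> N" "\<alpha> (move_tiling (dilation (r k)) S) \<inter> P \<noteq> {}"
      using E(2) by blast
    have "\<alpha> (move_tiling (dilation (r k)) S) = move_tiling (dilation (r k)) (\<alpha> S)"
      using S by (rule equivariant)
    then obtain g where g: "g \<in> \<alpha> S" "dilation (r k) * g \<in> P"
      using k(2) by (auto simp: move_tiling_def)
    have "sq21 (dilation (r k) * g) = sq21 g / r k"
      using r(1) by (simp add: sq_upper_mult sq_dilation)
    then have "0 < sq21 g / r k" "sq21 g / r k < sq21 e + 1" using g(2) by (auto simp: P_def)
    then have gg: "0 < sq21 g" "sq21 g < (sq21 e + 1) * r k"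
      using r(1)[of k] by (simp_all add: zero_less_divide_iff divide_less_eq)
    have "1 \<le> sq11 h0 * sq21 g" using far g(1) gg(1) by simp
    also have "\<dots> \<le> sq11 h0 * ((sq21 e + 1) * r k)" using gg s by (intro mult_left_mono) auto
    also have "\<dots> = ((sq21 e + 1) * sq11 h0) * r k" by simp
    also have "\<dots> \<le> real N * r k" using N r(1)[of k] by (intro mult_right_mono) auto
    also have "\<dots> \<le> (real k + 1) * r k" using k r(1)[of k] by (intro mult_right_mono) auto
    also have "\<dots> < 1" using r(2)[of k] by (simp add: field_simps)
    finally show False by simp
  qed
  obtain D where D: "D \<in> X" "D \<inter> U = {}" "E = \<alpha> D" using E(1) by (auto simp: F_def)
  then have "degenerate D" using degenerate_preimage \<open>degenerate E\<close> by blast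
  then obtain g where "g \<in> D" "depth g \<i> > 1" using X.degenerate_hits[OF row_X[OF D(1)] _ i] by metis
  then show False using D(2) by (auto simp: U_def)
qed

end

section \<open>The cusps of a nondegenerate tiling for n = 3\<close>

lemma hecke_width_3: "hecke_width 3 = 1"
  by (simp add: hecke_width_def cos_60)

lemma hecke_group_3_integral:
  assumes "g \<in> hecke_group 3"
  shows "\<exists>(a::int) (b::int) (c::int) (d::int). a * d - b * c = (1::int) \<and> g = psl2_of a b c d"
  using assms
proof induction
  case one
  show ?case by (rule exI[of _ 1], rule exI[of _ 0], rule exI[of _ 0], rule exI[of _ 1]) (simp add: psl2_one)
next
  case inversion
  show ?case by (rule exI[of _ 0], rule exI[of _ "- 1"], rule exI[of _ 1], rule exI[of _ 0]) (simp add: psl2_inversion_eq)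
next
  case translation
  show ?case by (rule exI[of _ 1], rule exI[of _ 1], rule exI[of _ 0], rule exI[of _ 1])
    (simp add: psl2_translation_eq hecke_width_3)
next
  case (mult g h)
  then obtain a b c d a' b' c' d' :: int where 1: "a * d - b * c = 1" "g = psl2_of a b c d"
    "a' * d' - b' * c' = 1" "h = psl2_of a' b' c' d'" by blast
  have r: "real_of_int a * real_of_int d - real_of_int b * real_of_int c = 1" "real_of_int a' * real_of_int d' - real_of_int b' * real_of_int c' = 1"
    using 1(1,3) by (metis of_int_1 of_int_diff of_int_mult)+
  have "(a * a' + b * c') * (c * b' + d * d') - (a * b' + b * d') * (c * a' + d * c') = (a * d - b * c) * (a' * d' - b' * c')"
    by (simp add: algebra_simps)
  then have "(a * a' + b * c') * (c * b' + d * d') - (a * b' + b * d') * (c * a' + d * c') = 1" using 1 by simp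
  moreover have "g * h = psl2_of (of_int (a * a' + b * c')) (of_int (a * b' + b * d')) (of_int (c * a' + d * c')) (of_int (c * b' + d * d'))"
    using 1 psl2_of_mult[OF r] by simp
  ultimately show ?case by blast
next
  case (inverse g)
  then obtain a b c d :: int where 1: "a * d - b * c = 1" "g = psl2_of a b c d" by blast
  have r: "real_of_int a * real_of_int d - real_of_int b * real_of_int c = 1" using 1(1) by (metis of_int_1 of_int_diff of_int_mult)
  show ?case using 1 psl2_of_inverse[OF r]
    by (intro exI[of _ d] exI[of _ "- b"] exI[of _ "- c"] exI[of _ a]) (simp add: algebra_simps)
qed

lemma hecke_group_3_depth:
  assumes "g \<in> hecke_group 3"
  obtains a c :: int where "(a, c) \<noteq> (0, 0)" "sq11 g = (of_int a)\<^sup>2" "sq21 g = (of_int c)\<^sup>2" "c = 0 \<longrightarrow> \<bar>a\<bar> = 1"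
    "\<forall>z. depth g z = Im z / ((of_int a - of_int c * Re z)\<^sup>2 + (of_int c * Im z)\<^sup>2)"
proof -
  obtain a b c d :: int where 1: "a * d - b * c = 1" "g = psl2_of a b c d"
    using hecke_group_3_integral[OF assms] by blast
  have r: "real_of_int a * real_of_int d - real_of_int b * real_of_int c = 1" using 1(1) by (metis of_int_1 of_int_diff of_int_mult)
  show thesis
  proof (rule that[of a c])
    show "(a, c) \<noteq> (0, 0)" using 1 by auto
    show "c = 0 \<longrightarrow> \<bar>a\<bar> = 1" using 1 zmult_eq_1_iff[of a d] by auto
  qed (use 1 r sq_psl2_of[OF r] depth_psl2_of[OF r] in auto)
qed

text \<open>
The horoballs of the packing for \<open>n = 3\<close> are equal or disjoint, because nonzero integers have absolute
value at least \<open>1\<close>.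
\<close>

lemma farey_packing:
  assumes "\<gamma> \<in> hecke_group 3" "\<gamma>' \<in> hecke_group 3" "z \<in> uhp" "depth (g * \<gamma>) z > 1" "depth (g * \<gamma>') z > 1" "y \<in> uhp"
  shows "depth (g * \<gamma>) y = depth (g * \<gamma>') y"
proof -
  have k: "inverse \<gamma> * \<gamma>' \<in> hecke_group 3" using assms by (intro hecke_group.mult hecke_group.inverse)
  have kk: "depth (g * \<gamma>') x = depth (inverse \<gamma> * \<gamma>') (mobius (inverse (g * \<gamma>)) x)" if "x \<in> uhp" for x
    using depth_mult[OF that, of "g * \<gamma>" "inverse \<gamma> * \<gamma>'"] by (simp add: mult.assoc)
  define z' where "z' = mobius (inverse (g * \<gamma>)) z"
  have z': "Im z' > 1" using assms by (simp add: z'_def)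
  obtain a c :: int where "(a, c) \<noteq> (0, 0)" and ac: "sq11 (inverse \<gamma> * \<gamma>') = (of_int a)\<^sup>2"
    "sq21 (inverse \<gamma> * \<gamma>') = (of_int c)\<^sup>2" "c = 0 \<longrightarrow> \<bar>a\<bar> = 1"
    "\<forall>z. depth (inverse \<gamma> * \<gamma>') z = Im z / ((of_int a - of_int c * Re z)\<^sup>2 + (of_int c * Im z)\<^sup>2)"
    by (rule hecke_group_3_depth[OF k])
  have "1 < depth (inverse \<gamma> * \<gamma>') z'" using assms kk by (simp add: z'_def)
  then have "(of_int a - of_int c * Re z')\<^sup>2 + (of_int c * Im z')\<^sup>2 < Im z'"
    unfolding ac(4)[rule_format] using z' by (auto simp: less_divide_eq split: if_splits)
  then have "(of_int c * Im z')\<^sup>2 < Im z'" by (smt (verit) zero_le_power2)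
  then have "(of_int c)\<^sup>2 * Im z' < 1" using z' by (simp add: power_mult_distrib power2_eq_square)
  moreover have "(real_of_int c)\<^sup>2 * 1 \<le> (of_int c)\<^sup>2 * Im z'" using z' by (intro mult_left_mono) auto
  ultimately have "(real_of_int c)\<^sup>2 < 1" by linarith
  then have "c = 0" by (simp add: abs_square_less_1)
  then have "sq21 (inverse \<gamma> * \<gamma>') = 0" "sq11 (inverse \<gamma> * \<gamma>') = 1" using ac(1,2,3) by (auto simp: abs_if split: if_splits)
  then show ?thesis using kk[OF assms(6)] depth_base_infinity by simp
qed

lemma open_depth: "open {z \<in> uhp. depth g z > r}"
proof -
  have "open {z \<in> uhp. mobius (inverse g) z \<in> {z. Im z > r}}"
    by (intro open_mobius_preimage open_halfspace_Im_gt)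
  then show ?thesis by simp
qed

lemma farey_connected:
  assumes C: "connected C" "C \<subseteq> uhp" "z0 \<in> C"
    and cover: "\<And>z. z \<in> C \<Longrightarrow> \<exists>\<gamma>\<in>hecke_group 3. depth (g * \<gamma>) z > 1"
  obtains \<gamma> where "\<gamma> \<in> hecke_group 3" "\<And>z. z \<in> C \<Longrightarrow> depth (g * \<gamma>) z > 1"
proof -
  obtain \<gamma> where \<gamma>: "\<gamma> \<in> hecke_group 3" "depth (g * \<gamma>) z0 > 1" using cover C by blast
  define U where "U = {z \<in> uhp. depth (g * \<gamma>) z > 1}"
  define \<Gamma> where "\<Gamma> = {\<gamma>' \<in> hecke_group 3. U \<inter> {z \<in> uhp. depth (g * \<gamma>') z > 1} = {}}"
  define V where "V = (\<Union>\<gamma>'\<in>\<Gamma>. {z \<in> uhp. depth (g * \<gamma>') z > 1})"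
  have "open U" "open V" unfolding U_def V_def by (intro open_depth open_UN ballI)+
  moreover have "C \<subseteq> U \<union> V"
  proof
    fix z assume z: "z \<in> C"
    then obtain \<gamma>' where g': "\<gamma>' \<in> hecke_group 3" "depth (g * \<gamma>') z > 1" using cover by blast
    have zu: "z \<in> uhp" using z C by blast
    show "z \<in> U \<union> V"
    proof (cases "\<gamma>' \<in> \<Gamma>")
      case True then show ?thesis using g' zu by (auto simp: V_def)
    next
      case False
      then obtain y where "y \<in> uhp" "depth (g * \<gamma>) y > 1" "depth (g * \<gamma>') y > 1"
        using g' by (auto simp: \<Gamma>_def U_def)
      then have "depth (g * \<gamma>) z = depth (g * \<gamma>') z" using farey_packing \<gamma> g' zu by metis
      then show ?thesis using g' zu by (simp add: U_def)
    qed
  qed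
  moreover have "U \<inter> V \<inter> C = {}" by (auto simp: V_def \<Gamma>_def)
  moreover have "U \<inter> C \<noteq> {}" using \<gamma> C by (auto simp: U_def)
  ultimately have "V \<inter> C = {}" using connectedD[OF C(1)] by metis
  then have "C \<subseteq> U" using \<open>C \<subseteq> U \<union> V\<close> by blast
  then show thesis using that \<gamma> by (auto simp: U_def)
qed

text \<open>
Closed horoballs of the packing do not cover a neighbourhood of a boundary point \<open>w\<close> of \<open>{Im z \<ge> 1}\<close>: next
to it, just below the line \<open>Im z = 1\<close> and off the integral vertical lines, no horoball of diameter \<open>1\<close> at
an integer is met, and the others have diameter at most \<open>1/4\<close>.
\<close>

lemma farey_gap:
  assumes w: "Im w = 1" and \<rho>: "\<rho> > 0"
  obtains w' where "w' \<in> ball w \<rho>" "w' \<in> uhp" "\<And>\<kappa>. \<kappa> \<in> hecke_group 3 \<Longrightarrow> depth \<kappa> w' < 1"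
proof -
  obtain x where x: "\<bar>x - Re w\<bar> < \<rho> / 2" "x \<notin> \<int>"
  proof (cases "Re w \<in> \<int>")
    case False then show thesis using that[of "Re w"] \<rho> by simp
  next
    case True
    define \<delta> where "\<delta> = min (\<rho> / 4) (1/2)"
    have d: "0 < \<delta>" "\<delta> < 1" "\<delta> < \<rho> / 2" using \<rho> by (auto simp: \<delta>_def min_def)
    have "Re w + \<delta> \<notin> \<int>"
    proof
      assume "Re w + \<delta> \<in> \<int>"
      then have "Re w + \<delta> - Re w \<in> \<int>" using True by (rule Ints_diff)
      then have "\<delta> \<in> \<int>" by simp
      then show False using d by (auto elim!: Ints_cases)
    qed
    then show thesis using d by (intro that[of "Re w + \<delta>"]) auto
  qed
  define \<eta> where "\<eta> = min (x - of_int \<lfloor>x\<rfloor>) (of_int \<lfloor>x\<rfloor> + 1 - x)"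
  have "x \<noteq> of_int \<lfloor>x\<rfloor>" using x(2) by (metis Ints_of_int)
  then have "of_int \<lfloor>x\<rfloor> < x" using of_int_floor_le[of x] by linarith
  then have \<eta>: "\<eta> > 0" unfolding \<eta>_def using real_of_int_floor_add_one_gt[of x] by simp
  have far: "\<eta> \<le> \<bar>of_int a - x\<bar>" for a :: int
  proof (cases "a \<le> \<lfloor>x\<rfloor>")
    case True
    then have "real_of_int a \<le> of_int \<lfloor>x\<rfloor>" by simp
    then show ?thesis unfolding \<eta>_def by linarith
  next
    case False
    then have "real_of_int (\<lfloor>x\<rfloor> + 1) \<le> of_int a" by (subst of_int_le_iff) simp
    then show ?thesis unfolding \<eta>_def by simp
  qed
  define q where "q = max (3/4) (max (1 - \<rho>/2) (1 - \<eta>\<^sup>2))"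
  have "q < 1" using \<rho> \<eta> by (simp add: q_def)
  then obtain y where "q < y" "y < 1" using dense by blast
  then have y: "3/4 < y" "1 - \<rho>/2 < y" "1 - \<eta>\<^sup>2 < y" "y < 1" by (auto simp: q_def)
  define w' where "w' = Complex x y"
  have "cmod (w - w') \<le> \<bar>Re (w - w')\<bar> + \<bar>Im (w - w')\<bar>" by (rule cmod_le)
  also have "\<dots> < \<rho>" using abs_minus_commute[of x "Re w"] x(1) y w by (simp add: w'_def)
  finally have "w' \<in> ball w \<rho>" by (simp add: dist_norm)
  moreover have "w' \<in> uhp" using y by (simp add: w'_def uhp_iff)
  moreover have "depth \<kappa> w' < 1" if \<kappa>: "\<kappa> \<in> hecke_group 3" for \<kappa>
  proof -
    obtain a c :: int where ac: "(a, c) \<noteq> (0, 0)" "sq11 \<kappa> = (of_int a)\<^sup>2" "sq21 \<kappa> = (of_int c)\<^sup>2" "c = 0 \<longrightarrow> \<bar>a\<bar> = 1"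
      "\<forall>z. depth \<kappa> z = Im z / ((of_int a - of_int c * Re z)\<^sup>2 + (of_int c * Im z)\<^sup>2)"
      by (rule hecke_group_3_depth[OF \<kappa>])
    have dk: "depth \<kappa> w' = y / ((of_int a - of_int c * x)\<^sup>2 + (of_int c * y)\<^sup>2)"
      using ac(5) by (simp add: w'_def)
    have "y < (of_int a - of_int c * x)\<^sup>2 + (of_int c * y)\<^sup>2"
    proof -
      consider "c = 0" | "\<bar>c\<bar> = 1" | "\<bar>c\<bar> \<ge> 2" by linarith
      then show ?thesis
      proof cases
        case 1
        then have "(real_of_int a)\<^sup>2 = 1" using ac(4) by (metis abs_1 of_int_1 of_int_abs power2_abs power_one)
        then show ?thesis using 1 y by simp
      next
        case 2
        then consider "c = 1" | "c = - 1" by linarith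
        then have "\<eta>\<^sup>2 \<le> (of_int a - of_int c * x)\<^sup>2"
        proof cases
          case 1
          have "\<eta>\<^sup>2 \<le> \<bar>of_int a - x\<bar>\<^sup>2" using far[of a] \<eta> by (intro power_mono) auto
          then show ?thesis using 1 by simp
        next
          case 2
          have "\<eta>\<^sup>2 \<le> \<bar>of_int (- a) - x\<bar>\<^sup>2" using far[of "- a"] \<eta> by (intro power_mono) auto
          then show ?thesis using 2 by (simp add: power2_eq_square algebra_simps)
        qed
        moreover have "(real_of_int c * y)\<^sup>2 = y\<^sup>2" using 2 by (auto simp: abs_if split: if_splits)
        moreover have "y * (1 - y) \<le> 1 * (1 - y)" using y by (intro mult_right_mono) auto
        ultimately show ?thesis using y by (simp add: power2_eq_square algebra_simps)
      next
        case 3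
        then have "real_of_int 2 \<le> \<bar>real_of_int c\<bar>" by (metis of_int_abs of_int_le_iff)
        then have "2\<^sup>2 \<le> \<bar>real_of_int c\<bar>\<^sup>2" by (intro power_mono) auto
        then have "4 * y\<^sup>2 \<le> (of_int c)\<^sup>2 * y\<^sup>2" by (intro mult_right_mono) auto
        moreover have "y * 1 < y * (4 * y)" using y by (intro mult_strict_left_mono) auto
        moreover have "y * (4 * y) = 4 * y\<^sup>2" by (simp add: power2_eq_square)
        ultimately have "y < (of_int c * y)\<^sup>2" unfolding power_mult_distrib by linarith
        then show ?thesis by (smt (verit) zero_le_power2)
      qed
    qed
    then show ?thesis unfolding dk using y by (subst divide_less_eq) auto
  qed
  ultimately show thesis by (rule that)
qed

context hecke_tile begin

text \<open>
The horocyclic strip formed by the cores of a row is an open connected part of the union of the closed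
horoballs of the packing. By the gaps just below their boundaries it lies in the union of the open
ones, hence in a single one. As the strip accumulates at its base point, it is concentric with that
horoball, and then the whole horoball of the tile is contained in it.
\<close>

lemma nondegenerate_horoballs:
  assumes n: "n = 3" and S: "row_tiling S" and nd: "nondegenerate n m S"
  obtains g where "\<And>h z. h \<in> S \<Longrightarrow> z \<in> uhp \<Longrightarrow> depth h z > 1 \<Longrightarrow> \<exists>\<gamma>\<in>hecke_group 3. depth (g * \<gamma>) z > 1"
proof -
  obtain g where g: "(\<Union>h\<in>S. mobius h ` core n m) = mobius g ` \<Union>(horoball_packing n)"
    using nd by (auto simp: nondegenerate_def)
  have "\<exists>\<gamma>\<in>hecke_group 3. depth (g * \<gamma>) z > 1" if h: "h \<in> S" and z: "z \<in> uhp" "depth h z > 1" for h z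
  proof -
    define C where "C = mobius h ` {u. 1 < Im u \<and> Im u < real m}"
    have strip: "{u. 1 < Im u \<and> Im u < real m} = {u. 1 < Im u} \<inter> {u. Im u < real m}" by auto
    have su: "{u. 1 < Im u \<and> Im u < real m} \<subseteq> uhp" by (auto simp: uhp_iff)
    have "connected {u. 1 < Im u \<and> Im u < real m}"
      unfolding strip by (intro convex_connected convex_Int convex_halfspace_Im_gt convex_halfspace_Im_lt)
    then have conn: "connected C" unfolding C_def
      using continuous_on_subset[OF continuous_on_mobius su] by (intro connected_continuous_image)
    have "open C" unfolding C_def
      using su by (intro open_mobius_image) (auto simp: strip intro!: open_Int open_halfspace_Im_gt open_halfspace_Im_lt)
    have Cu: "C \<subseteq> uhp" using su by (auto simp: C_def)
    have cov: "\<exists>\<gamma>\<in>hecke_group 3. depth (g * \<gamma>) y \<ge> 1" if y: "y \<in> C" for y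
    proof -
      obtain u where u: "1 < Im u" "Im u < real m" "y = mobius h u" using y by (auto simp: C_def)
      obtain k :: int where k: "0 \<le> Re u - of_int k * w" "Re u - of_int k * w < w"
        using floor_shift[of w "Re u"] period_bounds by auto
      have "u - of_real (of_int k * w) \<in> core n m" using u k by (auto simp: core_def)
      moreover have "y = mobius (h * \<tau> k) (u - of_real (of_int k * w))"
        using u by (subst mobius_mult) (auto simp: uhp_iff mobius_translation)
      ultimately have "y \<in> (\<Union>h\<in>S. mobius h ` core n m)" using row_tiling_shift[OF S h] by blast
      then obtain \<gamma> v where v: "\<gamma> \<in> hecke_group 3" "1 \<le> Im v" "y = mobius g (mobius \<gamma> v)"
        unfolding g by (auto simp: horoball_packing_def n)
      then have "v \<in> uhp" by (simp add: uhp_iff)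
      then have "mobius (inverse (g * \<gamma>)) y = v" using v by (simp add: psl2_inverse_mult mobius_mult)
      then have "depth (g * \<gamma>) y \<ge> 1" using v by simp
      then show ?thesis using v(1) by blast
    qed
    have "\<exists>\<gamma>\<in>hecke_group 3. depth (g * \<gamma>) y > 1" if y: "y \<in> C" for y
    proof (rule ccontr)
      assume no: "\<not> ?thesis"
      obtain \<gamma> where \<gamma>: "\<gamma> \<in> hecke_group 3" "depth (g * \<gamma>) y = 1" using cov[OF y] no by force
      have "open (mobius (inverse (g * \<gamma>)) ` C)" using \<open>open C\<close> Cu by (rule open_mobius_image)
      then obtain \<rho> where \<rho>: "\<rho> > 0" "ball (mobius (inverse (g * \<gamma>)) y) \<rho> \<subseteq> mobius (inverse (g * \<gamma>)) ` C"
        using y openE by blast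
      obtain w' where w': "w' \<in> ball (mobius (inverse (g * \<gamma>)) y) \<rho>" "w' \<in> uhp"
        "\<And>\<kappa>. \<kappa> \<in> hecke_group 3 \<Longrightarrow> depth \<kappa> w' < 1" using farey_gap[OF \<gamma>(2) \<rho>(1)] by metis
      then obtain y' where y': "y' \<in> C" "w' = mobius (inverse (g * \<gamma>)) y'" using \<rho> by blast
      obtain \<gamma>' where \<gamma>': "\<gamma>' \<in> hecke_group 3" "depth (g * \<gamma>') y' \<ge> 1" using cov[OF y'(1)] by blast
      have "g * \<gamma>' = g * \<gamma> * (inverse \<gamma> * \<gamma>')" by (simp add: mult.assoc)
      then have "depth (g * \<gamma>') y' = depth (inverse \<gamma> * \<gamma>') w'"
        using y' Cu by (metis depth_mult subsetD)
      moreover have "inverse \<gamma> * \<gamma>' \<in> hecke_group 3" using \<gamma> \<gamma>' by (intro hecke_group.mult hecke_group.inverse)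
      ultimately show False using w'(3) \<gamma>'(2) by fastforce
    qed
    moreover have "mobius h (\<i> * of_real ((1 + real m) / 2)) \<in> C" using m_bounds by (auto simp: C_def field_simps)
    ultimately obtain \<gamma> where \<gamma>: "\<gamma> \<in> hecke_group 3" "\<And>y. y \<in> C \<Longrightarrow> depth (g * \<gamma>) y > 1"
      using farey_connected[OF conn Cu] by metis
    obtain a b c d where k: "a * d - b * c = 1" "inverse (g * \<gamma>) * h = psl2_of a b c d" by (metis psl2_cases)
    have eq: "depth (g * \<gamma>) (mobius h u) = Im u / (cmod (of_real c * u + of_real d))\<^sup>2" if "u \<in> uhp" for u
    proof -
      have "mobius (inverse (g * \<gamma>)) (mobius h u) = mobius (inverse (g * \<gamma>) * h) u" using that by (simp add: mobius_mult)
      then show ?thesis by (simp add: k Im_mobius)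
    qed
    have big: "(cmod (of_real c * u + of_real d))\<^sup>2 < Im u" if u: "1 < Im u" "Im u < real m" for u
    proof -
      have "mobius h u \<in> C" using u by (auto simp: C_def)
      then have "1 < depth (g * \<gamma>) (mobius h u)" by (rule \<gamma>(2))
      moreover have "u \<in> uhp" using u by (simp add: uhp_iff)
      ultimately have "1 < Im u / (cmod (of_real c * u + of_real d))\<^sup>2" using eq[of u] by simp
      then show ?thesis using u by (auto simp: less_divide_eq split: if_splits)
    qed
    have "1 < real m" using m_bounds by linarith
    have "c = 0"
    proof (rule ccontr)
      assume c: "c \<noteq> 0"
      obtain v where v: "1 < v" "v < real m" using dense[OF \<open>1 < real m\<close>] by blast
      define u where "u = Complex ((real m - d) / c) v"
      have "(cmod (of_real c * u + of_real d))\<^sup>2 = (real m)\<^sup>2 + (c * v)\<^sup>2" using c by (simp add: u_def cmod_power2)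
      moreover have "(cmod (of_real c * u + of_real d))\<^sup>2 < v" using big[of u] v by (simp add: u_def)
      moreover have "real m * 1 \<le> (real m)\<^sup>2" unfolding power2_eq_square using m_bounds by (intro mult_left_mono) auto
      ultimately show False using v zero_le_power2[of "c * v"] by linarith
    qed
    have "d\<^sup>2 \<le> 1"
    proof (rule ccontr)
      assume "\<not> d\<^sup>2 \<le> 1"
      then obtain v where "1 < v" "v < real m" "v < d\<^sup>2" using between[of 1 "real m" "d\<^sup>2"] \<open>1 < real m\<close> by auto
      then show False using big[of "\<i> * of_real v"] \<open>c = 0\<close> by simp
    qed
    moreover have "d \<noteq> 0" using k \<open>c = 0\<close> by auto
    ultimately have "depth h z / d\<^sup>2 \<ge> depth h z" using z by (simp add: field_simps mult_left_le)
    moreover have "depth (g * \<gamma>) z = depth h z / d\<^sup>2"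
      using eq[of "mobius (inverse h) z"] z \<open>c = 0\<close> by simp
    ultimately show ?thesis using \<gamma>(1) z(2) by force
  qed
  then show thesis using that by blast
qed

end

text \<open>
The vertical ray found in \<open>cusp_ray\<close> lies in the union of the disjoint open horoballs of the packing,
hence in one of them; only a horoball based at \<open>\<infinity>\<close> contains a vertical ray.
\<close>

lemma (in conjugacy) image_cusps:
  assumes n: "n = 3" and S: "S \<in> X" "nondegenerate n m S"
  obtains g where "\<And>h. h \<in> \<alpha> S \<Longrightarrow> \<exists>\<gamma>\<in>hecke_group 3. sq21 (inverse h * (g * \<gamma>)) = 0"
    "\<not> degenerate (\<alpha> S)"
proof -
  have RS: "X.row_tiling S" using row_X S by blast
  obtain g where g: "\<And>h z. h \<in> S \<Longrightarrow> z \<in> uhp \<Longrightarrow> depth h z > 1 \<Longrightarrow> \<exists>\<gamma>\<in>hecke_group 3. depth (g * \<gamma>) z > 1"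
    using X.nondegenerate_horoballs[OF n RS S(2)] by metis
  have i: "\<i> \<in> uhp" by (simp add: uhp_iff)
  have "\<not> degenerate (\<alpha> S)"
  proof
    assume "degenerate (\<alpha> S)"
    then have "degenerate S" by (rule degenerate_preimage[OF S(1)])
    then obtain h where h: "h \<in> S" "depth h (mobius g \<i>) > 1"
      using X.degenerate_hits[OF RS _ mobius_uhp[OF i]] by metis
    then obtain \<gamma> where \<gamma>: "\<gamma> \<in> hecke_group 3" "depth (g * \<gamma>) (mobius g \<i>) > 1"
      using g i by (meson mobius_uhp)
    then have "depth \<gamma> \<i> > 1" using i by (simp add: depth_mult)
    moreover obtain a c :: int where ac: "(a, c) \<noteq> (0, 0)" "sq11 \<gamma> = (of_int a)\<^sup>2" "sq21 \<gamma> = (of_int c)\<^sup>2" "c = 0 \<longrightarrow> \<bar>a\<bar> = 1"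
      "\<forall>z. depth \<gamma> z = Im z / ((of_int a - of_int c * Re z)\<^sup>2 + (of_int c * Im z)\<^sup>2)"
      by (rule hecke_group_3_depth[OF \<gamma>(1)])
    ultimately have "1 / ((of_int a)\<^sup>2 + (of_int c)\<^sup>2) > (1::real)" by (simp only: ac(5)) simp
    then have "(real_of_int a)\<^sup>2 + (of_int c)\<^sup>2 < 1" by (auto simp: less_divide_eq split: if_splits)
    then have "of_int (a\<^sup>2 + c\<^sup>2) < (1::real)" by simp
    then have "a\<^sup>2 + c\<^sup>2 < 1" by linarith
    then have "a\<^sup>2 = 0" "c\<^sup>2 = 0" using zero_le_power2[of a] zero_le_power2[of c] by linarith+
    then show False using ac by simp
  qed
  moreover have "\<exists>\<gamma>\<in>hecke_group 3. sq21 (inverse h * (g * \<gamma>)) = 0" if h: "h \<in> \<alpha> S" for h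
  proof -
    define S' where "S' = move_tiling (inverse h) S"
    have "1 \<in> \<alpha> S'" using move_tilingI[OF h, of "inverse h"] S by (simp add: S'_def equivariant)
    moreover have "sq21 1 = 0" using sq_translation(2)[of 0] by (simp add: translation_0)
    ultimately obtain r0 where r0: "r0 > 0" "\<And>r. 0 < r \<Longrightarrow> r < r0 \<Longrightarrow> \<exists>s\<in>S'. depth (dilation r * s) \<i> > 1"
      using cusp_ray[of S' 1] X(3)[OF S(1)] S'_def by metis
    define C where "C = mobius h ` {z. Re z = 0 \<and> 1 / r0 < Im z}"
    have pos: "y \<in> uhp" if "1 / r0 < Im y" for y
      using that r0(1) by (simp add: uhp_iff) (meson divide_pos_pos less_trans zero_less_one)
    have sub: "{z. Re z = 0 \<and> 1 / r0 < Im z} \<subseteq> uhp" using pos by auto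
    have "{z. Re z = 0 \<and> 1 / r0 < Im z} = {z. Re z \<le> 0} \<inter> {z. Re z \<ge> 0} \<inter> {z. 1 / r0 < Im z}" by auto
    moreover have "convex ({z. Re z \<le> 0} \<inter> {z. Re z \<ge> 0} \<inter> {z. 1 / r0 < Im z})"
      by (intro convex_Int convex_halfspace_Im_gt convex_halfspace_Re_le convex_halfspace_Re_ge)
    ultimately have "connected {z. Re z = 0 \<and> 1 / r0 < Im z}" by (metis convex_connected)
    then have conn: "connected C" unfolding C_def
      using continuous_on_subset[OF continuous_on_mobius sub] by (intro connected_continuous_image)
    have Cu: "C \<subseteq> uhp" using sub by (auto simp: C_def)
    have cov: "\<exists>\<gamma>\<in>hecke_group 3. depth (g * \<gamma>) z > 1" if z: "z \<in> C" for z
    proof -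
      obtain u where u: "Re u = 0" "1 / r0 < Im u" "z = mobius h u" using z by (auto simp: C_def)
      have up: "Im u > 0" using pos[OF u(2)] by (simp add: uhp_iff)
      have "1 / Im u < r0" using u r0(1) up by (simp add: field_simps)
      then obtain s where s: "s \<in> S" "depth (dilation (1 / Im u) * (inverse h * s)) \<i> > 1"
        using r0(2)[of "1 / Im u"] up by (auto simp: S'_def move_tiling_def)
      have "u = \<i> / of_real (1 / Im u)" using u up by (simp add: complex_eq_iff)
      then have "mobius (inverse (dilation (1 / Im u))) \<i> = u" using up by (simp add: mobius_inverse_dilation)
      then have "depth s z > 1" using s(2) i pos[OF u(2)] u(3) by (simp add: depth_mult)
      then show ?thesis using g s(1) z Cu by blast
    qed
    have "mobius h (\<i> * of_real (1 / r0 + 1)) \<in> C" by (auto simp: C_def)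
    then obtain \<gamma> where \<gamma>: "\<gamma> \<in> hecke_group 3" "\<And>z. z \<in> C \<Longrightarrow> depth (g * \<gamma>) z > 1"
      using farey_connected[OF conn Cu] cov by metis
    obtain a b c d where k: "a * d - b * c = 1" "inverse h * (g * \<gamma>) = psl2_of a b c d" by (metis psl2_cases)
    have "c = 0"
    proof (rule ccontr)
      assume c: "c \<noteq> 0"
      define y where "y = 1 / r0 + 1 / c\<^sup>2"
      have y: "1 / r0 < y" "1 / c\<^sup>2 < y" "y > 0" using r0(1) c by (auto simp: y_def add_pos_pos)
      have iy: "\<i> * of_real y \<in> uhp" using y by (simp add: uhp_iff)
      have "mobius h (\<i> * of_real y) \<in> C" using y by (auto simp: C_def)
      then have "depth (g * \<gamma>) (mobius h (\<i> * of_real y)) > 1" using \<gamma>(2) by blast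
      moreover have "g * \<gamma> = h * psl2_of a b c d" using k(2) by (metis psl2_cancel(2))
      ultimately have "depth (psl2_of a b c d) (\<i> * of_real y) > 1" using iy by (simp add: depth_mult)
      then have "1 < y / (a\<^sup>2 + (c * y)\<^sup>2)" by (simp add: depth_psl2_of[OF k(1)])
      moreover have "a\<^sup>2 + (c * y)\<^sup>2 > 0" using c y by (intro add_nonneg_pos) auto
      ultimately have "a\<^sup>2 + (c * y)\<^sup>2 < y" by (simp add: less_divide_eq)
      then have "(c * y)\<^sup>2 < y" by (smt (verit) zero_le_power2)
      then have "c\<^sup>2 * y < 1" using y by (simp add: power_mult_distrib power2_eq_square)
      then show False using y(2) c by (simp add: field_simps)
    qed
    then have "sq21 (inverse h * (g * \<gamma>)) = 0" unfolding k(2) sq_psl2_of[OF k(1)] by simp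
    then show ?thesis using \<gamma>(1) by blast
  qed
  ultimately show thesis using that by blast
qed

section \<open>Directions at a point of the upper half-plane\<close>

text \<open>
The inverse of the Cayley map \<open>z \<mapsto> (z - u) / (z - cnj u)\<close> to the unit disk. It takes \<open>0\<close> to \<open>u\<close> and
straight lines through \<open>0\<close> to geodesics through \<open>u\<close>, so that near \<open>u\<close> regions with geodesic sides become
sectors.
\<close>

definition disk_chart :: "complex \<Rightarrow> complex \<Rightarrow> complex" where
  "disk_chart u \<zeta> = (u - cnj u * \<zeta>) / (1 - \<zeta>)"

lemma disk_denom: "cmod \<zeta> < 1 \<Longrightarrow> 1 - \<zeta> \<noteq> 0"
  by auto

lemma disk_chart_add: "cmod \<zeta> < 1 \<Longrightarrow> disk_chart (u + of_real r) \<zeta> = disk_chart u \<zeta> + of_real r"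
  using disk_denom[of \<zeta>] by (simp add: disk_chart_def field_simps)

lemma disk_chart_div: "disk_chart u \<zeta> / of_nat m = disk_chart (u / of_nat m) \<zeta>"
  by (simp add: disk_chart_def diff_divide_distrib[symmetric] field_simps)

lemma Im_disk_chart:
  assumes "cmod \<zeta> < 1"
  shows "Im (disk_chart u \<zeta>) = Im u * (1 - (cmod \<zeta>)\<^sup>2) / (cmod (1 - \<zeta>))\<^sup>2"
  unfolding disk_chart_def Im_divide cmod_power2
  by (simp add: algebra_simps power2_eq_square)

lemma disk_chart_uhp: "cmod \<zeta> < 1 \<Longrightarrow> u \<in> uhp \<Longrightarrow> disk_chart u \<zeta> \<in> uhp"
  using disk_denom[of \<zeta>] by (simp add: uhp_iff Im_disk_chart abs_square_less_1)

text \<open>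
In these charts an isometry that maps one centre to the other is a rotation. With \<open>e = a - c u\<close> the angle
of rotation is the argument of \<open>cnj e / e\<close>.
\<close>

lemma mobius_disk_chart:
  assumes "a * d - b * c = 1" "u \<in> uhp" "cmod \<zeta> < 1"
  shows "mobius (inverse (psl2_of a b c d)) (disk_chart u \<zeta>) =
    disk_chart (mobius (inverse (psl2_of a b c d)) u)
      (\<zeta> * (cnj (of_real a - of_real c * u) / (of_real a - of_real c * u)))"
proof -
  define e where "e = of_real a - of_real c * u"
  have "d * a - (- b) * (- c) = 1" using assms(1) by (simp add: algebra_simps)
  then have "e \<noteq> 0" using denom_nonzero[of d a "- b" "- c" u] assms(2) by (simp add: e_def uhp_iff)
  then have ne: "e \<noteq> 0" "cnj e \<noteq> 0" by simp_all
  have z1: "1 - \<zeta> \<noteq> 0" using assms(3) by (rule disk_denom)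
  have inv: "mobius (inverse (psl2_of a b c d)) z = (of_real d * z - of_real b) / (of_real a - of_real c * z)" for z
    using assms(1) by (subst psl2_of_inverse, simp, subst mobius_psl2_of) (auto simp: algebra_simps)
  define x where "x = mobius (inverse (psl2_of a b c d)) u"
  have x: "of_real d * u - of_real b = x * e" using ne by (simp add: x_def inv e_def)
  then have x': "of_real d * cnj u - of_real b = cnj x * cnj e"
    by (metis complex_cnj_complex_of_real complex_cnj_diff complex_cnj_mult)
  have e': "of_real a - of_real c * cnj u = cnj e" by (simp add: e_def)
  have num: "of_real d * disk_chart u \<zeta> - of_real b = (x * e - cnj x * cnj e * \<zeta>) / (1 - \<zeta>)"
    using z1 unfolding x[symmetric] x'[symmetric] by (simp add: disk_chart_def field_simps)
  have den: "of_real a - of_real c * disk_chart u \<zeta> = (e - cnj e * \<zeta>) / (1 - \<zeta>)"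
    using z1 unfolding e'[symmetric] unfolding e_def by (simp add: disk_chart_def field_simps)
  have "mobius (inverse (psl2_of a b c d)) (disk_chart u \<zeta>) = (x * e - cnj x * cnj e * \<zeta>) / (e - cnj e * \<zeta>)"
    unfolding inv num den using z1 by simp
  also have "\<dots> = (e * (x - cnj x * (\<zeta> * (cnj e / e)))) / (e * (1 - \<zeta> * (cnj e / e)))"
    using ne by (simp add: algebra_simps)
  also have "\<dots> = disk_chart x (\<zeta> * (cnj e / e))" using ne by (simp add: disk_chart_def)
  finally show ?thesis by (simp add: x_def e_def)
qed

definition ray :: "complex \<Rightarrow> real \<Rightarrow> real \<Rightarrow> complex" where
  "ray u t \<epsilon> = disk_chart u (of_real \<epsilon> * cis t)"

lemma ray_tendsto: "(ray u t \<longlongrightarrow> u) (at_right 0)"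
proof -
  have "((\<lambda>\<epsilon>. (u - cnj u * (of_real \<epsilon> * cis t)) / (1 - of_real \<epsilon> * cis t)) \<longlongrightarrow>
     (u - cnj u * (of_real 0 * cis t)) / (1 - of_real 0 * cis t)) (at_right 0)"
    by (intro tendsto_intros) auto
  then show ?thesis by (simp add: ray_def[abs_def] disk_chart_def)
qed

lemma ray_in_open: "open A \<Longrightarrow> u \<in> A \<Longrightarrow> \<forall>\<^sub>F \<epsilon> in at_right 0. ray u t \<epsilon> \<in> A"
  using ray_tendsto topological_tendstoD by blast

lemma eventually_small: "\<forall>\<^sub>F \<epsilon>::real in at_right 0. 0 < \<epsilon> \<and> \<epsilon> < 1/2"
  unfolding eventually_at_right_field by (intro exI[of _ "1/2"]) auto

lemma ray_period: "ray u (t + 2 * pi * of_int k) = ray u t"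
proof -
  have "cis (t + 2 * pi * of_int k) = cis t"
    using cis_multiple_2pi[of "of_int k"] cis_mult[of t "2 * pi * of_int k"] by simp
  then show ?thesis by (simp add: ray_def[abs_def])
qed

text \<open>
A ray leaves the centre \<open>u\<close>, which lies on the geodesic \<open>\<bar>z - r\<bar> = 1\<close>, to the side given by the sign of
\<open>sin (\<psi> - t)\<close>, and stays on that side.
\<close>

lemma ray_side:
  fixes \<psi> t \<epsilon> r :: real
  assumes e: "0 < \<epsilon>" "\<epsilon> < 1" and \<psi>: "0 < \<psi>" "\<psi> < pi" and u: "u = of_real r + cis \<psi>"
  shows "sin (\<psi> - t) > 0 \<Longrightarrow> 1 < cmod (ray u t \<epsilon> - of_real r)"
    "sin (\<psi> - t) < 0 \<Longrightarrow> cmod (ray u t \<epsilon> - of_real r) < 1"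
proof -
  define \<zeta> where "\<zeta> = of_real \<epsilon> * cis t"
  have z: "cmod \<zeta> < 1" using e by (simp add: \<zeta>_def norm_mult)
  then have z1: "1 - \<zeta> \<noteq> 0" by (rule disk_denom)
  have "ray u t \<epsilon> - of_real r = disk_chart (cis \<psi>) \<zeta>"
    using disk_chart_add[OF z, of "cis \<psi>" r] by (simp add: ray_def u \<zeta>_def add.commute)
  then have eq: "cmod (ray u t \<epsilon> - of_real r) = cmod (cis \<psi> - cnj (cis \<psi>) * \<zeta>) / cmod (1 - \<zeta>)"
    by (simp add: disk_chart_def norm_divide)
  have "(cmod (cis \<psi> - cnj (cis \<psi>) * \<zeta>))\<^sup>2 = (cmod (1 - \<zeta>))\<^sup>2 + 4 * \<epsilon> * sin \<psi> * sin (\<psi> - t)"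
  proof -
    have "(cos \<psi>)\<^sup>2 = 1 - (sin \<psi>)\<^sup>2" by (simp add: cos_squared_eq)
    then show ?thesis
      unfolding cmod_power2 \<zeta>_def sin_diff by (simp, algebra)
  qed
  moreover have "sin \<psi> > 0" using \<psi> by (rule sin_gt_zero)
  ultimately have
    "sin (\<psi> - t) > 0 \<Longrightarrow> (cmod (1 - \<zeta>))\<^sup>2 < (cmod (cis \<psi> - cnj (cis \<psi>) * \<zeta>))\<^sup>2"
    "sin (\<psi> - t) < 0 \<Longrightarrow> (cmod (cis \<psi> - cnj (cis \<psi>) * \<zeta>))\<^sup>2 < (cmod (1 - \<zeta>))\<^sup>2"
    using e by (simp_all add: mult_pos_neg)
  then have
    "sin (\<psi> - t) > 0 \<Longrightarrow> cmod (1 - \<zeta>) < cmod (cis \<psi> - cnj (cis \<psi>) * \<zeta>)"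
    "sin (\<psi> - t) < 0 \<Longrightarrow> cmod (cis \<psi> - cnj (cis \<psi>) * \<zeta>) < cmod (1 - \<zeta>)"
    by (auto intro: power2_less_imp_less)
  then show "sin (\<psi> - t) > 0 \<Longrightarrow> 1 < cmod (ray u t \<epsilon> - of_real r)"
    "sin (\<psi> - t) < 0 \<Longrightarrow> cmod (ray u t \<epsilon> - of_real r) < 1"
    unfolding eq using z1 by simp_all
qed

section \<open>Corners and edges of rows\<close>

text \<open>
Seen from \<open>u\<close>, the set \<open>A\<close> with interior \<open>O'\<close> is the sector of the directions from \<open>a\<close> to \<open>a + l\<close>. Nothing is
said about the two boundary directions.
\<close>

definition sector :: "complex set \<Rightarrow> complex set \<Rightarrow> complex \<Rightarrow> real \<Rightarrow> real \<Rightarrow> bool" where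
  "sector A O' u a l \<longleftrightarrow>
     (\<forall>t. a < t \<and> t < a + l \<longrightarrow> (\<forall>\<^sub>F \<epsilon> in at_right 0. ray u t \<epsilon> \<in> O')) \<and>
     (\<forall>t. a + l < t \<and> t < a + 2 * pi \<longrightarrow> (\<forall>\<^sub>F \<epsilon> in at_right 0. ray u t \<epsilon> \<notin> A))"

context hecke_tile begin

lemma sector_shift:
  assumes "sector (apeirogon n) (open_apeirogon n) u a l"
  shows "sector (apeirogon n) (open_apeirogon n) (u + of_real (of_int k * \<Lambda>)) a l"
proof -
  have "ray (u + of_real (of_int k * \<Lambda>)) t \<epsilon> = ray u t \<epsilon> + of_real (of_int k * \<Lambda>)" if "0 < \<epsilon> \<and> \<epsilon> < 1/2" for t \<epsilon>
    unfolding ray_def using that by (intro disk_chart_add) (simp add: norm_mult)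
  then have ev: "\<forall>\<^sub>F \<epsilon> in at_right 0. ray (u + of_real (of_int k * \<Lambda>)) t \<epsilon> = ray u t \<epsilon> + of_real (of_int k * \<Lambda>)" for t
    using eventually_small by (auto elim: eventually_mono)
  show ?thesis
    unfolding sector_def
  proof (intro conjI allI impI)
    fix t assume "a < t \<and> t < a + l"
    then have "\<forall>\<^sub>F \<epsilon> in at_right 0. ray u t \<epsilon> \<in> open_apeirogon n" using assms by (simp add: sector_def)
    with ev[of t] show "\<forall>\<^sub>F \<epsilon> in at_right 0. ray (u + of_real (of_int k * \<Lambda>)) t \<epsilon> \<in> open_apeirogon n"
      by eventually_elim (auto simp only: apeirogon_shift)
  next
    fix t assume "a + l < t \<and> t < a + 2 * pi"
    then have "\<forall>\<^sub>F \<epsilon> in at_right 0. ray u t \<epsilon> \<notin> apeirogon n" using assms by (simp add: sector_def)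
    with ev[of t] show "\<forall>\<^sub>F \<epsilon> in at_right 0. ray (u + of_real (of_int k * \<Lambda>)) t \<epsilon> \<notin> apeirogon n"
      by eventually_elim (auto simp only: apeirogon_shift)
  qed
qed

lemma width_cos: "\<Lambda> = 2 * cos \<phi>" by (simp add: hecke_width_def)

lemma apeirogon_dist: "z \<in> apeirogon n \<Longrightarrow> 1 \<le> cmod (z - of_real (of_int k * \<Lambda>))"
  unfolding apeirogon_def by blast

text \<open>
The point \<open>cis \<psi>\<close> on the side of the polygon that belongs to the circle around \<open>0\<close> is strictly outside
all other circles, apart from the neighbouring circle when it is a vertex.
\<close>

lemma other_strict:
  assumes "0 < \<psi>" "\<psi> < pi" "\<bar>cos \<psi>\<bar> \<le> cos \<phi>" "k \<noteq> 0" "\<bar>k\<bar> = 1 \<Longrightarrow> \<bar>cos \<psi>\<bar> < cos \<phi> \<or> of_int k * cos \<psi> < 0"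
  shows "1 < cmod (cis \<psi> - of_real (of_int k * \<Lambda>))"
proof -
  have c: "cos \<phi> > 0" using width_bounds width_cos by simp
  have "0 < of_int k * of_int k * cos \<phi> - of_int k * cos \<psi>"
  proof (cases "\<bar>k\<bar> = 1")
    case True
    then have kk: "of_int k * of_int k = (1::real)" by (auto simp: abs_if split: if_splits)
    show ?thesis
    proof (cases "of_int k * cos \<psi> < 0")
      case True then show ?thesis using c kk by simp
    next
      case False
      then have "\<bar>cos \<psi>\<bar> < cos \<phi>" using assms(5) True by blast
      moreover have "\<bar>of_int k * cos \<psi>\<bar> = \<bar>cos \<psi>\<bar>" using True by (simp add: abs_mult flip: of_int_abs)
      ultimately show ?thesis using kk by simp
    qed
  next
    case False
    then have k2: "\<bar>k\<bar> \<ge> 2" using assms(4) by linarith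
    then have kr: "\<bar>real_of_int k\<bar> > 1" by linarith
    have "\<bar>of_int k * cos \<psi>\<bar> \<le> \<bar>real_of_int k\<bar> * cos \<phi>"
      unfolding abs_mult using assms(3) by (intro mult_left_mono) auto
    also have "\<dots> < \<bar>real_of_int k\<bar> * (\<bar>real_of_int k\<bar> * cos \<phi>)"
      using kr c by (intro mult_strict_left_mono) auto
    finally show ?thesis by (simp add: mult.assoc[symmetric] abs_mult_self_eq)
  qed
  then have "0 < 4 * cos \<phi> * (of_int k * of_int k * cos \<phi> - of_int k * cos \<psi>)" using c by simp
  moreover have "(cos \<psi> - of_int k * \<Lambda>)\<^sup>2 + (sin \<psi>)\<^sup>2 = 1 + 4 * cos \<phi> * (of_int k * of_int k * cos \<phi> - of_int k * cos \<psi>)"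
    using sin_cos_squared_add[of \<psi>] unfolding width_cos by algebra
  ultimately show ?thesis using cmod_gt_iff[of 1 "cis \<psi>" "of_int k * \<Lambda>"] by simp
qed

lemma sector_vertex: "sector (apeirogon n) (open_apeirogon n) (cis \<phi>) (- \<phi>) (2 * \<phi>)"
proof -
  have p: "0 < \<phi>" "\<phi> < pi" "\<phi> \<le> pi / 3" "0 < pi - \<phi>" "pi - \<phi> < pi"
    using angle_bounds pi_gt_zero by linarith+
  have c: "cos \<phi> > 0" using width_bounds width_cos by simp
  have s: "sin \<phi> > 0" by (rule width_bounds)
  have u0: "cis \<phi> = of_real 0 + cis \<phi>" by simp
  have u1: "cis \<phi> = of_real \<Lambda> + cis (pi - \<phi>)" by (simp add: complex_eq_iff width_cos)
  define I where "I = UNIV - {0, 1::int}"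
  have "cis \<phi> \<in> {z. Im z > 0 \<and> (\<forall>k\<in>I. 1 < cmod (z - of_real (of_int k * \<Lambda>)))}"
  proof -
    have "1 < cmod (cis \<phi> - of_real (of_int k * \<Lambda>))" if "k \<in> I" for k
      using that c by (intro other_strict p(1) p(2)) (auto simp: I_def abs_if split: if_splits)
    then show ?thesis using s by simp
  qed
  then have near: "\<forall>\<^sub>F \<epsilon> in at_right 0. Im (ray (cis \<phi>) t \<epsilon>) > 0 \<and> (\<forall>k\<in>I. 1 < cmod (ray (cis \<phi>) t \<epsilon> - of_real (of_int k * \<Lambda>)))" for t
    using ray_in_open[OF open_outside] by auto
  show ?thesis
    unfolding sector_def
  proof (intro conjI allI impI)
    fix t assume t: "- \<phi> < t \<and> t < - \<phi> + 2 * \<phi>"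
    have s0: "sin (\<phi> - t) > 0" using t p by (intro sin_gt_zero) linarith+
    have "sin (\<phi> + t) > 0" using t p by (intro sin_gt_zero) linarith+
    moreover have "sin (pi - \<phi> - t) = sin (\<phi> + t)" using sin_pi_minus[of "\<phi> + t"] by (simp add: algebra_simps)
    ultimately have s1: "sin (pi - \<phi> - t) > 0" by simp
    show "\<forall>\<^sub>F \<epsilon> in at_right 0. ray (cis \<phi>) t \<epsilon> \<in> open_apeirogon n"
      using near[of t] eventually_small
    proof eventually_elim
      case (elim \<epsilon>)
      have "1 < cmod (ray (cis \<phi>) t \<epsilon> - of_real 0)" using elim by (intro ray_side(1)[OF _ _ p(1,2) u0 s0]) auto
      moreover have "1 < cmod (ray (cis \<phi>) t \<epsilon> - of_real \<Lambda>)" using elim by (intro ray_side(1)[OF _ _ p(4,5) u1 s1]) auto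
      ultimately have "1 < cmod (ray (cis \<phi>) t \<epsilon> - of_real (of_int k * \<Lambda>))" for k :: int
        using elim by (cases "k \<in> I") (auto simp: I_def)
      then show ?case using elim by (auto simp: open_apeirogon_def)
    qed
  next
    fix t assume t: "- \<phi> + 2 * \<phi> < t \<and> t < - \<phi> + 2 * pi"
    show "\<forall>\<^sub>F \<epsilon> in at_right 0. ray (cis \<phi>) t \<epsilon> \<notin> apeirogon n"
      using eventually_small
    proof eventually_elim
      case (elim \<epsilon>)
      show ?case
      proof (cases "t < pi + \<phi>")
        case True
        then have "sin (t - \<phi>) > 0" using t by (intro sin_gt_zero) linarith+
        then have s: "sin (\<phi> - t) < 0" using sin_minus[of "t - \<phi>"] by simp
        have "cmod (ray (cis \<phi>) t \<epsilon> - of_real 0) < 1" using elim by (intro ray_side(2)[OF _ _ p(1,2) u0 s]) auto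
        then show ?thesis using apeirogon_dist[of _ 0] by force
      next
        case False
        have "sin (\<phi> + t - pi) > 0" using t False p by (intro sin_gt_zero) linarith+
        then have s: "sin (pi - \<phi> - t) < 0" using sin_minus[of "\<phi> + t - pi"] by (simp add: algebra_simps)
        have "cmod (ray (cis \<phi>) t \<epsilon> - of_real \<Lambda>) < 1" using elim by (intro ray_side(2)[OF _ _ p(4,5) u1 s]) auto
        then show ?thesis using apeirogon_dist[of _ 1] by force
      qed
    qed
  qed
qed

lemma sector_edge:
  assumes \<psi>: "0 < \<psi>" "\<psi> < pi" "\<bar>cos \<psi>\<bar> < cos \<phi>"
  shows "sector (apeirogon n) (open_apeirogon n) (cis \<psi>) (\<psi> - pi) pi"
proof -
  have u0: "cis \<psi> = of_real 0 + cis \<psi>" by simp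
  have "sin \<psi> > 0" using \<psi> by (intro sin_gt_zero)
  define I where "I = UNIV - {0::int}"
  have "cis \<psi> \<in> {z. Im z > 0 \<and> (\<forall>k\<in>I. 1 < cmod (z - of_real (of_int k * \<Lambda>)))}"
  proof -
    have "1 < cmod (cis \<psi> - of_real (of_int k * \<Lambda>))" if "k \<in> I" for k
      using that \<psi> by (intro other_strict) (auto simp: I_def)
    then show ?thesis using \<open>sin \<psi> > 0\<close> by simp
  qed
  then have near: "\<forall>\<^sub>F \<epsilon> in at_right 0. Im (ray (cis \<psi>) t \<epsilon>) > 0 \<and> (\<forall>k\<in>I. 1 < cmod (ray (cis \<psi>) t \<epsilon> - of_real (of_int k * \<Lambda>)))" for t
    using ray_in_open[OF open_outside] by auto
  show ?thesis
    unfolding sector_def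
  proof (intro conjI allI impI)
    fix t assume t: "\<psi> - pi < t \<and> t < \<psi> - pi + pi"
    have s0: "sin (\<psi> - t) > 0" using t by (intro sin_gt_zero) linarith+
    show "\<forall>\<^sub>F \<epsilon> in at_right 0. ray (cis \<psi>) t \<epsilon> \<in> open_apeirogon n"
      using near[of t] eventually_small
    proof eventually_elim
      case (elim \<epsilon>)
      have "1 < cmod (ray (cis \<psi>) t \<epsilon> - of_real 0)" using elim \<psi> s0 by (intro ray_side(1)[OF _ _ _ _ u0]) auto
      then have "1 < cmod (ray (cis \<psi>) t \<epsilon> - of_real (of_int k * \<Lambda>))" for k :: int
        using elim by (cases "k \<in> I") (auto simp: I_def)
      then show ?case using elim by (auto simp: open_apeirogon_def)
    qed
  next
    fix t assume t: "\<psi> - pi + pi < t \<and> t < \<psi> - pi + 2 * pi"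
    have "sin (t - \<psi>) > 0" using t by (intro sin_gt_zero) linarith+
    then have s0: "sin (\<psi> - t) < 0" using sin_minus[of "t - \<psi>"] by simp
    show "\<forall>\<^sub>F \<epsilon> in at_right 0. ray (cis \<psi>) t \<epsilon> \<notin> apeirogon n"
      using eventually_small
    proof eventually_elim
      case (elim \<epsilon>)
      have "cmod (ray (cis \<psi>) t \<epsilon> - of_real 0) < 1" using elim \<psi> s0 by (intro ray_side(2)[OF _ _ _ _ u0]) auto
      then show ?case using apeirogon_dist[of _ 0] by force
    qed
  qed
qed

lemma sector_boundary:
  assumes u: "u \<in> apeirogon n" "u \<notin> open_apeirogon n"
  obtains a l where "sector (apeirogon n) (open_apeirogon n) u a l" "l = 2 * \<phi> \<and> a = - \<phi> \<or> l = pi" "Im u \<le> 1"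
proof -
  obtain k :: int where k: "cmod (u - of_real (of_int k * \<Lambda>)) = 1"
  proof -
    have "Im u > 0" using u by (simp add: apeirogon_def)
    then obtain k :: int where "\<not> 1 < cmod (u - of_real (of_int k * \<Lambda>))"
      using u(2) unfolding open_apeirogon_def by blast
    then show thesis using apeirogon_dist[OF u(1), of k] that[of k] by linarith
  qed
  define u0 where "u0 = u - of_real (of_int k * \<Lambda>)"
  have uk: "u = u0 + of_real (of_int k * \<Lambda>)" by (simp add: u0_def)
  have "u0 \<in> apeirogon n" using u(1) unfolding uk by (simp only: apeirogon_shift)
  moreover have "Im u > 0" using u(1) by (simp add: apeirogon_def)
  ultimately have u0: "cmod u0 = 1" "Im u0 > 0" "u0 \<in> apeirogon n" using k by (simp_all add: u0_def)
  define \<psi> where "\<psi> = arccos (Re u0)"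
  have re: "- 1 \<le> Re u0" "Re u0 \<le> 1" using abs_Re_le_cmod[of u0] u0 by auto
  have sq: "(Re u0)\<^sup>2 + (Im u0)\<^sup>2 = 1" using u0(1) by (simp add: cmod_def)
  have "(Re u0)\<^sup>2 < 1" using sq u0(2) by (smt (verit) zero_less_power2)
  then have re': "- 1 < Re u0" "Re u0 < 1" using re by (auto simp: power2_eq_1_iff less_le)
  have \<psi>: "0 < \<psi>" "\<psi> < pi" "cos \<psi> = Re u0" using re' arccos_lt_bounded by (auto simp: \<psi>_def)
  have "sin \<psi> = Im u0"
  proof -
    have "(sin \<psi>)\<^sup>2 = (Im u0)\<^sup>2" using sq \<psi>(3) by (simp add: sin_squared_eq)
    moreover have "sin \<psi> > 0" using \<psi> by (intro sin_gt_zero)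
    ultimately show ?thesis using u0(2) by (simp add: power2_eq_iff)
  qed
  then have cis: "u0 = cis \<psi>" using \<psi> by (simp add: complex_eq_iff)
  have "1 \<le> cmod (u0 - of_real (of_int 1 * \<Lambda>))" "1 \<le> cmod (u0 - of_real (of_int (- 1) * \<Lambda>))"
    using u0(3) unfolding apeirogon_def by blast+
  then have "1 \<le> (Re u0 - \<Lambda>)\<^sup>2 + (Im u0)\<^sup>2" "1 \<le> (Re u0 + \<Lambda>)\<^sup>2 + (Im u0)\<^sup>2"
    using cmod_ge_iff[of 1 u0 \<Lambda>] cmod_ge_iff[of 1 u0 "- \<Lambda>"] by simp_all
  then have "0 \<le> \<Lambda> * (\<Lambda> - 2 * Re u0)" "0 \<le> \<Lambda> * (\<Lambda> + 2 * Re u0)"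
    using sq by (simp_all add: power2_eq_square algebra_simps)
  then have "0 \<le> \<Lambda> - 2 * Re u0" "0 \<le> \<Lambda> + 2 * Re u0" using width_bounds by (simp_all add: zero_le_mult_iff)
  then have le: "\<bar>cos \<psi>\<bar> \<le> cos \<phi>" using \<psi>(3) width_cos by auto
  have pa: "0 < \<phi>" "\<phi> < pi" using angle_bounds pi_gt_zero by linarith+
  have Im1: "Im u \<le> 1" using uk cis by simp
  consider "\<bar>cos \<psi>\<bar> < cos \<phi>" | "cos \<psi> = cos \<phi>" | "cos \<psi> = - cos \<phi>" using le by linarith
  then show thesis
  proof cases
    case 1
    have sec: "sector (apeirogon n) (open_apeirogon n) u (\<psi> - pi) pi"
      using sector_shift[OF sector_edge[OF \<psi>(1,2) 1], of k] by (simp only: uk cis)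
    show thesis by (rule that[OF sec _ Im1]) simp
  next
    case 2
    have "\<psi> = \<phi>" using \<psi>(1,2) pa less_imp_le by (intro cos_inj_pi[OF _ _ _ _ 2]) blast+
    then have sec: "sector (apeirogon n) (open_apeirogon n) u (- \<phi>) (2 * \<phi>)"
      using sector_shift[OF sector_vertex, of k] by (simp only: uk cis)
    show thesis by (rule that[OF sec _ Im1]) simp
  next
    case 3
    then have eq: "cos \<psi> = cos (pi - \<phi>)" by simp
    have "0 \<le> pi - \<phi>" "pi - \<phi> \<le> pi" using pa by linarith+
    then have "\<psi> = pi - \<phi>" using \<psi>(1,2) less_imp_le by (intro cos_inj_pi[OF _ _ _ _ eq]) blast+
    then have "u0 = cis (pi - \<phi>)" using cis by (simp only:)
    moreover have "cis (pi - \<phi>) = cis \<phi> - of_real \<Lambda>" by (simp add: complex_eq_iff width_cos)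
    ultimately have "u = cis \<phi> - of_real \<Lambda> + of_real (of_int k * \<Lambda>)" using uk by (simp only:)
    then have "u = cis \<phi> + of_real (of_int (k - 1) * \<Lambda>)" by (simp add: algebra_simps)
    then have sec: "sector (apeirogon n) (open_apeirogon n) u (- \<phi>) (2 * \<phi>)"
      using sector_shift[OF sector_vertex, of "k - 1"] by (simp only:)
    show thesis by (rule that[OF sec _ Im1]) simp
  qed
qed

lemma sector_lower:
  assumes s: "sector (apeirogon n) (open_apeirogon n) u a l" and u: "Im u \<le> 1"
  shows "sector (row n m) (open_row n m) u a l"
proof -
  have cl: "open {z::complex. z / of_nat m \<notin> apeirogon n}"
  proof -
    have "open ((\<lambda>z. z / of_nat m) -` (- apeirogon n))"
      using continuous_div_m closed_apeirogon by (simp add: continuous_on_open_vimage open_Compl)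
    then show ?thesis by (simp add: vimage_def)
  qed
  have "Im (u / of_nat m) \<le> 1 / real m" using u m_bounds by (simp add: Im_divide_of_nat field_simps)
  also have "\<dots> < sin \<phi>" using tall m_bounds by (simp add: field_simps)
  finally have "u / of_nat m \<notin> apeirogon n" using apeirogon_Im by fastforce
  then have ev: "\<forall>\<^sub>F \<epsilon> in at_right 0. ray u t \<epsilon> / of_nat m \<notin> apeirogon n" for t
    using ray_in_open[OF cl] by auto
  show ?thesis
    unfolding sector_def
  proof (intro conjI allI impI)
    fix t assume "a < t \<and> t < a + l"
    then have "\<forall>\<^sub>F \<epsilon> in at_right 0. ray u t \<epsilon> \<in> open_apeirogon n" using s by (simp add: sector_def)
    with ev[of t] show "\<forall>\<^sub>F \<epsilon> in at_right 0. ray u t \<epsilon> \<in> open_row n m"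
      by eventually_elim (simp add: open_row_def)
  next
    fix t assume "a + l < t \<and> t < a + 2 * pi"
    then have "\<forall>\<^sub>F \<epsilon> in at_right 0. ray u t \<epsilon> \<notin> apeirogon n" using s by (simp add: sector_def)
    then show "\<forall>\<^sub>F \<epsilon> in at_right 0. ray u t \<epsilon> \<notin> row n m"
      by eventually_elim (simp add: row_def)
  qed
qed

text \<open>
The lower boundary of a row is the polygon itself; at the upper boundary the row is the complement of
the polygon scaled by \<open>m\<close>, so there the sectors are the complementary ones.
\<close>

lemma row_sector:
  assumes u: "u \<in> row n m"
  obtains a l where "sector (row n m) (open_row n m) u a l"
    "l = 2 * \<phi> \<and> a = - \<phi> \<or> l = pi \<or> l = 2 * pi - 2 * \<phi> \<and> a = \<phi> \<and> u / of_nat m \<in> apeirogon n \<or> l = 2 * pi"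
proof -
  have dv: "ray u t \<epsilon> / of_nat m = ray (u / of_nat m) t \<epsilon>" for t \<epsilon>
    by (simp add: ray_def disk_chart_div)
  consider (lower) "u \<in> apeirogon n" "u \<notin> open_apeirogon n"
    | (upper) "u \<in> open_apeirogon n" "u / of_nat m \<in> apeirogon n" "u / of_nat m \<notin> open_apeirogon n"
    | (inner) "u \<in> open_row n m"
    using u by (auto simp: row_def open_row_def)
  then show thesis
  proof cases
    case lower
    obtain a l where al: "sector (apeirogon n) (open_apeirogon n) u a l" "l = 2 * \<phi> \<and> a = - \<phi> \<or> l = pi" "Im u \<le> 1"
      using sector_boundary[OF lower] by metis
    have "sector (row n m) (open_row n m) u a l" using sector_lower al(1,3) by blast
    then show thesis using al(2) by (intro that) auto
  next
    case upper
    obtain a l where al: "sector (apeirogon n) (open_apeirogon n) (u / of_nat m) a l" "l = 2 * \<phi> \<and> a = - \<phi> \<or> l = pi"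
      using sector_boundary[OF upper(2,3)] by metis
    have "sector (row n m) (open_row n m) u (a + l) (2 * pi - l)"
      unfolding sector_def
    proof (intro conjI allI impI)
      fix t assume "a + l < t \<and> t < a + l + (2 * pi - l)"
      then have "\<forall>\<^sub>F \<epsilon> in at_right 0. ray (u / of_nat m) t \<epsilon> \<notin> apeirogon n" using al(1) by (simp add: sector_def)
      with ray_in_open[OF open_open_apeirogon upper(1), of t] show "\<forall>\<^sub>F \<epsilon> in at_right 0. ray u t \<epsilon> \<in> open_row n m"
        by eventually_elim (simp add: open_row_def dv)
    next
      fix t assume "a + l + (2 * pi - l) < t \<and> t < a + l + 2 * pi"
      then have "\<forall>\<^sub>F \<epsilon> in at_right 0. ray (u / of_nat m) (t + 2 * pi * of_int (- 1)) \<epsilon> \<in> open_apeirogon n"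
        using al(1) by (simp add: sector_def)
      then have "\<forall>\<^sub>F \<epsilon> in at_right 0. ray (u / of_nat m) t \<epsilon> \<in> open_apeirogon n" by (simp only: ray_period)
      then show "\<forall>\<^sub>F \<epsilon> in at_right 0. ray u t \<epsilon> \<notin> row n m"
        by eventually_elim (simp add: row_def dv)
    qed
    then show thesis using al(2) upper(2) by (intro that) auto
  next
    case inner
    have "sector (row n m) (open_row n m) u 0 (2 * pi)"
      unfolding sector_def using ray_in_open[OF open_open_row inner] by auto
    then show thesis by (intro that) auto
  qed
qed

section \<open>The rows around a corner\<close>

abbreviation "v \<equiv> cis \<phi>"

definition covers :: "psl2 \<Rightarrow> real \<Rightarrow> real \<Rightarrow> bool" where
  "covers g a l \<longleftrightarrow>
     (\<forall>t. a < t \<and> t < a + l \<longrightarrow> (\<forall>\<^sub>F \<epsilon> in at_right 0. mobius (inverse g) (ray v t \<epsilon>) \<in> open_row n m)) \<and>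
     (\<forall>t. a + l < t \<and> t < a + 2 * pi \<longrightarrow> (\<forall>\<^sub>F \<epsilon> in at_right 0. mobius (inverse g) (ray v t \<epsilon>) \<notin> row n m))"

text \<open>
The chart at the corner \<open>v\<close> and the chart at its preimage differ by the rotation \<open>\<theta>\<close>. Equivalently, the base
point of \<open>g\<close> is the endpoint of the geodesic ray that leaves \<open>v\<close> in the direction \<open>\<theta>\<close>.
\<close>

definition turns :: "psl2 \<Rightarrow> real \<Rightarrow> bool" where
  "turns g \<theta> \<longleftrightarrow> (\<exists>a b c d. a * d - b * c = 1 \<and> g = psl2_of a b c d \<and>
     of_real a - of_real c * v = cis \<theta> * cnj (of_real a - of_real c * v))"

lemma covers_period:
  assumes "covers g a l" shows "covers g (a + 2 * pi * of_int k) l"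
  unfolding covers_def
proof (intro conjI allI impI)
  fix t assume "a + 2 * pi * of_int k < t \<and> t < a + 2 * pi * of_int k + l"
  then have "\<forall>\<^sub>F \<epsilon> in at_right 0. mobius (inverse g) (ray v (t + 2 * pi * of_int (- k)) \<epsilon>) \<in> open_row n m"
    using assms by (simp add: covers_def)
  then show "\<forall>\<^sub>F \<epsilon> in at_right 0. mobius (inverse g) (ray v t \<epsilon>) \<in> open_row n m" by (simp only: ray_period)
next
  fix t assume "a + 2 * pi * of_int k + l < t \<and> t < a + 2 * pi * of_int k + 2 * pi"
  then have "\<forall>\<^sub>F \<epsilon> in at_right 0. mobius (inverse g) (ray v (t + 2 * pi * of_int (- k)) \<epsilon>) \<notin> row n m"
    using assms by (simp add: covers_def)
  then show "\<forall>\<^sub>F \<epsilon> in at_right 0. mobius (inverse g) (ray v t \<epsilon>) \<notin> row n m" by (simp only: ray_period)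
qed

lemma turns_period: "turns g \<theta> \<Longrightarrow> turns g (\<theta> + 2 * pi * of_int k)"
  using cis_multiple_2pi[of "of_int k"] cis_mult[of \<theta> "2 * pi * of_int k"] by (simp add: turns_def)

lemma corner_uhp: "v \<in> uhp"
  using width_bounds by (simp add: uhp_iff)

lemma ray_uhp: "\<epsilon> \<ge> 0 \<Longrightarrow> \<epsilon> < 1 \<Longrightarrow> ray v t \<epsilon> \<in> uhp"
  unfolding ray_def using corner_uhp by (intro disk_chart_uhp) (auto simp: norm_mult)

lemma covers_of_sector:
  assumes s: "sector (row n m) (open_row n m) (mobius (inverse g) v) a l"
  obtains \<theta> where "turns g \<theta>" "covers g (a + \<theta>) l"
proof -
  obtain a' b c d where k: "a' * d - b * c = 1" "g = psl2_of a' b c d" by (metis psl2_cases)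
  define e where "e = of_real a' - of_real c * v"
  have "d * a' - (- b) * (- c) = 1" using k(1) by (simp add: algebra_simps)
  then have "e \<noteq> 0" using denom_nonzero[of d a' "- b" "- c" v] corner_uhp by (simp add: e_def uhp_iff)
  then have "cmod (e / cnj e) = 1" by (simp add: norm_divide)
  then have c: "e / cnj e = cis (Arg (e / cnj e))" using \<open>e \<noteq> 0\<close> by (simp add: cis_Arg sgn_eq norm_divide)
  define \<theta> where "\<theta> = Arg (e / cnj e)"
  have e1: "e = cis \<theta> * cnj e" using c \<open>e \<noteq> 0\<close> by (simp add: \<theta>_def field_simps)
  have "turns g \<theta>" unfolding turns_def using k e1 e_def by blast
  have "cnj e / e = cis (- \<theta>)"
    using c \<open>e \<noteq> 0\<close> unfolding \<theta>_def[symmetric] by (metis cis_divide cis_zero diff_0 divide_divide_eq_left' inverse_divide inverse_eq_divide divide_self_if)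
  then have rot: "mobius (inverse g) (ray v t \<epsilon>) = ray (mobius (inverse g) v) (t - \<theta>) \<epsilon>" if "0 < \<epsilon> \<and> \<epsilon> < 1/2" for t \<epsilon>
    using mobius_disk_chart[OF k(1) corner_uhp, of "of_real \<epsilon> * cis t"] that
    unfolding ray_def k(2) e_def[symmetric] by (simp add: norm_mult cis_mult mult.assoc)
  have ev: "\<forall>\<^sub>F \<epsilon> in at_right 0. mobius (inverse g) (ray v t \<epsilon>) = ray (mobius (inverse g) v) (t - \<theta>) \<epsilon>" for t
    using eventually_small by eventually_elim (rule rot)
  have "covers g (a + \<theta>) l"
    unfolding covers_def
  proof (intro conjI allI impI)
    fix t assume "a + \<theta> < t \<and> t < a + \<theta> + l"
    then have "\<forall>\<^sub>F \<epsilon> in at_right 0. ray (mobius (inverse g) v) (t - \<theta>) \<epsilon> \<in> open_row n m"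
      using s by (simp add: sector_def)
    with ev[of t] show "\<forall>\<^sub>F \<epsilon> in at_right 0. mobius (inverse g) (ray v t \<epsilon>) \<in> open_row n m"
      by eventually_elim simp
  next
    fix t assume "a + \<theta> + l < t \<and> t < a + \<theta> + 2 * pi"
    then have "\<forall>\<^sub>F \<epsilon> in at_right 0. ray (mobius (inverse g) v) (t - \<theta>) \<epsilon> \<notin> row n m"
      using s by (simp add: sector_def)
    with ev[of t] show "\<forall>\<^sub>F \<epsilon> in at_right 0. mobius (inverse g) (ray v t \<epsilon>) \<notin> row n m"
      by eventually_elim simp
  qed
  then show thesis using that \<open>turns g \<theta>\<close> by blast
qed

text \<open>
A row with the corner \<open>v\<close> of angle \<open>2 \<pi>/n\<close>, with \<open>v\<close> inside a side, with \<open>v\<close> at the tip of a dent, or with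
\<open>v\<close> in its interior. At corners and tips, the position of the sector determines the rotation.
\<close>

definition arc :: "psl2 \<Rightarrow> real \<Rightarrow> real \<Rightarrow> bool" where
  "arc g a l \<longleftrightarrow> covers g a l \<and>
     (l = 2 * \<phi> \<and> turns g (a + \<phi>) \<or> l = pi \<or>
      l = 2 * pi - 2 * \<phi> \<and> turns g (a - \<phi>) \<and> mobius (inverse g) v / of_nat m \<in> apeirogon n \<or> l = 2 * pi)"

lemma arc_period: "arc g a l \<Longrightarrow> arc g (a + 2 * pi * of_int k) l"
  using covers_period[of g a l k] turns_period[of g "a + \<phi>" k] turns_period[of g "a - \<phi>" k]
  unfolding arc_def by (auto simp: algebra_simps)

lemma arc_exists:
  assumes "mobius (inverse g) v \<in> row n m" obtains a l where "arc g a l"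
proof -
  obtain a l where al: "sector (row n m) (open_row n m) (mobius (inverse g) v) a l"
    "l = 2 * \<phi> \<and> a = - \<phi> \<or> l = pi \<or> l = 2 * pi - 2 * \<phi> \<and> a = \<phi> \<and> mobius (inverse g) v / of_nat m \<in> apeirogon n \<or> l = 2 * pi"
    using row_sector[OF assms] by metis
  obtain \<theta> where "turns g \<theta>" "covers g (a + \<theta>) l" using covers_of_sector[OF al(1)] .
  then have "arc g (a + \<theta>) l" using al(2) by (auto simp: arc_def)
  then show thesis by (rule that)
qed

lemma arc_length: "arc g a l \<Longrightarrow> 0 < l \<and> l \<le> 2 * pi"
  using angle_bounds pi_gt_zero unfolding arc_def by (elim conjE disjE) linarith+

context
  fixes T assumes T: "row_tiling T"
begin

text \<open>
Points close to \<open>v\<close> are covered by placements from a compact set, of which there are finitely many. So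
one of them covers points arbitrarily close to \<open>v\<close> along a given ray.
\<close>

lemma direction_covered:
  obtains K where "finite K" "K \<subseteq> T"
    "\<And>t. \<exists>g\<in>K. \<exists>\<^sub>F \<epsilon> in at_right 0. mobius (inverse g) (ray v t \<epsilon>) \<in> row n m"
proof -
  have "\<exists>C. compact C \<and> C \<subseteq> row n m \<and> (\<forall>z\<in>uhp. \<exists>g\<in>T. mobius (inverse g) z \<in> C)"
    using T unfolding row_tiling_def by (elim conjE)
  then obtain C where C: "compact C" "C \<subseteq> row n m" "\<forall>z\<in>uhp. \<exists>g\<in>T. mobius (inverse g) z \<in> C"
    by (elim exE conjE)
  obtain M where M: "\<And>y. y \<in> C \<Longrightarrow> cmod y \<le> M"
    using compact_imp_bounded[OF C(1)] by (auto simp: bounded_iff)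
  have s: "sin \<phi> / 3 > 0" using width_bounds by simp
  obtain Q where Q: "compact Q" "\<And>g y. Im y \<ge> sin \<phi> / 3 \<Longrightarrow> cmod y \<le> max M 3 \<Longrightarrow>
       Im (mobius g y) \<ge> sin \<phi> / 3 \<Longrightarrow> cmod (mobius g y) \<le> max M 3 \<Longrightarrow> g \<in> Q"
    using proper_action[OF s, of "max M 3"] by metis
  define K where "K = T \<inter> Q"
  have K: "finite K" "K \<subseteq> T" using T Q(1) by (auto simp: K_def row_tiling_def)
  have near: "\<exists>g\<in>K. mobius (inverse g) (ray v t \<epsilon>) \<in> row n m" if e: "0 < \<epsilon> \<and> \<epsilon> < 1/2" for t \<epsilon>
  proof -
    let ?\<zeta> = "of_real \<epsilon> * cis t"
    have n1: "cmod ?\<zeta> = \<epsilon>" using e by (simp add: norm_mult)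
    have lo: "1/2 \<le> cmod (1 - ?\<zeta>)" and hi: "cmod (1 - ?\<zeta>) \<le> 3/2"
      using norm_triangle_ineq2[of 1 ?\<zeta>] norm_triangle_ineq4[of 1 ?\<zeta>] n1 e by auto
    have z: "ray v t \<epsilon> \<in> uhp" using e by (intro ray_uhp) auto
    have "cmod (ray v t \<epsilon>) = cmod (v - cnj v * ?\<zeta>) / cmod (1 - ?\<zeta>)"
      by (simp add: ray_def disk_chart_def norm_divide)
    also have "\<dots> \<le> (3/2) / (1/2)"
    proof (intro frac_le)
      have "cmod (v - cnj v * ?\<zeta>) \<le> cmod v + cmod (cnj v * ?\<zeta>)" by (rule norm_triangle_ineq4)
      also have "cmod (cnj v * ?\<zeta>) = \<epsilon>" unfolding norm_mult[of "cnj v"] n1 by simp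
      finally show "cmod (v - cnj v * ?\<zeta>) \<le> 3/2" using e by simp
    qed (use lo in auto)
    finally have c3: "cmod (ray v t \<epsilon>) \<le> 3" by simp
    have "\<epsilon>\<^sup>2 \<le> (1/2)\<^sup>2" using e by (intro power_mono) auto
    then have e2: "3/4 \<le> 1 - \<epsilon>\<^sup>2" by (simp add: power2_eq_square)
    have "(cmod (1 - ?\<zeta>))\<^sup>2 \<le> (3/2)\<^sup>2" using hi by (intro power_mono) auto
    then have c2: "(cmod (1 - ?\<zeta>))\<^sup>2 \<le> 9/4" by (simp add: power2_eq_square)
    have pos: "(cmod (1 - ?\<zeta>))\<^sup>2 > 0" using lo by (intro zero_less_power) linarith
    have "sin \<phi> / 3 = sin \<phi> * (3/4) / (9/4)" by simp
    also have "\<dots> \<le> sin \<phi> * (1 - \<epsilon>\<^sup>2) / (cmod (1 - ?\<zeta>))\<^sup>2"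
      using e2 c2 pos width_bounds by (intro frac_le mult_left_mono mult_nonneg_nonneg) auto
    also have "\<dots> = Im (ray v t \<epsilon>)" unfolding ray_def using Im_disk_chart[of ?\<zeta> v] n1 e by simp
    finally have I3: "sin \<phi> / 3 \<le> Im (ray v t \<epsilon>)" .
    obtain g where g: "g \<in> T" "mobius (inverse g) (ray v t \<epsilon>) \<in> C" using C(3) z by blast
    have "sin \<phi> \<le> Im (mobius (inverse g) (ray v t \<epsilon>))" using row_Im C(2) g(2) by blast
    then have "sin \<phi> / 3 \<le> Im (mobius (inverse g) (ray v t \<epsilon>))" using width_bounds by linarith
    then have "g \<in> Q" using I3 c3 M[OF g(2)] z by (intro Q(2)[of "mobius (inverse g) (ray v t \<epsilon>)"]) auto
    then show ?thesis using g C(2) by (auto simp: K_def)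
  qed
  have "\<exists>g\<in>K. \<exists>\<^sub>F \<epsilon> in at_right 0. mobius (inverse g) (ray v t \<epsilon>) \<in> row n m" for t
  proof (rule ccontr)
    assume "\<not> ?thesis"
    then have "\<forall>g\<in>K. \<forall>\<^sub>F \<epsilon> in at_right 0. mobius (inverse g) (ray v t \<epsilon>) \<notin> row n m"
      by (simp add: not_frequently)
    then have "\<forall>\<^sub>F \<epsilon> in at_right 0. \<forall>g\<in>K. mobius (inverse g) (ray v t \<epsilon>) \<notin> row n m"
      using K(1) by (simp add: eventually_ball_finite_distrib)
    with eventually_small have "\<forall>\<^sub>F \<epsilon>::real in at_right 0. False"
      by eventually_elim (use near in blast)
    then show False by simp
  qed
  then show thesis using K that by blast
qed

text \<open>
Apply the covering of directions to a sequence decreasing to \<open>b\<close>: one placement covers infinitely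
many of these directions, and its sector is closed on the left.
\<close>

lemma arc_through:
  obtains g a l where "g \<in> T" "arc g a l" "a \<le> b" "b < a + l"
proof -
  obtain K where K: "finite K" "K \<subseteq> T"
    "\<And>t. \<exists>g\<in>K. \<exists>\<^sub>F \<epsilon> in at_right 0. mobius (inverse g) (ray v t \<epsilon>) \<in> row n m"
    using direction_covered by metis
  define s where "s j = b + 1 / real (Suc j)" for j
  obtain G where G: "\<And>j. G j \<in> K" "\<And>j. \<exists>\<^sub>F \<epsilon> in at_right 0. mobius (inverse (G j)) (ray v (s j) \<epsilon>) \<in> row n m"
    using K(3)[of "s _"] by metis
  have "finite (range G)" using G(1) K(1) by (metis finite_subset image_subset_iff)
  then obtain j0 where "infinite {j \<in> UNIV. G j = G j0}"
    using pigeonhole_infinite[of UNIV G] by auto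
  then have inf: "infinite {j. G j = G j0}" by simp
  define g where "g = G j0"
  have "mobius (inverse g) v \<in> row n m"
  proof (rule ccontr)
    assume no: "mobius (inverse g) v \<notin> row n m"
    have "open {z \<in> uhp. mobius (inverse g) z \<in> - row n m}"
      using closed_row by (intro open_mobius_preimage) auto
    then have "\<forall>\<^sub>F \<epsilon> in at_right 0. ray v (s j0) \<epsilon> \<in> {z \<in> uhp. mobius (inverse g) z \<in> - row n m}"
      using no corner_uhp by (intro ray_in_open) auto
    then have "\<forall>\<^sub>F \<epsilon> in at_right 0. mobius (inverse g) (ray v (s j0) \<epsilon>) \<notin> row n m"
      by eventually_elim simp
    then show False using G(2)[of j0] by (simp add: g_def frequently_def)
  qed
  then obtain a0 l where al: "arc g a0 l" by (rule arc_exists)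
  obtain k :: int where k: "0 \<le> b - a0 - of_int k * (2 * pi)" "b - a0 - of_int k * (2 * pi) < 2 * pi"
    using floor_shift[of "2 * pi" "b - a0"] pi_gt_zero by auto
  define a where "a = a0 + 2 * pi * of_int k"
  have a: "a \<le> b" "b < a + 2 * pi" "arc g a l"
    using k arc_period[OF al] by (auto simp: a_def algebra_simps)
  have "b < a + l"
  proof (rule ccontr)
    assume not: "\<not> b < a + l"
    obtain N where N: "1 / real (Suc N) < a + 2 * pi - b" using a(2) by (metis diff_gt_0_iff_gt nat_approx_posE)
    obtain j where j: "j \<ge> N" "G j = g" using inf unfolding g_def infinite_nat_iff_unbounded_le by blast
    have "1 / real (Suc j) \<le> 1 / real (Suc N)" using j by (simp add: frac_le)
    then have "a + l < s j \<and> s j < a + 2 * pi" using N not unfolding s_def by (smt (verit) zero_less_divide_1_iff of_nat_0_less_iff zero_less_Suc)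
    then have "\<forall>\<^sub>F \<epsilon> in at_right 0. mobius (inverse g) (ray v (s j) \<epsilon>) \<notin> row n m"
      using a(3) by (simp add: arc_def covers_def)
    then show False using G(2)[of j] j by (simp add: frequently_def)
  qed
  then show thesis using that a K(2) G(1) g_def by blast
qed

lemma overlap_same_row:
  assumes g: "g \<in> T" "arc g a l" and h: "h \<in> T" "arc h a' l'"
    and t: "a < t" "t < a + l" "a' < t" "t < a' + l'" and z: "z \<in> uhp"
  shows "mobius (inverse g) z \<in> row n m \<longleftrightarrow> mobius (inverse h) z \<in> row n m"
proof -
  have "\<forall>\<^sub>F \<epsilon> in at_right 0. mobius (inverse g) (ray v t \<epsilon>) \<in> open_row n m"
    "\<forall>\<^sub>F \<epsilon> in at_right 0. mobius (inverse h) (ray v t \<epsilon>) \<in> open_row n m"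
    using assms by (simp_all add: arc_def covers_def)
  with eventually_small have "\<forall>\<^sub>F \<epsilon> in at_right 0. ray v t \<epsilon> \<in> uhp \<and> mobius (inverse g) (ray v t \<epsilon>) \<in> open_row n m \<and>
     mobius (inverse h) (ray v t \<epsilon>) \<in> open_row n m"
    by eventually_elim (auto intro: ray_uhp)
  then obtain \<epsilon> where "ray v t \<epsilon> \<in> uhp" "mobius (inverse g) (ray v t \<epsilon>) \<in> open_row n m"
     "mobius (inverse h) (ray v t \<epsilon>) \<in> open_row n m"
    by (metis (mono_tags, lifting) eventually_happens trivial_limit_at_right_real)
  then obtain k :: int where "h = g * \<tau> k" using row_tiling_overlap[OF T g(1) h(1)] by metis
  then show ?thesis using row_same[OF z] by simp
qed

lemma overlap_inside:
  assumes g: "g \<in> T" "arc g a l" and h: "h \<in> T" "arc h a' l'"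
    and t: "a < t" "t < a + l" "a' < t" "t < a' + l'"
    and s: "a < s" "s < a + l" and h': "arc h a'' l''"
  shows "\<not> (a'' + l'' < s \<and> s < a'' + 2 * pi)"
proof
  assume "a'' + l'' < s \<and> s < a'' + 2 * pi"
  then have "\<forall>\<^sub>F \<epsilon> in at_right 0. mobius (inverse h) (ray v s \<epsilon>) \<notin> row n m" using h' by (simp add: arc_def covers_def)
  moreover have "\<forall>\<^sub>F \<epsilon> in at_right 0. mobius (inverse g) (ray v s \<epsilon>) \<in> open_row n m" using g s by (simp add: arc_def covers_def)
  ultimately have "\<forall>\<^sub>F \<epsilon>::real in at_right 0. False"
    using eventually_small
  proof eventually_elim
    case (elim \<epsilon>)
    then have "ray v s \<epsilon> \<in> uhp" by (intro ray_uhp) auto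
    then show ?case using overlap_same_row[OF g h t] elim open_row_subset by blast
  qed
  then show False by simp
qed

text \<open>
Going around \<open>v\<close> counterclockwise, a new sector begins exactly where the last one ended, and it ends
before the sector of the initial row is reached again.
\<close>

lemma next_arc:
  assumes one: "1 \<in> T" "arc 1 (- \<phi>) (2 * \<phi>)"
    and g0: "g0 \<in> T" "arc g0 a0 l0" "a0 + l0 = b" "l0 < 2 * pi" and b: "\<phi> \<le> b" "b < 2 * pi - \<phi>"
  obtains g l where "g \<in> T" "arc g b l" "b + l \<le> 2 * pi - \<phi>"
proof -
  obtain g a l where g: "g \<in> T" "arc g a l" "a \<le> b" "b < a + l" by (rule arc_through)
  have l0: "l0 > 0" using arc_length g0 by blast
  have "a = b"
  proof (rule ccontr)
    assume "a \<noteq> b"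
    then have "max a a0 < b" using g g0 l0 by simp
    then obtain t where t: "max a a0 < t" "t < b" using dense by blast
    have "b < a0 + 2 * pi" using g0 by linarith
    then obtain s where s: "b < s" "s < a + l" "s < a0 + 2 * pi" using between g(4) by metis
    show False using overlap_inside[OF g(1,2) g0(1,2) _ _ _ _ _ _ g0(2), of t s] t s g g0 by simp
  qed
  have "b + l \<le> 2 * pi - \<phi>"
  proof (rule ccontr)
    assume far: "\<not> b + l \<le> 2 * pi - \<phi>"
    have one': "arc 1 (2 * pi - \<phi>) (2 * \<phi>)" using arc_period[OF one(2), of 1] by simp
    have ph: "\<phi> > 0" using angle_bounds by simp
    have "2 * pi - \<phi> < b + l" using far by simp
    moreover have "2 * pi - \<phi> < 2 * pi + \<phi>" using ph by simp
    ultimately obtain t where t: "2 * pi - \<phi> < t" "t < b + l" "t < 2 * pi + \<phi>" using between by metis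
    obtain s where s: "b < s" "s < 2 * pi - \<phi>" using b dense by blast
    show False using overlap_inside[OF g(1,2) one(1) one' _ _ _ _ _ _ one(2), of t s] t s b \<open>a = b\<close> by simp
  qed
  then show thesis using that g \<open>a = b\<close> by blast
qed

end

lemma arc_one: "arc 1 (- \<phi>) (2 * \<phi>)"
proof -
  have inv1: "inverse 1 = (1::psl2)" by (metis mult.right_neutral psl2_cancel(3))
  have "sector (row n m) (open_row n m) v (- \<phi>) (2 * \<phi>)"
    using width_bounds by (intro sector_lower sector_vertex) simp
  then have "covers 1 (- \<phi>) (2 * \<phi>)"
    by (simp add: sector_def covers_def inv1 mobius_one)
  moreover have "turns 1 0"
    unfolding turns_def by (intro exI[of _ 1] exI[of _ 0]) (simp add: psl2_one)
  ultimately show ?thesis by (simp add: arc_def)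
qed

text \<open>
Measure angles in units of \<open>\<pi>/5\<close> and start with the sector from \<open>-1\<close> to \<open>1\<close>. The remaining \<open>8\<close> units are filled
by consecutive sectors of lengths \<open>2\<close>, \<open>5\<close> and \<open>8\<close>. After a sector of length \<open>5\<close> there remain \<open>1\<close> or \<open>3\<close> units, an
odd number that is too small for another \<open>5\<close> and cannot be filled by sectors of length \<open>2\<close>. A sector of
length \<open>8\<close> is the tip of a dent without rotation, so its row is based at \<open>\<infinity>\<close> and has scale at most \<open>1/m\<close>,
which is excluded. So there are only sectors of length \<open>2\<close>, of which the first three are recorded.
\<close>

lemma five_rows:
  assumes n: "n = 5" and T: "row_tiling T" "1 \<in> T"
    and lowest: "\<And>g. g \<in> T \<Longrightarrow> sq21 g = 0 \<Longrightarrow> 1 / 2 < sq11 g"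
  obtains g1 g2 g3 where "g1 \<in> T" "g2 \<in> T" "g3 \<in> T" "turns g1 (2 * \<phi>)" "turns g2 (4 * \<phi>)" "turns g3 (6 * \<phi>)"
proof -
  have pi5: "pi = 5 * \<phi>" using n by simp
  have ph: "\<phi> > 0" using angle_bounds by simp
  have step: "\<exists>g\<in>T. \<exists>l. arc g b l \<and> b + l \<le> 9 * \<phi>"
    if h: "g0 \<in> T" "arc g0 a0 l0" "a0 + l0 = b" "l0 \<le> 8 * \<phi>" "\<phi> \<le> b" "b < 9 * \<phi>" for g0 a0 l0 b
  proof -
    have "l0 < 2 * pi" "b < 2 * pi - \<phi>" using h pi5 ph by linarith+
    then obtain g l where "g \<in> T" "arc g b l" "b + l \<le> 2 * pi - \<phi>"
      using next_arc[OF T(1,2) arc_one h(1-3) _ h(5)] by metis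
    moreover have "2 * pi - \<phi> = 9 * \<phi>" using pi5 by linarith
    ultimately show ?thesis by auto
  qed
  have types: "l = 2 * \<phi> \<and> turns g (a + \<phi>) \<or> l = 5 * \<phi> \<or>
      l = 8 * \<phi> \<and> turns g (a - \<phi>) \<and> mobius (inverse g) v / of_nat m \<in> apeirogon n \<or> l = 10 * \<phi>"
    if "arc g a l" for g a l
  proof -
    have "2 * pi = 10 * \<phi>" "2 * pi - 2 * \<phi> = 8 * \<phi>" using pi5 by linarith+
    then show ?thesis using that pi5 unfolding arc_def by metis
  qed
  have upper: False if h: "g \<in> T" "turns g 0" "mobius (inverse g) v / of_nat m \<in> apeirogon n" for g
  proof -
    obtain a b c d where k: "a * d - b * c = 1" "g = psl2_of a b c d"
      "of_real a - of_real c * v = cis 0 * cnj (of_real a - of_real c * v)"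
      using h(2) unfolding turns_def by blast
    then have "c * sin \<phi> = 0" by (simp add: complex_eq_iff)
    then have "c = 0" using width_bounds by simp
    then have s: "sq21 g = 0" using k sq_psl2_of by simp
    have "sin \<phi> \<le> Im (mobius (inverse g) v / of_nat m)" using h(3) apeirogon_Im by blast
    also have "\<dots> = sin \<phi> / sq11 g / real m" using depth_base_infinity[OF s, of v] by (simp add: Im_divide_of_nat)
    finally have "sq11 g * real m \<le> 1" using sq11_pos[OF s] m_bounds width_bounds by (simp add: field_simps)
    moreover have "1/2 * real m < sq11 g * real m" using lowest[OF h(1) s] m_bounds by (intro mult_strict_right_mono) auto
    ultimately show False using m_bounds by linarith
  qed
  have final: False if "g0 \<in> T" "arc g0 a0 l0" "a0 + l0 = 8 * \<phi>" "l0 \<le> 8 * \<phi>" for g0 a0 l0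
    using step[OF that] types ph by force
  have six: False if h: "g0 \<in> T" "arc g0 a0 l0" "a0 + l0 = 6 * \<phi>" "l0 \<le> 8 * \<phi>" for g0 a0 l0
  proof -
    obtain g l where g: "g \<in> T" "arc g (6 * \<phi>) l" "6 * \<phi> + l \<le> 9 * \<phi>" using step[OF h] ph by auto
    then have "l = 2 * \<phi>" using types[OF g(2)] ph by auto
    then show False using final[OF g(1,2)] ph by auto
  qed
  obtain g1 l1 where g1: "g1 \<in> T" "arc g1 \<phi> l1" "\<phi> + l1 \<le> 9 * \<phi>"
    using step[OF T(2) arc_one] ph by auto
  have t1: "l1 = 2 * \<phi>" "turns g1 (2 * \<phi>)"
  proof -
    have "l1 \<noteq> 5 * \<phi>" using six[OF g1(1,2)] ph by auto
    moreover have "l1 \<noteq> 10 * \<phi>" using g1 ph by auto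
    moreover have "\<not> (turns g1 (\<phi> - \<phi>) \<and> mobius (inverse g1) v / of_nat m \<in> apeirogon n)"
      using upper[OF g1(1)] by auto
    ultimately have "l1 = 2 * \<phi> \<and> turns g1 (\<phi> + \<phi>)" using types[OF g1(2)] by blast
    then show "l1 = 2 * \<phi>" "turns g1 (2 * \<phi>)" by (simp_all only: mult_2)
  qed
  obtain g2 l2 where g2: "g2 \<in> T" "arc g2 (3 * \<phi>) l2" "3 * \<phi> + l2 \<le> 9 * \<phi>"
    using step[OF g1(1,2), of "3 * \<phi>"] t1 ph by auto
  have t2: "l2 = 2 * \<phi>" "turns g2 (4 * \<phi>)"
  proof -
    have "l2 \<noteq> 5 * \<phi>" using final[OF g2(1,2)] ph by auto
    moreover have "l2 \<noteq> 10 * \<phi>" "l2 \<noteq> 8 * \<phi>" using g2 ph by auto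
    ultimately have "l2 = 2 * \<phi> \<and> turns g2 (3 * \<phi> + \<phi>)" using types[OF g2(2)] by blast
    moreover have "3 * \<phi> + \<phi> = 4 * \<phi>" by simp
    ultimately show "l2 = 2 * \<phi>" "turns g2 (4 * \<phi>)" by simp_all
  qed
  obtain g3 l3 where g3: "g3 \<in> T" "arc g3 (5 * \<phi>) l3" "5 * \<phi> + l3 \<le> 9 * \<phi>"
    using step[OF g2(1,2), of "5 * \<phi>"] t2 ph by auto
  have t3: "turns g3 (6 * \<phi>)"
  proof -
    have "l3 \<noteq> 5 * \<phi>" "l3 \<noteq> 10 * \<phi>" "l3 \<noteq> 8 * \<phi>" using g3 ph by auto
    then have "turns g3 (5 * \<phi> + \<phi>)" using types[OF g3(2)] by blast
    moreover have "5 * \<phi> + \<phi> = 6 * \<phi>" by simp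
    ultimately show ?thesis by simp
  qed
  show thesis using that g1(1) g2(1) g3(1) t1(2) t2(2) t3 by blast
qed

text \<open>
The direction of the base point seen from \<open>v\<close> determines the base point, that is, the ratio of the
entries of the first column.
\<close>

lemma turns_column:
  assumes "turns g (2 * real j * \<phi>)"
  obtains a b c d where "a * d - b * c = 1" "g = psl2_of a b c d" "a * sin (real j * \<phi>) = c * sin ((real j - 1) * \<phi>)"
proof -
  obtain a b c d where k: "a * d - b * c = 1" "g = psl2_of a b c d"
    "of_real a - of_real c * v = cis (2 * real j * \<phi>) * cnj (of_real a - of_real c * v)"
    using assms unfolding turns_def by blast
  define e where "e = of_real a - of_real c * v"
  have dbl: "cis (2 * real j * \<phi>) = cis (real j * \<phi>) * cis (real j * \<phi>)"
    unfolding cis_mult by (rule arg_cong[of _ _ cis]) simp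
  have e: "e = cis (real j * \<phi>) * cis (real j * \<phi>) * cnj e"
    using k(3) unfolding e_def[symmetric] dbl .
  have "cis (- (real j * \<phi>)) * (cis (real j * \<phi>) * cis (real j * \<phi>) * cnj e) =
    (cis (- (real j * \<phi>)) * cis (real j * \<phi>)) * (cis (real j * \<phi>) * cnj e)"
    by (simp only: mult.assoc)
  also have "cis (- (real j * \<phi>)) * cis (real j * \<phi>) = 1" unfolding cis_mult by simp
  finally have "cis (- (real j * \<phi>)) * e = cis (real j * \<phi>) * cnj e"
    unfolding e[symmetric] by (simp only: mult_1)
  then have "cis (- (real j * \<phi>)) * e = cnj (cis (- (real j * \<phi>)) * e)" by (simp add: cis_cnj)
  from arg_cong[OF this, of Im] have "Im (cis (- (real j * \<phi>)) * e) = 0"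
    unfolding cnj.sel(2) by linarith
  then have "a * sin (real j * \<phi>) = c * sin (real j * \<phi> - \<phi>)"
    by (simp add: e_def sin_diff algebra_simps)
  moreover have "real j * \<phi> - \<phi> = (real j - 1) * \<phi>" by (simp only: left_diff_distrib mult_1)
  ultimately have "a * sin (real j * \<phi>) = c * sin ((real j - 1) * \<phi>)" by (simp only:)
  then show thesis by (rule that[OF k(1,2)])
qed

end

section \<open>The golden ratio\<close>

text \<open>
Everything follows from \<open>sin (3 x) = sin (2 x)\<close>, which holds since \<open>3 x = \<pi> - 2 x\<close> for \<open>x = \<pi>/5\<close>.
\<close>

lemma golden_ratio: "(hecke_width 5)\<^sup>2 = hecke_width 5 + 1" "sin (3 * (pi / 5)) = sin (2 * (pi / 5))"
  "sin (2 * (pi / 5)) = hecke_width 5 * sin (pi / 5)"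
proof -
  define x where "x = pi / 5"
  have s: "sin x > 0" using pi_gt_zero by (intro sin_gt_zero) (simp_all add: x_def)
  have "sin (3 * x) = sin (pi - 2 * x)" by (simp add: x_def)
  then have e: "sin (3 * x) = sin (2 * x)" by simp
  have "sin (3 * x) = sin (2 * x + x)" by simp
  also have "\<dots> = sin x * (4 * (cos x)\<^sup>2 - 1)"
    unfolding sin_add sin_double cos_double_cos by algebra
  finally have "sin x * (4 * (cos x)\<^sup>2 - 1) = sin x * (2 * cos x)" unfolding e sin_double by auto
  then have "4 * (cos x)\<^sup>2 - 1 = 2 * cos x" using s by simp
  then show "(hecke_width 5)\<^sup>2 = hecke_width 5 + 1"
    by (simp add: hecke_width_def x_def power_mult_distrib)
  show "sin (3 * (pi / 5)) = sin (2 * (pi / 5))" using e by (simp add: x_def)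
  show "sin (2 * (pi / 5)) = hecke_width 5 * sin (pi / 5)"
    unfolding sin_double by (simp add: hecke_width_def)
qed

text \<open>
If \<open>p\<close> and \<open>q\<close> are not both even, then \<open>p\<^sup>2 - p q - q\<^sup>2\<close> is odd.
\<close>

lemma golden_ratio_irrational:
  fixes x :: real assumes "x\<^sup>2 = x + 1" "x > 0" shows "x \<notin> \<rat>"
proof
  assume "x \<in> \<rat>"
  then obtain p q :: nat where pq: "q \<noteq> 0" "\<bar>x\<bar> = real p / real q" "coprime p q"
    by (rule Rats_abs_nat_div_natE)
  then have "x = real p / real q" using assms by simp
  then have "(real p)\<^sup>2 = real p * real q + (real q)\<^sup>2"
  proof -
    have px: "real p = x * real q" using \<open>x = real p / real q\<close> pq(1) by simp
    have "(real p)\<^sup>2 = x\<^sup>2 * (real q)\<^sup>2" unfolding px by (rule power_mult_distrib)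
    also have "\<dots> = x * real q * real q + (real q)\<^sup>2" unfolding assms(1) by (simp add: algebra_simps power2_eq_square)
    finally show ?thesis unfolding px .
  qed
  then have "real (p\<^sup>2) = real (p * q + q\<^sup>2)" by simp
  then have eq: "p\<^sup>2 = p * q + q\<^sup>2" by (simp only: of_nat_eq_iff)
  then have "even (p\<^sup>2) = even (p * q + q\<^sup>2)" by simp
  then have "even p \<and> even q" by auto
  then have "2 dvd gcd p q" by simp
  then show False using pq(3) by simp
qed

lemma tile_3: "m \<ge> 2 \<Longrightarrow> hecke_tile 3 m"
proof
  assume "m \<ge> 2"
  then have "2 * sin (pi / 3) \<le> real m * sin (pi / 3)"
    by (intro mult_right_mono) (auto simp: sin_60)
  moreover have "1 < sqrt 3" by simp
  ultimately have "1 < real m * sin (pi / 3)" unfolding sin_60 by linarith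
  then show "1 < real m * sin (pi / real 3)" by simp
qed auto

lemma tile_5: "m \<ge> 2 \<Longrightarrow> hecke_tile 5 m"
proof
  assume m: "m \<ge> 2"
  have "sin (pi / 6) < sin (pi / real 5)" using pi_gt_zero by (intro sin_monotone_2pi) auto
  then have s: "1/2 < sin (pi / real 5)" by (simp add: sin_30)
  then have "2 * sin (pi / real 5) \<le> real m * sin (pi / real 5)"
    using m by (intro mult_right_mono) auto
  then show "1 < real m * sin (pi / real 5)" using s by linarith
qed auto

lemma (in hecke_tile) nondegenerate_move:
  assumes "nondegenerate n m S" shows "nondegenerate n m (move_tiling p S)"
proof -
  obtain g where g: "(\<Union>h\<in>S. mobius h ` core n m) = mobius g ` \<Union>(horoball_packing n)"
    using assms by (auto simp: nondegenerate_def)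
  have c: "core n m \<subseteq> uhp" by (auto simp: core_def uhp_iff)
  have f: "\<Union>(horoball_packing n) \<subseteq> uhp" by (force simp: horoball_packing_def uhp_iff intro: mobius_uhp[unfolded uhp_iff])
  have mm: "mobius (p * h) ` A = mobius p ` mobius h ` A" if "A \<subseteq> uhp" for h A
    using that unfolding image_image by (intro image_cong) (auto simp: mobius_mult)
  have "(\<Union>h\<in>move_tiling p S. mobius h ` core n m) = mobius p ` (\<Union>h\<in>S. mobius h ` core n m)"
    unfolding move_tiling_def image_UN by (simp add: mm[OF c])
  also have "\<dots> = mobius (p * g) ` \<Union>(horoball_packing n)" unfolding g mm[OF f] ..
  finally show ?thesis unfolding nondegenerate_def by blast
qed

text \<open>
A unimodular map that takes four integral points of the projective line to points proportional to
\<open>(1, 0)\<close>, \<open>(0, 1)\<close>, \<open>(1, r)\<close> and \<open>(1, 1)\<close> preserves their cross ratio \<open>r\<close>, which is a quotient of products of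
integral determinants.
\<close>

lemma integral_cross_ratio:
  fixes A B C D :: real and p q :: "nat \<Rightarrow> int"
  assumes det: "A * D - B * C = 1" and pq: "\<And>j. (p j, q j) \<noteq> (0, 0)"
    and x: "\<And>j. x j = A * p j + B * q j" and y: "\<And>j. y j = C * p j + D * q j"
    and e: "y 0 = 0" "x 1 = 0" "y 2 = r * x 2" "y 3 = x 3"
  shows "r \<in> \<rat>"
proof -
  have nz: "(x j, y j) \<noteq> (0, 0)" for j
  proof
    assume "(x j, y j) = (0, 0)"
    then have 0: "A * p j + B * q j = 0" "C * p j + D * q j = 0" using x y by auto
    have "(A * D - B * C) * p j = D * (A * p j + B * q j) - B * (C * p j + D * q j)"
      "(A * D - B * C) * q j = A * (C * p j + D * q j) - C * (A * p j + B * q j)" by algebra+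
    then have "real_of_int (p j) = 0" "real_of_int (q j) = 0" unfolding det 0 by simp_all
    then show False using pq[of j] by simp
  qed
  have ne: "x 0 \<noteq> 0" "y 1 \<noteq> 0" "x 2 \<noteq> 0" "x 3 \<noteq> 0" using nz[of 0] nz[of 1] nz[of 2] nz[of 3] e by auto
  have d: "real_of_int (p i * q j - p j * q i) = x i * y j - x j * y i" for i j
  proof -
    have "x i * y j - x j * y i = (A * D - B * C) * (real_of_int (p i) * real_of_int (q j) - real_of_int (p j) * real_of_int (q i))"
      unfolding x y by algebra
    then show ?thesis using det by simp
  qed
  have "real_of_int (p 0 * q 2 - p 2 * q 0) * real_of_int (p 1 * q 3 - p 3 * q 1) =
    r * (real_of_int (p 0 * q 3 - p 3 * q 0) * real_of_int (p 1 * q 2 - p 2 * q 1))"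
    unfolding d e by algebra
  moreover have "real_of_int (p 0 * q 3 - p 3 * q 0) * real_of_int (p 1 * q 2 - p 2 * q 1) \<noteq> 0"
    unfolding d e using ne by simp
  ultimately have "r = real_of_int (p 0 * q 2 - p 2 * q 0) * real_of_int (p 1 * q 3 - p 3 * q 1) /
    (real_of_int (p 0 * q 3 - p 3 * q 0) * real_of_int (p 1 * q 2 - p 2 * q 1))"
    by (simp only: eq_divide_eq not_False_eq_True if_True)
  also have "\<dots> \<in> \<rat>" by (intro Rats_divide Rats_mult Rats_of_int)
  finally show ?thesis .
qed

lemma base_column:
  assumes h: "a * d - b * c = 1" "h = psl2_of a b c d" and g: "A * D - B * C = 1" "g = psl2_of A B C D"
    and \<gamma>: "p * s - q' * q = (1::int)" "\<gamma> = psl2_of p q' q s" and base: "sq21 (inverse h * (g * \<gamma>)) = 0"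
  shows "a * (C * p + D * q) = c * (A * p + B * q)"
proof -
  have r: "real_of_int p * real_of_int s - real_of_int q' * real_of_int q = 1"
    using \<gamma>(1) by (metis of_int_1 of_int_diff of_int_mult)
  have i: "inverse h = psl2_of d (- b) (- c) a" using h by (simp add: psl2_of_inverse)
  have hd: "d * a - (- b) * (- c) = 1" using h(1) by (simp add: algebra_simps)
  have g\<gamma>: "g * \<gamma> = psl2_of (A * p + B * q) (A * q' + B * s) (C * p + D * q) (C * q' + D * s)"
    using g \<gamma>(2) r by (simp add: psl2_of_mult)
  have gd: "(A * p + B * q) * (C * q' + D * s) - (A * q' + B * s) * (C * p + D * q) = 1"
  proof -
    have "(A * p + B * q) * (C * q' + D * s) - (A * q' + B * s) * (C * p + D * q) =
      (A * D - B * C) * (real_of_int p * real_of_int s - real_of_int q' * real_of_int q)" by algebra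
    then show ?thesis using g(1) r by simp
  qed
  obtain a1 b1 c1 d1 where 1: "a1 * d1 - b1 * c1 = 1" "inverse h * (g * \<gamma>) = psl2_of a1 b1 c1 d1" by (metis psl2_cases)
  have m: "inverse h * (g * \<gamma>) = psl2_of (d * (A * p + B * q) + - b * (C * p + D * q)) (d * (A * q' + B * s) + - b * (C * q' + D * s))
     (- c * (A * p + B * q) + a * (C * p + D * q)) (- c * (A * q' + B * s) + a * (C * q' + D * s))" (is "_ = psl2_of ?a ?b ?c ?d")
    unfolding i g\<gamma> by (rule psl2_of_mult[OF hd gd])
  have "?a * ?d - ?b * ?c = (d * a - (- b) * (- c)) * ((A * p + B * q) * (C * q' + D * s) - (A * q' + B * s) * (C * p + D * q))"
    by algebra
  then have "?a * ?d - ?b * ?c = 1" unfolding hd gd by simp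
  then have "?c\<^sup>2 = 0" using base sq_psl2_of(2) unfolding m by metis
  then show ?thesis by simp
qed

theorem theorem9:
  fixes m m' :: nat and B B' :: "complex set" and X Y :: "psl2 set set"
  assumes "m \<ge> 2" and "m' \<ge> 2"
    and "admissible_bump 3 m B" and "admissible_bump 5 m' B'"
    and "X \<subseteq> tilings 3 m B" and "closedin (tiling_space 3 m B) X"
    and "\<And>g S. S \<in> X \<Longrightarrow> move_tiling g S \<in> X"
    and "\<exists>S\<in>X. nondegenerate 3 m S"
    and "Y \<subseteq> tilings 5 m' B'" and "closedin (tiling_space 5 m' B') Y"
    and "\<And>g S. S \<in> Y \<Longrightarrow> move_tiling g S \<in> Y"
  shows "\<not> topologically_conjugate
           move_tiling (subtopology (tiling_space 3 m B) X)
           move_tiling (subtopology (tiling_space 5 m' B') Y)"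
proof
  assume "topologically_conjugate move_tiling (subtopology (tiling_space 3 m B) X)
           move_tiling (subtopology (tiling_space 5 m' B') Y)"
  then obtain \<alpha> where \<alpha>: "homeomorphic_map (subtopology (tiling_space 3 m B) X) (subtopology (tiling_space 5 m' B') Y) \<alpha>"
    "\<And>g S. S \<in> topspace (subtopology (tiling_space 3 m B) X) \<Longrightarrow> \<alpha> (move_tiling g S) = move_tiling g (\<alpha> S)"
    unfolding topologically_conjugate_def by blast
  have top: "topspace (subtopology (tiling_space 3 m B) X) = X"
    using closedin_subset[OF assms(6)] by auto
  interpret X: hecke_tile 3 m using tile_3 assms(1) .
  interpret Y: hecke_tile 5 m' using tile_5 assms(2) .
  interpret conjugacy 3 m 5 m' B B' X Y \<alpha>
    by unfold_locales (use assms(3-7,9-11) \<alpha>[unfolded top] in simp_all)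
  obtain S where S: "S \<in> X" "nondegenerate 3 m S" using assms(8) by blast
  have i: "\<i> \<in> uhp" by (simp add: uhp_iff)
  obtain h0 where h0: "h0 \<in> \<alpha> S" using Y.row_tiling_cover[OF row_Y[OF alpha_Y[OF S(1)]] i] by metis
  define S1 where "S1 = move_tiling (inverse h0) S"
  have S1: "S1 \<in> X" "nondegenerate 3 m S1" using S assms(7) X.nondegenerate_move by (simp_all add: S1_def)
  have R1: "Y.row_tiling (\<alpha> S1)" using row_Y alpha_Y S1 by blast
  have one: "1 \<in> \<alpha> S1" using move_tilingI[OF h0, of "inverse h0"] S by (simp add: S1_def equivariant)
  obtain k where k: "k \<in> \<alpha> S1" "sq21 k \<noteq> 0"
    using image_cusps[OF refl S1] by (metis degenerate_def)
  have gap: "1 \<le> sq11 h * sq21 k" if "h \<in> \<alpha> S1" "sq21 h = 0" for h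
    using Y.horoball_gap[OF R1 that(1) k(1) that(2) k(2)] .
  \<comment> \<open>The horoball of \<open>k\<close> bounds the scales at \<open>\<infinity>\<close> from below, so there is a row that is lowest up to the factor \<open>2\<close>. It is moved to scale \<open>1\<close> below.\<close>
  have "\<exists>g\<in>\<alpha> S1. sq21 g = 0 \<and> (\<forall>h\<in>\<alpha> S1. sq21 h = 0 \<longrightarrow> sq11 g < 2 * sq11 h)"
  proof (rule ccontr)
    assume no: "\<not> ?thesis"
    have small: "\<exists>g\<in>\<alpha> S1. sq21 g = 0 \<and> sq11 g * 2 ^ N \<le> 1" for N
    proof (induction N)
      case 0
      have "sq21 1 = 0" "sq11 1 = 1" using sq_translation[of 0] by (simp_all add: translation_0)
      then show ?case using one by (intro bexI[of _ 1]) auto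
    next
      case (Suc N)
      then obtain g where g: "g \<in> \<alpha> S1" "sq21 g = 0" "sq11 g * 2 ^ N \<le> 1" by blast
      then obtain g' where g': "g' \<in> \<alpha> S1" "sq21 g' = 0" "2 * sq11 g' \<le> sq11 g" using no by (meson not_less)
      have "sq11 g' * 2 ^ Suc N = 2 * sq11 g' * 2 ^ N" by simp
      also have "\<dots> \<le> sq11 g * 2 ^ N" using g' by (intro mult_right_mono) auto
      finally have "sq11 g' * 2 ^ Suc N \<le> 1" using g by linarith
      then show ?case using g' by blast
    qed
    obtain N where N: "sq21 k < 2 ^ N" using real_arch_pow[of 2] by auto
    obtain g where g: "g \<in> \<alpha> S1" "sq21 g = 0" "sq11 g * 2 ^ N \<le> 1" using small by blast
    have "sq11 g * sq21 k < sq11 g * 2 ^ N" using N sq11_pos[OF g(2)] by (intro mult_strict_left_mono) auto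
    then show False using gap[OF g(1,2)] g(3) by linarith
  qed
  then obtain g0 where g0: "g0 \<in> \<alpha> S1" "sq21 g0 = 0" "\<And>h. h \<in> \<alpha> S1 \<Longrightarrow> sq21 h = 0 \<Longrightarrow> sq11 g0 < 2 * sq11 h"
    by blast
  define S2 where "S2 = move_tiling (inverse g0) S1"
  have S2: "S2 \<in> X" "nondegenerate 3 m S2" using S1 assms(7) X.nondegenerate_move by (simp_all add: S2_def)
  have T2: "\<alpha> S2 = move_tiling (inverse g0) (\<alpha> S1)" using S1 by (simp add: S2_def equivariant)
  have R2: "Y.row_tiling (\<alpha> S2)" using row_Y alpha_Y S2 by blast
  have one2: "1 \<in> \<alpha> S2" unfolding T2 using move_tilingI[OF g0(1), of "inverse g0"] by simp
  have lowest: "1 / 2 < sq11 g" if g: "g \<in> \<alpha> S2" "sq21 g = 0" for g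
  proof -
    obtain h where h: "h \<in> \<alpha> S1" "g = inverse g0 * h" using g(1) by (auto simp: T2 move_tiling_def)
    have e: "h = g0 * g" using h by simp
    have "sq21 h = 0" "sq11 h = sq11 g0 * sq11 g" unfolding e using g0(2) g(2) by (simp_all add: sq_upper_mult)
    then have "sq11 g0 * 1 < sq11 g0 * (2 * sq11 g)" using g0(3)[OF h(1)] by simp
    then have "1 < 2 * sq11 g" using sq11_pos[OF g0(2)] by (simp only: mult_less_cancel_left_pos)
    then show ?thesis by simp
  qed
  obtain g1 g2 g3 where g123: "g1 \<in> \<alpha> S2" "g2 \<in> \<alpha> S2" "g3 \<in> \<alpha> S2"
    "Y.turns g1 (2 * (pi / real 5))" "Y.turns g2 (4 * (pi / real 5))" "Y.turns g3 (6 * (pi / real 5))"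
    using Y.five_rows[OF refl R2 one2 lowest] by metis
  obtain g where g: "\<And>h. h \<in> \<alpha> S2 \<Longrightarrow> \<exists>\<gamma>\<in>hecke_group 3. sq21 (inverse h * (g * \<gamma>)) = 0"
    using image_cusps[OF refl S2] by metis
  obtain A Bb C D where G: "A * D - Bb * C = 1" "g = psl2_of A Bb C D" by (metis psl2_cases)
  \<comment> \<open>The base points of \<open>\<alpha> S2\<close> are images under \<open>g\<close> of rational points \<open>p / q\<close>.\<close>
  have cusp: "\<exists>(p::int) (q::int). (p, q) \<noteq> (0 :: int, 0 :: int) \<and> a * (C * p + D * q) = c * (A * p + Bb * q)"
    if h: "h \<in> \<alpha> S2" "a * d - b * c = 1" "h = psl2_of a b c d" for h a b c d
  proof -
    obtain \<gamma> where \<gamma>: "\<gamma> \<in> hecke_group 3" "sq21 (inverse h * (g * \<gamma>)) = 0" using g[OF h(1)] by blast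
    obtain p q' q s :: int where pq: "p * s - q' * q = 1" "\<gamma> = psl2_of p q' q s"
      using hecke_group_3_integral[OF \<gamma>(1)] by blast
    have "(p, q) \<noteq> (0, 0)" using pq(1) by auto
    moreover have "a * (C * p + D * q) = c * (A * p + Bb * q)"
      by (rule base_column[OF h(2,3) G pq \<gamma>(2)])
    ultimately show ?thesis by (intro exI conjI)
  qed
  have sn: "sin (pi / 5) > 0" using Y.width_bounds by simp
  \<comment> \<open>The four base points around the corner are \<open>\<infinity>\<close>, \<open>0\<close>, \<open>1 / \<lambda>\<close> and \<open>1\<close>.\<close>
  obtain p0 q0 :: int where 0: "(p0, q0) \<noteq> (0, 0)" "C * p0 + D * q0 = 0"
    using cusp[OF one2 _ psl2_one] by auto
  obtain p1 q1 :: int where 1: "(p1, q1) \<noteq> (0, 0)" "A * p1 + Bb * q1 = 0"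
  proof -
    have t: "Y.turns g1 (2 * real 1 * (pi / real 5))" using g123(4) by simp
    obtain a b c d where h: "a * d - b * c = 1" "g1 = psl2_of a b c d" "a * sin (real 1 * (pi / real 5)) = c * sin ((real 1 - 1) * (pi / real 5))"
      by (rule Y.turns_column[OF t])
    then have "a = 0" "c \<noteq> 0" using sn by auto
    then show thesis using cusp[OF g123(1) h(1,2)] that by auto
  qed
  obtain p2 q2 :: int where 2: "(p2, q2) \<noteq> (0, 0)" "C * p2 + D * q2 = hecke_width 5 * (A * p2 + Bb * q2)"
  proof -
    have t: "Y.turns g2 (2 * real 2 * (pi / real 5))" using g123(5) by simp
    obtain a b c d where h: "a * d - b * c = 1" "g2 = psl2_of a b c d" "a * sin (real 2 * (pi / real 5)) = c * sin ((real 2 - 1) * (pi / real 5))"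
      by (rule Y.turns_column[OF t])
    then have "a * hecke_width 5 * sin (pi / 5) = c * sin (pi / 5)" using golden_ratio(3) by simp
    then have c: "c = a * hecke_width 5" using sn by simp
    then have "a \<noteq> 0" using h(1) by auto
    obtain p q :: int where "(p, q) \<noteq> (0, 0)" "a * (C * p + D * q) = c * (A * p + Bb * q)"
      using cusp[OF g123(2) h(1,2)] by blast
    then show thesis using that[of p q] c \<open>a \<noteq> 0\<close> by simp
  qed
  obtain p3 q3 :: int where 3: "(p3, q3) \<noteq> (0, 0)" "C * p3 + D * q3 = A * p3 + Bb * q3"
  proof -
    have t: "Y.turns g3 (2 * real 3 * (pi / real 5))" using g123(6) by simp
    obtain a b c d where h: "a * d - b * c = 1" "g3 = psl2_of a b c d" "a * sin (real 3 * (pi / real 5)) = c * sin ((real 3 - 1) * (pi / real 5))"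
      by (rule Y.turns_column[OF t])
    then have "a * sin (2 * (pi / 5)) = c * sin (2 * (pi / 5))" using golden_ratio(2) by simp
    moreover have "sin (2 * (pi / 5)) > 0" unfolding golden_ratio(3) using sn Y.width_bounds by simp
    ultimately have c: "c = a" by simp
    then have "a \<noteq> 0" using h(1) by auto
    obtain p q :: int where "(p, q) \<noteq> (0, 0)" "a * (C * p + D * q) = c * (A * p + Bb * q)"
      using cusp[OF g123(3) h(1,2)] by blast
    then show thesis using that[of p q] c \<open>a \<noteq> 0\<close> by simp
  qed
  define p where "p j = (if j = 0 then p0 else if j = 1 then p1 else if j = 2 then p2 else p3)" for j :: nat
  define q where "q j = (if j = 0 then q0 else if j = 1 then q1 else if j = 2 then q2 else q3)" for j :: nat
  have "hecke_width 5 \<in> \<rat>"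
  proof (rule integral_cross_ratio[OF G(1), of p q "\<lambda>j. A * p j + Bb * q j" "\<lambda>j. C * p j + D * q j"])
    show "(p j, q j) \<noteq> (0, 0)" for j using 0(1) 1(1) 2(1) 3(1) by (auto simp: p_def q_def)
  qed (use 0(2) 1(2) 2(2) 3(2) in \<open>simp_all add: p_def q_def\<close>)
  moreover have "hecke_width 5 > 0" using Y.width_bounds by simp
  ultimately show False using golden_ratio_irrational golden_ratio(1) by blast
qed

end
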